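(* Let $2\le k\le3$, let $\boldsymbol{j}=(j_1,\dots,j_r)$ with $r\ge2$ be a vector of distinct integers, and let $\boldsymbol{a}=(a_1,\dots,a_r)$ be a vector of integers with $a_i\ge1$, $a_r=1$ and $\sum_{i=1}^ra_i=k$. Let $0<\vartheta\le1$ be fixed and such that hypothesis $\mathrm{EH}(\vartheta)$ (defined in the context) holds. Let $\epsilon>0$ be fixed and suppose $N^{\epsilon}\ll R\ll N^{\frac{\vartheta}{k-1}-\epsilon}$ and $\max_i|j_i|\ll N^{\frac1{k-1}-\epsilon}$. Then, as $N\to\infty$, $$\sum_{n=1}^N\lambda_R(n+j_1)^{a_1}\cdots\lambda_R(n+j_{r-1})^{a_{r-1}}\Lambda(n+j_r)=\bigl(\mathfrak{S}(\boldsymbol{j})+o(1)\bigr)N(\log R)^{k-r}.$$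
   Context: For $n\ge1$ and $R\ge1$, $\lambda_R(n)=\sum_{q\le R}\frac{\mu^2(q)}{\phi(q)}\sum_{d\mid (q,n)}d\,\mu(d)$ (with $\mu$ the Möbius function, $\phi$ Euler's function), and $\lambda_R(n)=0$ for $n\le0$. $\Lambda$ is the von Mangoldt function, with $\Lambda(n)=0$ for $n\le0$. For a vector $\boldsymbol{j}=(j_1,\dots,j_r)$ of distinct integers, $\mathfrak{S}(\boldsymbol{j})=\prod_p\left(1-\frac1p\right)^{-r}\left(1-\frac{\nu_p(\boldsymbol{j})}{p}\right)$, where $\nu_p(\boldsymbol{j})$ is the number of distinct residue classes modulo the prime $p$ occupied by the $j_i$. Put $\psi(x;q,a)=\sum_{n\le x,\ n\equiv a\,(\mathrm{mod}\ q)}\Lambda(n)$ and $E(x;q,a)=\psi(x;q,a)-[(a,q)=1]\frac{x}{\phi(q)}$, where $[P]$ is $1$ if $P$ is true and $0$ otherwise. Hypothesis $\mathrm{EH}(\vartheta)$: for every $\epsilon'>0$ and every $\mathcal{A}>0$, $$\sum_{1\le q\le x^{\vartheta-\epsilon'}}\max_{(a,q)=1}|E(x;q,a)|\ll\frac{x}{\log^{\mathcal{A}}x}$$ for all sufficiently large $x$. (It holds unconditionally for $\vartheta\le\frac12$ by the Bombieri–Vinogradov theorem.) $N$ is a large natural number; $R$ and $\boldsymbol{j}$ may vary with $N$ subject to the stated conditions, and the $o(1)$ (as $N\to\infty$) is uniform in them. *)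

theory Defs
  imports "HOL-Analysis.Analysis" "HOL-Number_Theory.Number_Theory"
    "HOL-Computational_Algebra.Squarefree" "HOL-Library.Landau_Symbols"
begin

definition moebius_mu :: "nat \<Rightarrow> real" where
  "moebius_mu n = (if squarefree n then (-1) ^ card (prime_factors n) else 0)"

definition lambda_R :: "real \<Rightarrow> int \<Rightarrow> real" where
  "lambda_R R n = (if n \<le> 0 then 0 else
     (\<Sum>q | 1 \<le> q \<and> real q \<le> R. (moebius_mu q)\<^sup>2 / real (totient q) *
        (\<Sum>d | d dvd gcd q (nat n). real d * moebius_mu d)))"

definition Lambda :: "int \<Rightarrow> real" where
  "Lambda n = (if n \<le> 0 then 0 else mangoldt (nat n))"

text \<open>
  An \<open>r\<close>-tuple is a function on \<^typ>\<open>nat\<close> of which only the values at \<open>1, \<dots>, r\<close> are used.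
\<close>

definition nu :: "nat \<Rightarrow> nat \<Rightarrow> (nat \<Rightarrow> int) \<Rightarrow> nat" where
  "nu p r j = card ((\<lambda>i. j i mod int p) ` {1..r})"

text \<open>
  The product over primes is an infinite product over all natural numbers with factor \<open>1\<close> at the
  non-primes. For distinct \<open>j 1, \<dots>, j r\<close> one has \<open>nu p r j = r\<close> for all but finitely many primes
  \<open>p\<close>, so the factors are \<open>1 + O(1/p\<^sup>2)\<close> and the product converges absolutely.
  It is \<open>0\<close> iff \<open>nu p r j = p\<close> for some prime \<open>p\<close>; \<^const>\<open>prodinf\<close> admits such zero factors.
\<close>

definition singular_series :: "nat \<Rightarrow> (nat \<Rightarrow> int) \<Rightarrow> real" where
  "singular_series r j = prodinf (\<lambda>p. if prime p
     then (1 - 1 / real p) powi (- int r) * (1 - real (nu p r j) / real p) else 1)"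

definition psi :: "real \<Rightarrow> nat \<Rightarrow> int \<Rightarrow> real" where
  "psi x q a = (\<Sum>n | 1 \<le> n \<and> real n \<le> x \<and> [int n = a] (mod int q). mangoldt n)"

definition E :: "real \<Rightarrow> nat \<Rightarrow> int \<Rightarrow> real" where
  "E x q a = psi x q a - (if coprime a (int q) then x / real (totient q) else 0)"

text \<open>
  As a function of \<open>a\<close>, \<^term>\<open>E x q a\<close> has period \<open>q\<close>; hence the maximum over all integers \<open>a\<close>
  coprime to \<open>q\<close> below is a maximum of a finite nonempty set of values.
\<close>

lemma E_mod: "E x q (a mod int q) = E x q a"
  by (simp add: E_def psi_def cong_def coprime_mod_left_iff)
     (cases "q = 0"; simp add: coprime_mod_left_iff)

lemma finite_E_values:
  assumes "q \<ge> 1"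
  shows "finite ((\<lambda>a. \<bar>E x q a\<bar>) ` {a. coprime a (int q)})"
proof (rule finite_subset)
  show "(\<lambda>a. \<bar>E x q a\<bar>) ` {a. coprime a (int q)} \<subseteq> (\<lambda>a. \<bar>E x q a\<bar>) ` {0..<int q}"
  proof safe
    fix a :: int
    have "a mod int q \<in> {0..<int q}" using assms by simp
    moreover have "\<bar>E x q a\<bar> = \<bar>E x q (a mod int q)\<bar>" by (simp add: E_mod)
    ultimately show "\<bar>E x q a\<bar> \<in> (\<lambda>a. \<bar>E x q a\<bar>) ` {0..<int q}" by (rule rev_image_eqI)
  qed
qed simp

definition EH :: "real \<Rightarrow> bool" where
  "EH \<theta> \<longleftrightarrow> (\<forall>\<epsilon>'>0. \<forall>A>0.
     (\<lambda>x::real. \<Sum>q | 1 \<le> q \<and> real q \<le> x powr (\<theta> - \<epsilon>'). MAX a\<in>{a. coprime a (int q)}. \<bar>E x q a\<bar>)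
       \<in> O[at_top](\<lambda>x. x / ln x powr A))"

end

theory Submission
  imports Defs "HOL-Real_Asymp.Real_Asymp"
begin

text \<open>
  Write \<open>\<lambda>\<^sub>R(n)\<close> as a divisor sum \<open>\<Sum>\<^bsub>d | n, d \<le> R\<^esub> w(d)\<close>; the weights satisfy \<open>w(d) \<lless> log\<^sup>3 R\<close>.
  All three cases reduce to \<open>\<Sum>\<^bsub>m \<le> N\<^esub> \<Lambda>(m) \<lambda>\<^bsub>Q1\<^esub>(m + h1) \<lambda>\<^bsub>Q2\<^esub>(m + h2)\<close>, where \<open>Q2 = 1\<close> for
  \<open>k = 2\<close> (as \<open>\<lambda>\<^sub>1 = 1\<close>) and \<open>h1 = h2\<close> for the square. Opening both divisor sums leads to primes in
  progressions modulo \<open>lcm(d1, d2) \<le> Q1 Q2\<close>; a modulus \<open>D\<close> occurs at most \<open>\<tau>(D)\<^sup>2\<close> times, which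
  Cauchy-Schwarz and the trivial bound for \<open>E\<close> absorb, so that EH applies.

  The remaining main term is a truncated sum over pairs of squarefree numbers with an
  Euler product of local weights. If it converges absolutely, Rankin's trick compares it with the
  singular series, the primes dividing the shifts costing only \<open>\<tau>(H)\<^bsup>O(1)\<^esup>\<close>. If \<open>h1 = h2\<close>, the local
  factor at \<open>p\<close> is first multiplied by \<open>1 - XY/p\<close>: the main term becomes an absolutely convergent sum of
  harmonic sums \<open>\<Sum>\<^bsub>u \<le> Q/M\<^esub> 1/u = log Q + O(1 + log M)\<close>, and Rankin's trick with exponent
  of order \<open>1/log log N\<close> bounds the error by \<open>o(log N)\<close> uniformly in the shifts.
\<close>

section \<open>Divisor bounds\<close>

text \<open>The weights play two roles. Against the error terms only their size matters. In the main
  term they are opened once more, back to the sums over q1 and q2 in the definition of lambda_R: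
  mu^2(q)/phi(q) and the inner divisor sums are multiplicative, so truncation is the only obstacle
  to an Euler product. Uniformity in the shifts shapes the rest, since the singular series is not
  bounded. If h1, h2 and h1 - h2 are nonzero, truncation saves a power of N and a loss of tau(H)^48
  is harmless. On the diagonal a single logarithm is available: a Rankin exponent s costs 1/s, and
  the primes dividing h cost exp(10 S) with S the sum of p^(4s - 1) over p | h. For s about 1/(4 log
  log N) it suffices that S = o(log log N), so any bound o(log y) for the sum of 1/p over p \<le> y
  will do; an elementary O(sqrt(log y)) replaces the theorem of Mertens. A last obstacle is that
  \<open>lambda_R\<close> vanishes at n \<le> 0, whereas divisor sums depend on residue classes
  only. They are therefore extended to all integers, and the few affected terms are bounded
  trivially.\<close>

definition divisor_count :: "nat \<Rightarrow> nat" where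
  "divisor_count n = card {d. d dvd n}"

lemma divisor_count_pos: "n > 0 \<Longrightarrow> divisor_count n > 0"
  by (auto simp: divisor_count_def card_gt_0_iff)

lemma divisor_count_mult_le:
  assumes "m > 0" "n > 0"
  shows "divisor_count (m * n) \<le> divisor_count m * divisor_count n"
proof -
  have "{d. d dvd m * n} \<subseteq> (\<lambda>(a, b). a * b) ` ({d. d dvd m} \<times> {d. d dvd n})"
  proof
    fix d assume "d \<in> {d. d dvd m * n}"
    then obtain b c where "d = b * c" "b dvd m" "c dvd n" using division_decomp[of d m n] by auto
    thus "d \<in> (\<lambda>(a, b). a * b) ` ({d. d dvd m} \<times> {d. d dvd n})"
      by (intro image_eqI[where x = "(b, c)"]) auto
  qed
  hence "card {d. d dvd m * n} \<le> card ({d. d dvd m} \<times> {d. d dvd n})"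
    using assms by (intro surj_card_le) auto
  thus ?thesis by (simp add: divisor_count_def card_cartesian_product)
qed

text \<open>Induction on \<open>j\<close>: one factor tau(n) is spent as a sum over d | n, and
  tau(n) \<le> tau(d) tau(n/d) splits the remaining power, so that each step at most squares the
  bound.\<close>

lemma sum_divisor_count_power_le:
  "(\<Sum>n=1..x. real (divisor_count n) ^ j / real n) \<le> harm x ^ (2 ^ j)"
proof (induction j)
  case 0
  show ?case by (simp add: harm_def divide_inverse)
next
  case (Suc j)
  define g where "g d = real (divisor_count d) ^ j / real d" for d
  have g_nonneg: "g d \<ge> 0" for d by (simp add: g_def)
  have "(\<Sum>n=1..x. real (divisor_count n) ^ Suc j / real n) =
      (\<Sum>n=1..x. \<Sum>d | d dvd n. g n)"
    by (simp add: g_def divisor_count_def)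
  also have "\<dots> \<le> (\<Sum>n=1..x. \<Sum>d | d dvd n. g d * g (n div d))"
  proof (intro sum_mono)
    fix n d assume n: "n \<in> {1..x}" and d: "d \<in> {d. d dvd n}"
    then obtain e where e: "n = d * e" by auto
    have pos: "d > 0" "e > 0" using e n by auto
    have "real (divisor_count n) \<le> real (divisor_count d) * real (divisor_count e)"
      using divisor_count_mult_le[OF pos] e by (metis of_nat_le_iff of_nat_mult)
    hence "real (divisor_count n) ^ j \<le> (real (divisor_count d) * real (divisor_count e)) ^ j"
      by (intro power_mono) auto
    thus "g n \<le> g d * g (n div d)"
      using pos by (simp add: g_def e power_mult_distrib divide_right_mono)
  qed
  also have "\<dots> = (\<Sum>(n,d)\<in>(SIGMA n:{1..x}. {d. d dvd n}). g d * g (n div d))"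
    by (subst sum.Sigma) auto
  also have "\<dots> = (\<Sum>(d,e)\<in>(\<lambda>(n,d). (d, n div d)) ` (SIGMA n:{1..x}. {d. d dvd n}). g d * g e)"
    by (subst sum.reindex) (auto simp: inj_on_def intro!: sum.cong)
  also have "\<dots> \<le> (\<Sum>(d,e)\<in>{1..x} \<times> {1..x}. g d * g e)"
  proof (rule sum_mono2)
    show "(\<lambda>(n,d). (d, n div d)) ` (SIGMA n:{1..x}. {d. d dvd n}) \<subseteq> {1..x} \<times> {1..x}"
    proof (clarsimp)
      fix n d :: nat assume *: "Suc 0 \<le> n" "n \<le> x" "d dvd n"
      have "d \<noteq> 0" "d \<le> n" using * dvd_imp_le[of d n] by (auto intro!: Nat.gr0I)
      moreover have "n div d \<noteq> 0" using * by (auto simp: dvd_div_eq_0_iff)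
      ultimately show "Suc 0 \<le> d \<and> d \<le> x \<and> Suc 0 \<le> n div d \<and> n div d \<le> x"
        using * div_le_dividend[of n d] by linarith
    qed
  qed (auto simp: g_nonneg)
  also have "\<dots> = (\<Sum>d=1..x. g d) * (\<Sum>d=1..x. g d)"
    by (simp add: sum_product sum.cartesian_product)
  also have "\<dots> \<le> harm x ^ (2 ^ j) * harm x ^ (2 ^ j)"
    using Suc.IH by (intro mult_mono) (auto simp: g_def harm_nonneg intro!: sum_nonneg)
  finally show ?case by (simp only: power_Suc mult_2 power_add)
qed

lemma harm_le_ln:
  assumes "n > 0"
  shows "harm n \<le> 1 + ln (real n)"
proof -
  obtain m where n: "n = Suc m" using assms gr0_conv_Suc by blast
  have "harm (Suc m) - ln (real (Suc m)) \<le> harm (Suc 0) - ln (real (Suc 0))"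
    using decseqD[OF decseq_harm_diff_ln, of 0 m] by simp
  thus ?thesis using n by (simp add: harm_Suc harm_expand)
qed

text \<open>This is log(x^s) \<le> x^s - 1 divided by s. It turns logarithmic errors into the powers
  on which Rankin's trick acts, at the price 1/s.\<close>

lemma one_plus_ln_le_powr:
  fixes x s :: real
  assumes "x \<ge> 1" "0 < s" "s \<le> 1"
  shows "1 + ln x \<le> x powr s / s"
proof -
  have "s * ln x \<le> x powr s - 1"
    using ln_le_minus_one[of "x powr s"] assms by (simp add: ln_powr)
  hence "s * (1 + ln x) \<le> x powr s" using assms by (simp add: algebra_simps)
  thus ?thesis using assms by (simp add: field_simps)
qed

text \<open>A single term of the \<open>j\<close>-th moment is at most the whole moment, which is a
  power of a logarithm. Hence tau(n)^j << n^2, and \<open>j\<close>-th roots with j \<ge> 2/\<delta>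
  give the exponent.\<close>

lemma divisor_count_le_powr:
  assumes "\<delta> > 0"
  obtains C :: real where "C > 0" "\<And>n. n > 0 \<Longrightarrow> real (divisor_count n) \<le> C * real n powr \<delta>"
proof -
  define j where "j = nat \<lceil>2 / \<delta>\<rceil>"
  have j: "real j \<ge> 2 / \<delta>" "j > 0" using assms by (auto simp: j_def)
  hence jd: "real j * \<delta> \<ge> 2" using assms by (simp add: field_simps)
  define K :: nat where "K = 2 ^ j"
  have K: "K \<ge> 1" by (simp add: K_def)
  define C where "C = (real K ^ K) powr (1 / real j)"
  have "C > 0" using K by (auto simp: C_def)
  moreover have "real (divisor_count n) \<le> C * real n powr \<delta>" if n: "n > 0" for n
  proof -
    have n1: "real n \<ge> 1" using n by simp
    have "real (divisor_count n) ^ j / real n \<le> (\<Sum>m=1..n. real (divisor_count m) ^ j / real m)"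
      using n by (intro member_le_sum) auto
    also have "\<dots> \<le> harm n ^ K" unfolding K_def by (rule sum_divisor_count_power_le)
    also have "\<dots> \<le> (1 + ln (real n)) ^ K"
      using harm_le_ln[OF n] by (intro power_mono) (auto simp: harm_nonneg)
    \<comment> \<open>The exponent 1/K is chosen because the K-th power then leaves a single factor
      n.\<close>
    also have "\<dots> \<le> (real n powr (1 / real K) / (1 / real K)) ^ K"
      using n1 K by (intro power_mono one_plus_ln_le_powr) (auto simp: add_nonneg_nonneg)
    also have "\<dots> = real K ^ K * real n"
    proof -
      have "(real n powr (1 / real K)) ^ K = (real n powr (1 / real K)) powr real K"
        using n by (subst powr_realpow) auto
      also have "\<dots> = real n" using n K by (simp add: powr_powr)
      finally show ?thesis using K by (simp add: power_divide power_mult_distrib)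
    qed
    finally have "real (divisor_count n) ^ j \<le> real K ^ K * real n * real n"
      using n by (simp add: field_simps)
    also have "\<dots> = real K ^ K * real n powr 2" using n by (simp add: power2_eq_square)
    also have "\<dots> \<le> real K ^ K * real n powr (real j * \<delta>)"
      using jd n1 by (intro mult_left_mono powr_mono) auto
    finally have "(real (divisor_count n) ^ j) powr (1 / real j)
        \<le> (real K ^ K * real n powr (real j * \<delta>)) powr (1 / real j)"
      by (intro powr_mono2) auto
    also have "(real (divisor_count n) ^ j) powr (1 / real j) = real (divisor_count n)"
    proof -
      have "real (divisor_count n) ^ j = real (divisor_count n) powr real j"
        using divisor_count_pos[OF n] by (subst powr_realpow) auto
      thus ?thesis using j divisor_count_pos[OF n] by (simp add: powr_powr)
    qed
    also have "(real K ^ K * real n powr (real j * \<delta>)) powr (1 / real j) = C * real n powr \<delta>"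
      using j n K by (simp add: powr_mult powr_powr C_def)
    finally show ?thesis .
  qed
  ultimately show ?thesis using that by blast
qed

section \<open>Squarefree numbers as products of sets of primes\<close>

lemma prime_factors_prod_primes:
  fixes X :: "nat set"
  assumes "finite X" "\<And>p. p \<in> X \<Longrightarrow> prime p"
  shows "prime_factors (\<Prod>X) = X"
proof -
  have "0 \<notin> (\<lambda>x. x) ` X" using assms(2) not_prime_0 by (metis imageE)
  hence "prime_factors (\<Prod>X) = \<Union>((prime_factors \<circ> (\<lambda>x. x)) ` X)"
    by (rule prime_factors_prod[OF assms(1)])
  also have "\<dots> = (\<Union>p\<in>X. {p})"
    using assms(2) by (intro SUP_cong) (auto simp: prime_prime_factors)
  finally show ?thesis by simp
qed

lemma squarefree_prod_primes:
  fixes X :: "nat set"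
  assumes "\<And>p. p \<in> X \<Longrightarrow> prime p"
  shows "squarefree (\<Prod>X)"
  using assms by (intro squarefree_prod_coprime) (auto intro: primes_coprime squarefree_prime)

lemma prod_primes_pos:
  fixes X :: "nat set"
  assumes "\<And>p. p \<in> X \<Longrightarrow> prime p"
  shows "\<Prod>X > 0"
  using assms by (intro prod_pos) (auto simp: prime_gt_0_nat)

lemma squarefree_prod_prime_factors:
  fixes n :: nat
  assumes "squarefree n"
  shows "\<Prod>(prime_factors n) = n"
proof -
  have "n \<noteq> 0" using assms by (intro notI) simp
  have "n = (\<Prod>p\<in>prime_factors n. p ^ multiplicity p n)"
    using \<open>n \<noteq> 0\<close> by (intro Primes.prime_factorization_nat) auto
  also have "\<dots> = (\<Prod>p\<in>prime_factors n. p)"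
    using assms squarefree_factorial_semiring'[OF \<open>n \<noteq> 0\<close>] by (intro prod.cong) auto
  finally show ?thesis by simp
qed

text \<open>This dictionary turns sums over squarefree integers into sums over subsets of
  \<open>A\<close>, where Euler products expand by finite combinatorics.\<close>

lemma bij_betw_prod_primes:
  fixes A :: "nat set"
  assumes "finite A" "\<And>p. p \<in> A \<Longrightarrow> prime p"
  shows "bij_betw Prod (Pow A) {q. squarefree q \<and> prime_factors q \<subseteq> A}"
proof (rule bij_betw_byWitness[where f' = prime_factors])
  have fin: "finite X" if "X \<subseteq> A" for X using assms(1) that finite_subset by blast
  show "\<forall>X\<in>Pow A. prime_factors (\<Prod>X) = X"
    using fin assms by (auto intro!: prime_factors_prod_primes)
  show "\<forall>q\<in>{q. squarefree q \<and> prime_factors q \<subseteq> A}. \<Prod>(prime_factors q) = q"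
    by (auto simp: squarefree_prod_prime_factors)
  show "Prod ` Pow A \<subseteq> {q. squarefree q \<and> prime_factors q \<subseteq> A}"
  proof safe
    fix X assume X: "X \<subseteq> A"
    show "squarefree (\<Prod>X)" using X assms by (intro squarefree_prod_primes) auto
    fix p assume "p \<in> prime_factors (\<Prod>X)"
    thus "p \<in> A" using prime_factors_prod_primes[OF fin[OF X]] X assms by auto
  qed
qed auto

text \<open>Distinct subsets of the prime factors have distinct products, and each of these products
  divides \<open>n\<close>.\<close>

lemma two_power_card_prime_factors_le:
  assumes "n > 0"
  shows "2 ^ card (prime_factors n) \<le> divisor_count n"
proof -
  let ?A = "prime_factors n"
  have *: "inj_on Prod (Pow ?A)"
    using bij_betw_prod_primes[of ?A] by (auto simp: bij_betw_def)
  have "2 ^ card ?A = card (Prod ` Pow ?A)"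
    using * by (subst card_image) (auto simp: card_Pow)
  also have "\<dots> \<le> card {d. d dvd n}"
  proof (rule card_mono)
    show "Prod ` Pow ?A \<subseteq> {d. d dvd n}"
    proof safe
      fix X assume "X \<subseteq> ?A"
      hence "\<Prod>X dvd \<Prod>?A" by (intro prod_dvd_prod_subset) auto
      also have "\<Prod>?A dvd (\<Prod>p\<in>?A. p ^ multiplicity p n)"
        using assms by (intro prod_dvd_prod) (auto simp: prime_factors_multiplicity)
      also have "\<dots> = n" using assms by (intro Primes.prime_factorization_nat [symmetric]) auto
      finally show "\<Prod>X dvd n" .
    qed
  qed (use assms in auto)
  finally show ?thesis by (simp add: divisor_count_def)
qed

text \<open>From 2^omega(n) \<le> tau(n) \<le> n; the estimate log 2 \<ge> 2/3 rounds the constant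
  1/log 2 up to 2.\<close>

lemma card_prime_factors_le_ln:
  assumes "n > 0"
  shows "real (card (prime_factors n)) \<le> 2 * ln (real n)"
proof -
  have "divisor_count n \<le> card {1..n}" unfolding divisor_count_def
    using assms by (intro card_mono) (auto dest: dvd_imp_le intro!: Nat.gr0I simp: Suc_le_eq)
  hence "2 ^ card (prime_factors n) \<le> n" using two_power_card_prime_factors_le[OF assms] by simp
  hence "(2::real) ^ card (prime_factors n) \<le> real n"
    by (metis of_nat_le_iff of_nat_numeral of_nat_power)
  hence "ln (2 ^ card (prime_factors n)) \<le> ln (real n)" using assms by (subst ln_le_cancel_iff) auto
  hence "real (card (prime_factors n)) * ln 2 \<le> ln (real n)" by (simp add: ln_realpow)
  moreover have "real (card (prime_factors n)) * (2/3) \<le> real (card (prime_factors n)) * ln 2"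
    using ln2_ge_two_thirds by (intro mult_left_mono) auto
  moreover have "ln (real n) \<ge> 0" using assms by simp
  ultimately show ?thesis by linarith
qed

text \<open>Expanding the product gives the sum of 1/d over the squarefree divisors d of
  \<open>n\<close>, which are distinct and at most \<open>n\<close>.\<close>

lemma prod_one_plus_inverse_le_harm:
  assumes "n > 0"
  shows "(\<Prod>p\<in>prime_factors n. 1 + 1 / real p) \<le> harm n"
proof -
  let ?A = "prime_factors n"
  have inj: "inj_on Prod (Pow ?A)"
    using bij_betw_prod_primes[of ?A] by (auto simp: bij_betw_def)
  have "(\<Prod>p\<in>?A. 1 / real p + 1) = (\<Sum>X\<in>Pow ?A. (\<Prod>p\<in>X. 1 / real p) * (\<Prod>p\<in>?A-X. 1))"
    by (rule prod_add) auto
  also have "\<dots> = (\<Sum>X\<in>Pow ?A. 1 / real (\<Prod>X))"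
    by (simp only: prod_dividef prod.neutral_const mult_1_right of_nat_prod)
  also have "\<dots> = (\<Sum>d\<in>Prod ` Pow ?A. 1 / real d)"
    by (subst sum.reindex[OF inj]) simp
  also have "\<dots> \<le> (\<Sum>d\<in>{1..n}. 1 / real d)"
  proof (rule sum_mono2)
    show "Prod ` Pow ?A \<subseteq> {1..n}"
    proof safe
      fix X assume X: "X \<subseteq> ?A"
      have "\<Prod>X > 0" using X by (intro prod_primes_pos) auto
      have "\<Prod>X dvd \<Prod>?A" using X by (intro prod_dvd_prod_subset) auto
      also have "\<Prod>?A dvd (\<Prod>p\<in>?A. p ^ multiplicity p n)"
        using assms by (intro prod_dvd_prod) (auto simp: prime_factors_multiplicity)
      also have "\<dots> = n" using assms by (intro Primes.prime_factorization_nat [symmetric]) auto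
      finally show "\<Prod>X \<in> {1..n}" using assms \<open>\<Prod>X > 0\<close> by (auto dest: dvd_imp_le)
    qed
  qed auto
  also have "\<dots> = harm n" by (simp add: harm_def divide_inverse)
  finally show ?thesis by (simp add: add.commute)
qed

text \<open>Each factor (1 - 1/p)^(-1) is at most (1 + 1/p)^2, which reduces the quotient to the
  square of the preceding product.\<close>

lemma real_div_totient_le:
  assumes "n > 0"
  shows "real n / real (totient n) \<le> harm n ^ 2"
proof -
  let ?A = "prime_factors n"
  have pr: "prime p" if "p \<in> ?A" for p using that by auto
  have "real n / real (totient n) = (\<Prod>p\<in>?A. 1 / (1 - 1 / real p))"
  proof -
    have "(\<Prod>p\<in>?A. 1 / (1 - 1 / real p)) = 1 / (\<Prod>p\<in>?A. 1 - 1 / real p)"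
      by (simp only: prod_dividef prod.neutral_const)
    thus ?thesis using assms unfolding totient_formula2[of n] by simp
  qed
  also have "\<dots> \<le> (\<Prod>p\<in>?A. (1 + 1 / real p) ^ 2)"
  proof (intro prod_mono conjI)
    fix p assume "p \<in> ?A"
    hence p: "real p \<ge> 2" using prime_ge_2_nat[OF pr] by auto
    show "0 \<le> 1 / (1 - 1 / real p)" using p by (auto simp: field_simps)
    \<comment> \<open>After expansion, p^3 \<le> (p + 1)^2 (p - 1) says p (p - 1) \<ge> 1.\<close>
    have "0 \<le> (real p) * (real p - 1) - 1" using mult_mono[of 2 "real p" 1 "real p - 1"] p by auto
    hence "real p * (real p)\<^sup>2 \<le> (real p + 1)\<^sup>2 * (real p - 1)"
      by (simp add: power2_eq_square algebra_simps)
    hence "real p * (real p)\<^sup>2 / (real p)\<^sup>2 \<le> (real p + 1)\<^sup>2 * (real p - 1) / (real p)\<^sup>2"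
      by (rule divide_right_mono) simp
    hence "real p \<le> (real p + 1)\<^sup>2 / (real p)\<^sup>2 * (real p - 1)" using p by simp
    hence "real p / (real p - 1) \<le> (real p + 1)\<^sup>2 / (real p)\<^sup>2"
      using p by (intro mult_imp_div_pos_le) auto
    moreover have "1 / (1 - 1 / real p) = real p / (real p - 1)" using p by (simp add: field_simps)
    moreover have "1 + 1 / real p = (real p + 1) / real p" using p by (simp add: field_simps)
    ultimately show "1 / (1 - 1 / real p) \<le> (1 + 1 / real p)\<^sup>2"
      by (simp add: power_divide)
  qed
  also have "\<dots> = (\<Prod>p\<in>?A. 1 + 1 / real p) ^ 2" by (rule prod_power_distrib [symmetric])
  also have "\<dots> \<le> harm n ^ 2"
    using prod_one_plus_inverse_le_harm[OF assms] by (intro power_mono prod_nonneg) auto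
  finally show ?thesis .
qed

text \<open>In the square, the products pq with p \<le> q are distinct integers up to y^2 by unique
  factorization; the factor 2 accounts for the order. The resulting O(sqrt(log y)) is far from the
  true log log y, but \<open>diagonal_error_small\<close> asks only for o(log y).\<close>

lemma sum_prime_reciprocals_le:
  "(\<Sum>p | prime p \<and> p \<le> y. 1 / real p) ^ 2 \<le> 2 * harm (y ^ 2)"
proof -
  let ?P = "{p. prime p \<and> p \<le> y}"
  define f where "f = (\<lambda>(p::nat, q). 1 / real (p * q))"
  let ?S = "{(p, q). p \<in> ?P \<and> q \<in> ?P \<and> p \<le> q}"
  let ?T = "{(p, q). p \<in> ?P \<and> q \<in> ?P \<and> q \<le> p}"
  have fin: "finite ?P" by (rule finite_subset[of _ "{..y}"]) auto
  have finS: "finite ?S" "finite ?T" by (rule finite_subset[of _ "?P \<times> ?P"]; use fin in auto)+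
  have inj: "inj_on (\<lambda>(p, q). p * q) ?S"
  proof (rule inj_onI; clarify)
    fix p q p' q' :: nat
    assume *: "prime p" "prime q" "prime p'" "prime q'" "p \<le> q" "p' \<le> q'" "p * q = p' * q'"
    have "p dvd p' * q'" "q dvd p' * q'" "p' dvd p * q"
      using *(7) by (metis dvd_triv_left dvd_triv_right)+
    hence "p = p' \<or> p = q'" "q = p' \<or> q = q'" "p' = p \<or> p' = q"
      using * by (metis prime_dvd_mult_iff primes_dvd_imp_eq)+
    moreover have "p > 0" "q > 0" using * prime_gt_0_nat by auto
    ultimately show "p = p' \<and> q = q'" using *(5-7) by auto
  qed
  have "(\<Sum>p\<in>?P. 1 / real p) ^ 2 = (\<Sum>x\<in>?P \<times> ?P. f x)"
    by (simp add: power2_eq_square sum_product sum.cartesian_product f_def case_prod_unfold)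
  also have "?P \<times> ?P = ?S \<union> ?T" by auto
  also have "(\<Sum>x\<in>?S \<union> ?T. f x) \<le> (\<Sum>x\<in>?S. f x) + (\<Sum>x\<in>?T. f x)"
  proof -
    have "(\<Sum>x\<in>?S \<union> ?T. f x) = (\<Sum>x\<in>?S. f x) + (\<Sum>x\<in>?T. f x) - (\<Sum>x\<in>?S \<inter> ?T. f x)"
      by (rule sum_Un[OF finS])
    thus ?thesis using sum_nonneg[of "?S \<inter> ?T" f] by (auto simp: f_def)
  qed
  also have "(\<Sum>x\<in>?T. f x) = (\<Sum>x\<in>?S. f x)"
    by (rule sum.reindex_bij_witness[of _ prod.swap prod.swap]) (auto simp: f_def mult.commute)
  also have "(\<Sum>x\<in>?S. f x) = (\<Sum>n\<in>(\<lambda>(p, q). p * q) ` ?S. 1 / real n)"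
    by (subst sum.reindex[OF inj]) (simp add: f_def case_prod_unfold)
  also have "\<dots> \<le> (\<Sum>n\<in>{1..y^2}. 1 / real n)"
    by (rule sum_mono2)
       (auto simp: power2_eq_square Suc_le_eq intro!: mult_le_mono prime_gt_0_nat)
  also have "\<dots> = harm (y ^ 2)" by (simp add: harm_def divide_inverse)
  finally show ?thesis by simp
qed

section \<open>Divisor sums and primes in progressions\<close>

text \<open>Unlike \<open>lambda_R\<close>, this depends on divisibility alone, hence is a linear
  combination of indicators of residue classes on all integers. The two differ at n \<le> 0, which
  \<open>boundary_terms_le\<close> takes into account.\<close>

definition lam :: "nat \<Rightarrow> int \<Rightarrow> real" where
  "lam Q n = (\<Sum>q=1..Q. (moebius_mu q)\<^sup>2 / real (totient q) *
     (\<Sum>d | d dvd q \<and> int d dvd n. real d * moebius_mu d))"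

text \<open>The weight w(d): interchanging the sums over q and d in \<open>lam\<close> collects here
  all q divisible by d.\<close>

definition lam_weight :: "nat \<Rightarrow> nat \<Rightarrow> real" where
  "lam_weight Q d = real d * moebius_mu d *
     (\<Sum>q | q \<in> {1..Q} \<and> d dvd q. (moebius_mu q)\<^sup>2 / real (totient q))"

lemma lambda_R_eq_lam: "lambda_R R n = (if n \<le> 0 then 0 else lam (nat \<lfloor>R\<rfloor>) n)"
proof (cases "n \<le> 0")
  case False
  have "real q \<le> R \<longleftrightarrow> q \<le> nat \<lfloor>R\<rfloor>" if "q \<ge> 1" for q
    using that by linarith
  hence "{q. 1 \<le> q \<and> real q \<le> R} = {1..nat \<lfloor>R\<rfloor>}" by auto
  moreover have "d dvd gcd q (nat n) \<longleftrightarrow> d dvd q \<and> int d dvd n" for d q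
    using False by (metis gcd_nat.bounded_iff int_dvd_int_iff int_nat_eq linorder_not_le less_imp_le)
  ultimately show ?thesis using False by (simp add: lambda_R_def lam_def)
qed (simp add: lambda_R_def)

lemma abs_moebius_mu_le: "\<bar>moebius_mu n\<bar> \<le> 1"
  by (simp add: moebius_mu_def)

lemma moebius_mu_power2_le: "(moebius_mu n)\<^sup>2 \<le> 1"
  using abs_moebius_mu_le[of n] by (simp add: abs_square_le_1)

lemma lam_1 [simp]: "lam (Suc 0) n = 1"
proof -
  have "{d. d = Suc 0 \<and> int d dvd n} = {Suc 0}" by auto
  thus ?thesis by (simp add: lam_def moebius_mu_def)
qed

lemma lam_eq_sum_lam_weight:
  "lam Q n = (\<Sum>d | d \<in> {1..Q} \<and> int d dvd n. lam_weight Q d)"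
proof -
  define f where "f q d = (moebius_mu q)\<^sup>2 / real (totient q) * (real d * moebius_mu d)" for q d
  have "lam Q n = (\<Sum>q\<in>{1..Q}. \<Sum>d\<in>{d\<in>{1..Q}. d dvd q \<and> int d dvd n}. f q d)"
    unfolding lam_def sum_distrib_left f_def
  proof (intro sum.cong refl)
    fix q assume "q \<in> {1..Q}"
    thus "{d. d dvd q \<and> int d dvd n} = {d\<in>{1..Q}. d dvd q \<and> int d dvd n}"
      by (auto dest: dvd_imp_le intro!: Nat.gr0I simp: Suc_le_eq)
  qed
  also have "\<dots> = (\<Sum>q\<in>{1..Q}. \<Sum>d\<in>{1..Q}. if d dvd q \<and> int d dvd n then f q d else 0)"
    by (intro sum.cong refl sum.inter_filter) auto
  also have "\<dots> = (\<Sum>d\<in>{1..Q}. \<Sum>q\<in>{1..Q}. if d dvd q \<and> int d dvd n then f q d else 0)"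
    by (rule sum.swap)
  also have "\<dots> = (\<Sum>d\<in>{1..Q}. if int d dvd n then lam_weight Q d else 0)"
  proof (intro sum.cong refl)
    fix d
    have "(\<Sum>q\<in>{1..Q}. if d dvd q then f q d else 0) = (\<Sum>q\<in>{q\<in>{1..Q}. d dvd q}. f q d)"
      by (intro sum.inter_filter [symmetric]) auto
    also have "\<dots> = lam_weight Q d"
      by (simp add: lam_weight_def f_def sum_distrib_left mult_ac)
    finally show "(\<Sum>q\<in>{1..Q}. if d dvd q \<and> int d dvd n then f q d else 0) =
        (if int d dvd n then lam_weight Q d else 0)" by auto
  qed
  also have "\<dots> = (\<Sum>d\<in>{d\<in>{1..Q}. int d dvd n}. lam_weight Q d)"
    by (intro sum.inter_filter [symmetric]) auto
  finally show ?thesis by simp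
qed

text \<open>Put q = d m and let H be the harmonic number of \<open>Q\<close>. The factor
  \<open>d\<close> cancels against the q in 1/phi(q) \<le> H^2/q, and the sum of 1/m supplies the
  third H.\<close>

lemma abs_lam_weight_le:
  assumes "d > 0"
  shows "\<bar>lam_weight Q d\<bar> \<le> harm Q ^ 3"
proof -
  let ?S = "{q. q \<in> {1..Q} \<and> d dvd q}"
  have S: "?S = (*) d ` {1..Q div d}"
  proof safe
    fix q assume "q \<in> {1..Q}" "d dvd q"
    then obtain m where "q = d * m" by auto
    thus "q \<in> (*) d ` {1..Q div d}" using \<open>q \<in> {1..Q}\<close> assms
      by (auto simp: Suc_le_eq less_eq_div_iff_mult_less_eq mult.commute)
  qed (use assms in \<open>auto simp: Suc_le_eq less_eq_div_iff_mult_less_eq mult.commute\<close>)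
  have nonneg: "(\<Sum>q\<in>?S. (moebius_mu q)\<^sup>2 / real (totient q)) \<ge> 0" by (intro sum_nonneg) auto
  have "\<bar>lam_weight Q d\<bar> = real d * \<bar>moebius_mu d\<bar> * (\<Sum>q\<in>?S. (moebius_mu q)\<^sup>2 / real (totient q))"
    using nonneg by (simp add: lam_weight_def abs_mult)
  also have "\<dots> \<le> real d * 1 * (\<Sum>q\<in>?S. (moebius_mu q)\<^sup>2 / real (totient q))"
    using nonneg abs_moebius_mu_le by (intro mult_right_mono mult_left_mono) auto
  also have "\<dots> \<le> real d * 1 * (\<Sum>q\<in>?S. harm Q ^ 2 / real q)"
  proof (intro mult_left_mono sum_mono)
    fix q assume q: "q \<in> ?S"
    have "(moebius_mu q)\<^sup>2 / real (totient q) \<le> 1 / real (totient q)"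
      using moebius_mu_power2_le by (intro divide_right_mono) auto
    also have "\<dots> = (real q / real (totient q)) / real q" using q by simp
    also have "\<dots> \<le> harm q ^ 2 / real q"
      using q real_div_totient_le[of q] by (intro divide_right_mono) auto
    also have "\<dots> \<le> harm Q ^ 2 / real q"
      using q by (intro divide_right_mono power_mono harm_mono harm_nonneg) auto
    finally show "(moebius_mu q)\<^sup>2 / real (totient q) \<le> harm Q ^ 2 / real q" .
  qed auto
  also have "\<dots> = harm Q ^ 2 * (\<Sum>q\<in>?S. real d / real q)"
    by (simp add: sum_distrib_left mult_ac)
  also have "(\<Sum>q\<in>?S. real d / real q) = (\<Sum>m=1..Q div d. 1 / real m)"
    unfolding S using assms by (subst sum.reindex) (auto simp: inj_on_def)
  also have "\<dots> = harm (Q div d)" by (simp add: harm_def divide_inverse)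
  also have "harm Q ^ 2 * harm (Q div d) \<le> harm Q ^ 2 * (harm Q :: real)"
    by (intro mult_left_mono harm_mono) (auto simp: div_le_dividend)
  finally show ?thesis by (simp add: power2_eq_square power3_eq_cube)
qed

lemma abs_lam_le_divisor_count:
  assumes "n \<noteq> 0"
  shows "\<bar>lam Q n\<bar> \<le> real (divisor_count (nat \<bar>n\<bar>)) * harm Q ^ 3"
proof -
  let ?S = "{d. d \<in> {1..Q} \<and> int d dvd n}"
  have "\<bar>lam Q n\<bar> \<le> (\<Sum>d\<in>?S. harm Q ^ 3)"
    unfolding lam_eq_sum_lam_weight
    by (rule order_trans[OF sum_abs sum_mono]) (auto intro!: abs_lam_weight_le)
  also have "\<dots> = real (card ?S) * harm Q ^ 3" by simp
  also have "\<dots> \<le> real (divisor_count (nat \<bar>n\<bar>)) * harm Q ^ 3"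
  proof -
    have "?S \<subseteq> {d. d dvd nat \<bar>n\<bar>}" by (auto simp: int_dvd_int_iff [symmetric])
    hence "card ?S \<le> divisor_count (nat \<bar>n\<bar>)"
      unfolding divisor_count_def using assms by (intro card_mono finite_divisors_nat) auto
    thus ?thesis by (intro mult_right_mono) (auto simp: harm_nonneg)
  qed
  finally show ?thesis .
qed

text \<open>Unlike the divisor bound, this also covers n = 0, which every modulus divides.\<close>

lemma abs_lam_le: "\<bar>lam Q n\<bar> \<le> real Q * harm Q ^ 3"
proof -
  let ?S = "{d. d \<in> {1..Q} \<and> int d dvd n}"
  have "\<bar>lam Q n\<bar> \<le> (\<Sum>d\<in>?S. harm Q ^ 3)"
    unfolding lam_eq_sum_lam_weight
    by (rule order_trans[OF sum_abs sum_mono]) (auto intro!: abs_lam_weight_le)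
  also have "\<dots> = real (card ?S) * harm Q ^ 3" by simp
  also have "card ?S \<le> card {1..Q}" by (intro card_mono) auto
  hence "real (card ?S) * harm Q ^ 3 \<le> real Q * harm Q ^ 3"
    by (intro mult_right_mono) (auto simp: harm_nonneg)
  finally show ?thesis .
qed

section \<open>Primes in the intersection of two residue classes\<close>

definition Psi2 :: "nat \<Rightarrow> int \<Rightarrow> int \<Rightarrow> nat \<Rightarrow> nat \<Rightarrow> real" where
  "Psi2 N h1 h2 d1 d2 =
     (\<Sum>m | m \<in> {1..N} \<and> int d1 dvd int m + h1 \<and> int d2 dvd int m + h2. mangoldt m)"

text \<open>The expected density in \<open>Psi2\<close>. The two classes are compatible iff gcd(d1,
  d2) divides h1 - h2; they then form one class modulo the lcm, which is reduced iff both
  coprimality conditions hold.\<close>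

definition rho2 :: "int \<Rightarrow> int \<Rightarrow> nat \<Rightarrow> nat \<Rightarrow> real" where
  "rho2 h1 h2 d1 d2 =
     (if coprime (int d1) h1 \<and> coprime (int d2) h2 \<and> int (gcd d1 d2) dvd h1 - h2
      then 1 / real (totient (lcm d1 d2)) else 0)"

definition Emax :: "real \<Rightarrow> nat \<Rightarrow> real" where
  "Emax x q = (MAX a\<in>{a. coprime a (int q)}. \<bar>E x q a\<bar>)"

lemma abs_E_le_Emax: "q > 0 \<Longrightarrow> coprime a (int q) \<Longrightarrow> \<bar>E x q a\<bar> \<le> Emax x q"
  unfolding Emax_def by (intro Max_ge finite_E_values) auto

lemma Emax_nonneg: "q > 0 \<Longrightarrow> Emax x q \<ge> 0"
  using abs_E_le_Emax[of q 1 x] by (simp add: order_trans[OF abs_ge_zero])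

lemma Emax_leI:
  assumes "q > 0" "\<And>a. coprime a (int q) \<Longrightarrow> \<bar>E x q a\<bar> \<le> B"
  shows "Emax x q \<le> B"
proof -
  have "(1::int) \<in> {a. coprime a (int q)}" by simp
  hence "(\<lambda>a. \<bar>E x q a\<bar>) ` {a. coprime a (int q)} \<noteq> {}" by blast
  moreover have "finite ((\<lambda>a. \<bar>E x q a\<bar>) ` {a. coprime a (int q)})"
    using assms(1) by (intro finite_E_values) simp
  ultimately show ?thesis unfolding Emax_def using assms(2) by (subst Max_le_iff) auto
qed

text \<open>Only powers of \<open>p\<close> contribute. Those up to \<open>N\<close> divide the
  largest one, p^K, and the sum of Lambda over the divisors of p^K is log p^K.\<close>

lemma sum_mangoldt_multiples_le:
  assumes "prime p" "N > 0"
  shows "(\<Sum>m | m \<in> {1..N} \<and> p dvd m. mangoldt m :: real) \<le> ln (real N)"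
proof -
  have p: "p \<ge> 2" using assms prime_ge_2_nat by auto
  define K where "K = Max {k. p ^ k \<le> N}"
  have "k \<le> N" if "p ^ k \<le> N" for k
  proof -
    have "k < 2 ^ k" by simp
    also have "(2::nat) ^ k \<le> p ^ k" using p by (intro power_mono) auto
    finally show ?thesis using that by simp
  qed
  hence "{k. p ^ k \<le> N} \<subseteq> {..N}" by blast
  hence fin: "finite {k. p ^ k \<le> N}" by (rule finite_subset) simp
  have "0 \<in> {k. p ^ k \<le> N}" using assms by simp
  hence K: "p ^ K \<le> N" using Max_in[OF fin] unfolding K_def by blast
  have le_K: "k \<le> K" if "p ^ k \<le> N" for k unfolding K_def using that by (intro Max_ge[OF fin]) simp
  have dvd: "m dvd p ^ K" if m: "m \<le> N" "p dvd m" "primepow m" for m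
  proof -
    obtain q k where q: "prime q" "k > 0" "m = q ^ k" using m(3) by (auto simp: primepow_def)
    hence "p dvd q" using m(2) assms(1) prime_dvd_power by blast
    hence "p = q" using q(1) assms(1) primes_dvd_imp_eq by blast
    thus ?thesis using q m(1) le_K[of k] by (auto intro: le_imp_power_dvd)
  qed
  have "(\<Sum>m | m \<in> {1..N} \<and> p dvd m. mangoldt m :: real) =
      (\<Sum>m | m \<in> {1..N} \<and> p dvd m \<and> primepow m. mangoldt m)"
    by (rule sum.mono_neutral_right) (auto simp: mangoldt_def)
  also have "\<dots> \<le> (\<Sum>m | m dvd p ^ K. mangoldt m)"
  proof (rule sum_mono2)
    show "finite {m. m dvd p ^ K}" using p by (intro finite_divisors_nat) simp
    show "{m. m \<in> {1..N} \<and> p dvd m \<and> primepow m} \<subseteq> {m. m dvd p ^ K}"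
      using dvd by fastforce
  qed (rule mangoldt_nonneg)
  also have "\<dots> = ln (real (p ^ K))" using p by (subst mangoldt_sum) auto
  also have "\<dots> \<le> ln (real N)"
  proof -
    have "real (p ^ K) \<le> real N" using K by (rule of_nat_mono)
    moreover have "real (p ^ K) > 0" using p by simp
    ultimately show ?thesis by (rule ln_mono)
  qed
  finally show ?thesis .
qed

text \<open>For moduli with a common factor, compatibility modulo the gcd replaces coprimality; a
  Bezout relation supplies the solution.\<close>

lemma chinese_remainder_compatible:
  fixes d1 d2 b1 b2 :: int
  assumes "gcd d1 d2 dvd b1 - b2"
  obtains a where "[a = b1] (mod d1)" "[a = b2] (mod d2)"
proof -
  obtain u v where uv: "u * d1 + v * d2 = gcd d1 d2" using bezout_int by blast
  obtain t where t: "b1 - b2 = gcd d1 d2 * t" using assms by auto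
  have "[b1 - u * d1 * t = b1] (mod d1)" by (simp add: cong_iff_dvd_diff)
  moreover have "b1 - u * d1 * t - b2 = d2 * (v * t)"
  proof -
    have "b1 - u * d1 * t - b2 = (u * d1 + v * d2) * t - u * d1 * t" unfolding uv t [symmetric] by simp
    also have "\<dots> = d2 * (v * t)" by (simp add: ring_distribs mult_ac)
    finally show ?thesis .
  qed
  hence "[b1 - u * d1 * t = b2] (mod d2)" by (simp add: cong_iff_dvd_diff)
  ultimately show ?thesis using that by blast
qed

text \<open>Incompatible classes make both terms 0, and a reduced class leaves a value of
  \<open>E\<close>. A class that is not reduced consists of multiples of one prime, so its total
  Lambda-mass is at most log N.\<close>

lemma abs_Psi2_minus_main_le:
  assumes "d1 > 0" "d2 > 0" "N > 0"
  shows "\<bar>Psi2 N h1 h2 d1 d2 - real N * rho2 h1 h2 d1 d2\<bar> \<le> Emax (real N) (lcm d1 d2) + ln (real N)"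
proof -
  let ?D = "lcm d1 d2"
  have D: "?D > 0" using assms by (simp add: lcm_pos_nat)
  have lnN: "ln (real N) \<ge> 0" using assms by simp
  show ?thesis
  proof (cases "int (gcd d1 d2) dvd h1 - h2")
    case False
    have "\<not> (int d1 dvd int m + h1 \<and> int d2 dvd int m + h2)" for m
    proof
      assume "int d1 dvd int m + h1 \<and> int d2 dvd int m + h2"
      moreover have "int (gcd d1 d2) dvd int d1" "int (gcd d1 d2) dvd int d2"
        by (simp_all only: int_dvd_int_iff gcd_dvd1 gcd_dvd2)
      ultimately have "int (gcd d1 d2) dvd (int m + h1) - (int m + h2)"
        by (intro dvd_diff) (auto elim: dvd_trans[rotated])
      thus False using False by simp
    qed
    hence *: "{m. m \<in> {1..N} \<and> int d1 dvd int m + h1 \<and> int d2 dvd int m + h2} = {}" by blast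
    have "Psi2 N h1 h2 d1 d2 = 0" unfolding Psi2_def * by simp
    thus ?thesis using False Emax_nonneg[OF D, of N] lnN by (simp add: rho2_def)
  next
    case True
    have "gcd (int d1) (int d2) dvd (- h1) - (- h2)"
      using True dvd_minus_iff[of "int (gcd d1 d2)" "h1 - h2"] by simp
    then obtain a where a: "[a = - h1] (mod int d1)" "[a = - h2] (mod int d2)"
      by (rule chinese_remainder_compatible)
    have a': "int d1 dvd a + h1" "int d2 dvd a + h2" using a by (auto simp: cong_iff_dvd_diff)
    have iff: "int d1 dvd int m + h1 \<and> int d2 dvd int m + h2 \<longleftrightarrow> [int m = a] (mod int ?D)" for m
    proof -
      have "int d1 dvd int m + h1 \<longleftrightarrow> int d1 dvd int m - a"
        using dvd_add_left_iff[OF a'(1), of "int m - a"] by (simp only: add.assoc [symmetric] diff_add_cancel)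
      moreover have "int d2 dvd int m + h2 \<longleftrightarrow> int d2 dvd int m - a"
        using dvd_add_left_iff[OF a'(2), of "int m - a"] by (simp only: add.assoc [symmetric] diff_add_cancel)
      moreover have "[int m = a] (mod int ?D) \<longleftrightarrow> lcm (int d1) (int d2) dvd int m - a"
        by (simp add: cong_iff_dvd_diff)
      ultimately show ?thesis using lcm_least_iff[of "int d1" "int d2" "int m - a"] by blast
    qed
    have Psi: "Psi2 N h1 h2 d1 d2 = psi (real N) ?D a"
      unfolding Psi2_def psi_def iff by (intro sum.cong) auto
    have cop1: "coprime a (int d1) \<longleftrightarrow> coprime (int d1) h1"
      using cong_imp_coprime[OF a(1)] cong_imp_coprime[OF cong_sym[OF a(1)]]
      by (auto simp: coprime_commute)
    have cop2: "coprime a (int d2) \<longleftrightarrow> coprime (int d2) h2"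
      using cong_imp_coprime[OF a(2)] cong_imp_coprime[OF cong_sym[OF a(2)]]
      by (auto simp: coprime_commute)
    have cop: "coprime a (int ?D) \<longleftrightarrow> coprime (int d1) h1 \<and> coprime (int d2) h2"
    proof -
      have "coprime a (int ?D) \<longleftrightarrow> coprime a (int d1) \<and> coprime a (int d2)"
      proof safe
        assume *: "coprime a (int ?D)"
        have "int d1 dvd int ?D" "int d2 dvd int ?D" by (simp_all only: int_dvd_int_iff dvd_lcm1 dvd_lcm2)
        thus "coprime a (int d1)" "coprime a (int d2)" 
          using coprime_divisors[OF dvd_refl _ *] by blast+
      next
        assume "coprime a (int d1)" "coprime a (int d2)"
        hence "coprime a (int d1 * int d2)" by simp
        moreover have "?D dvd d1 * d2" by (intro lcm_least dvd_triv_left dvd_triv_right)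
        hence "int ?D dvd int d1 * int d2" by (simp only: of_nat_mult [symmetric] int_dvd_int_iff)
        ultimately show "coprime a (int ?D)" using coprime_divisors[OF dvd_refl] by blast
      qed
      thus ?thesis using cop1 cop2 by simp
    qed
    show ?thesis
    proof (cases "coprime a (int ?D)")
      case c: True
      have "Psi2 N h1 h2 d1 d2 - real N * rho2 h1 h2 d1 d2 = E (real N) ?D a"
        using c True unfolding Psi E_def rho2_def cop by simp
      thus ?thesis using abs_E_le_Emax[OF D c, of "real N"] lnN by simp
    next
      case False
      hence rho: "rho2 h1 h2 d1 d2 = 0" using cop by (auto simp: rho2_def)
      obtain p :: int where p: "prime p" "p dvd a" "p dvd int ?D"
      proof -
        obtain c where c: "c dvd a" "c dvd int ?D" "\<not> is_unit c" using False by (rule not_coprimeE)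
        have "c \<noteq> 0" using c(2) D by auto
        then obtain p where p: "p dvd c" "prime p" using prime_divisor_exists[of c] c(3) by auto
        show ?thesis by (rule that[of p, OF p(2) dvd_trans[OF p(1) c(1)] dvd_trans[OF p(1) c(2)]])
      qed
      define p' where "p' = nat p"
      have p': "prime p'" "p = int p'" using p(1) prime_ge_0_int[OF p(1)] by (simp_all add: p'_def)
      have "psi (real N) ?D a \<le> (\<Sum>m | m \<in> {1..N} \<and> p' dvd m. mangoldt m)"
        unfolding psi_def
      proof (rule sum_mono2)
        show "{n. 1 \<le> n \<and> real n \<le> real N \<and> [int n = a] (mod int ?D)} \<subseteq> {m. m \<in> {1..N} \<and> p' dvd m}"
        proof safe
          fix n assume "[int n = a] (mod int ?D)"
          hence "p dvd int n - a" 
            using dvd_trans[OF p(3)] by (simp add: cong_iff_dvd_diff)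
          hence "p dvd int n" using dvd_add[OF _ p(2), of "int n - a"] by simp
          thus "p' dvd n" unfolding p'(2) by (simp only: int_dvd_int_iff)
        qed auto
      qed (auto simp: mangoldt_nonneg)
      also have "\<dots> \<le> ln (real N)" using p' assms by (intro sum_mangoldt_multiples_le) auto
      finally have "psi (real N) ?D a \<le> ln (real N)" .
      moreover have "psi (real N) ?D a \<ge> 0" unfolding psi_def by (intro sum_nonneg mangoldt_nonneg)
      ultimately show ?thesis using Emax_nonneg[OF D, of N] by (simp add: rho Psi)
    qed
  qed
qed

definition corr :: "nat \<Rightarrow> nat \<Rightarrow> int \<Rightarrow> int \<Rightarrow> nat \<Rightarrow> real" where
  "corr Q1 Q2 h1 h2 N =
     (\<Sum>m=1..N. mangoldt m * lam Q1 (int m + h1) * lam Q2 (int m + h2))"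

definition main_term :: "nat \<Rightarrow> nat \<Rightarrow> int \<Rightarrow> int \<Rightarrow> real" where
  "main_term Q1 Q2 h1 h2 =
     (\<Sum>d1=1..Q1. \<Sum>d2=1..Q2. lam_weight Q1 d1 * lam_weight Q2 d2 * rho2 h1 h2 d1 d2)"

lemma corr_eq_sum_Psi2:
  "corr Q1 Q2 h1 h2 N =
     (\<Sum>d1=1..Q1. \<Sum>d2=1..Q2. lam_weight Q1 d1 * lam_weight Q2 d2 * Psi2 N h1 h2 d1 d2)"
proof -
  define I where "I d h m = (if int d dvd int m + h then 1 else 0 :: real)" for d h m
  have lam: "lam Q (int m + h) = (\<Sum>d=1..Q. lam_weight Q d * I d h m)" for Q m h
  proof -
    have "lam Q (int m + h) = (\<Sum>d\<in>{1..Q}. if int d dvd int m + h then lam_weight Q d else 0)"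
      unfolding lam_eq_sum_lam_weight by (rule sum.inter_filter) simp
    thus ?thesis by (simp add: I_def if_distrib cong: if_cong)
  qed
  have "corr Q1 Q2 h1 h2 N = (\<Sum>m=1..N. \<Sum>d1=1..Q1. \<Sum>d2=1..Q2.
      lam_weight Q1 d1 * lam_weight Q2 d2 * (mangoldt m * I d1 h1 m * I d2 h2 m))"
    unfolding corr_def lam
    by (simp add: sum_product sum_distrib_left mult_ac)
  also have "\<dots> = (\<Sum>d1=1..Q1. \<Sum>m=1..N. \<Sum>d2=1..Q2.
      lam_weight Q1 d1 * lam_weight Q2 d2 * (mangoldt m * I d1 h1 m * I d2 h2 m))"
    by (rule sum.swap)
  also have "\<dots> = (\<Sum>d1=1..Q1. \<Sum>d2=1..Q2. \<Sum>m=1..N.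
      lam_weight Q1 d1 * lam_weight Q2 d2 * (mangoldt m * I d1 h1 m * I d2 h2 m))"
    by (intro sum.cong refl sum.swap)
  also have "\<dots> = (\<Sum>d1=1..Q1. \<Sum>d2=1..Q2. lam_weight Q1 d1 * lam_weight Q2 d2 * Psi2 N h1 h2 d1 d2)"
  proof (intro sum.cong refl)
    fix d1 d2
    have "Psi2 N h1 h2 d1 d2 = (\<Sum>m\<in>{1..N}. if int d1 dvd int m + h1 \<and> int d2 dvd int m + h2
        then mangoldt m else 0)"
      unfolding Psi2_def by (rule sum.inter_filter) simp
    also have "\<dots> = (\<Sum>m=1..N. mangoldt m * I d1 h1 m * I d2 h2 m)"
      by (intro sum.cong) (auto simp: I_def)
    finally show "(\<Sum>m=1..N. lam_weight Q1 d1 * lam_weight Q2 d2 * (mangoldt m * I d1 h1 m * I d2 h2 m))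
        = lam_weight Q1 d1 * lam_weight Q2 d2 * Psi2 N h1 h2 d1 d2"
      by (simp add: sum_distrib_left)
  qed
  finally show ?thesis .
qed

lemma abs_corr_minus_main_le:
  assumes "N > 0"
  shows "\<bar>corr Q1 Q2 h1 h2 N - real N * main_term Q1 Q2 h1 h2\<bar> \<le>
    harm Q1 ^ 3 * harm Q2 ^ 3 *
      (\<Sum>d1=1..Q1. \<Sum>d2=1..Q2. Emax (real N) (lcm d1 d2) + ln (real N))"
proof -
  have eq: "corr Q1 Q2 h1 h2 N - real N * main_term Q1 Q2 h1 h2 =
      (\<Sum>d1=1..Q1. \<Sum>d2=1..Q2. lam_weight Q1 d1 * lam_weight Q2 d2 *
         (Psi2 N h1 h2 d1 d2 - real N * rho2 h1 h2 d1 d2))"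
    unfolding corr_eq_sum_Psi2 main_term_def
    by (simp only: sum_distrib_left right_diff_distrib sum_subtractf mult.left_commute[of "real N"])
  have "\<bar>corr Q1 Q2 h1 h2 N - real N * main_term Q1 Q2 h1 h2\<bar> \<le>
      (\<Sum>d1=1..Q1. \<Sum>d2=1..Q2. \<bar>lam_weight Q1 d1 * lam_weight Q2 d2 *
         (Psi2 N h1 h2 d1 d2 - real N * rho2 h1 h2 d1 d2)\<bar>)"
    unfolding eq by (rule order_trans[OF sum_abs], rule sum_mono, rule sum_abs)
  also have "\<dots> \<le> (\<Sum>d1=1..Q1. \<Sum>d2=1..Q2. harm Q1 ^ 3 * harm Q2 ^ 3 *
      (Emax (real N) (lcm d1 d2) + ln (real N)))"
    unfolding abs_mult
    by (intro sum_mono mult_mono abs_lam_weight_le abs_Psi2_minus_main_le)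
       (use assms in \<open>auto simp: harm_nonneg\<close>)
  finally show ?thesis by (simp add: sum_distrib_left)
qed

section \<open>Averaging the error over the moduli\<close>

lemma sum_Emax_lcm_le:
  assumes "Q1 * Q2 \<le> Y"
  shows "(\<Sum>d1=1..Q1. \<Sum>d2=1..Q2. Emax x (lcm d1 d2)) \<le>
    (\<Sum>D=1..Y. real (divisor_count D) ^ 2 * Emax x D)"
proof -
  let ?P = "{1..Q1} \<times> {1..Q2}"
  let ?l = "\<lambda>(d1, d2). lcm d1 (d2 :: nat)"
  have sub: "?l ` ?P \<subseteq> {1..Y}"
  proof safe
    fix d1 d2 :: nat assume d: "d1 \<in> {1..Q1}" "d2 \<in> {1..Q2}"
    have "lcm d1 d2 dvd d1 * d2" by (intro lcm_least dvd_triv_left dvd_triv_right)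
    hence "lcm d1 d2 \<le> d1 * d2" using d by (intro dvd_imp_le) auto
    also have "\<dots> \<le> Q1 * Q2" using d by (intro mult_le_mono) auto
    finally have "lcm d1 d2 \<le> Y" using assms by simp
    moreover have "lcm d1 d2 > 0" using d by (intro lcm_pos_nat) auto
    ultimately show "lcm d1 d2 \<in> {1..Y}" by simp
  qed
  have "(\<Sum>d1=1..Q1. \<Sum>d2=1..Q2. Emax x (lcm d1 d2)) = (\<Sum>z\<in>?P. Emax x (?l z))"
    by (simp add: sum.cartesian_product case_prod_unfold)
  also have "\<dots> = (\<Sum>D=1..Y. \<Sum>z\<in>{z\<in>?P. ?l z = D}. Emax x (?l z))"
    by (rule sum.group[OF _ _ sub, symmetric]) auto
  also have "\<dots> \<le> (\<Sum>D=1..Y. real (divisor_count D) ^ 2 * Emax x D)"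
  proof (rule sum_mono)
    fix D assume D: "D \<in> {1..Y}"
    have "{z\<in>?P. ?l z = D} \<subseteq> {d. d dvd D} \<times> {d. d dvd D}" by auto
    hence "card {z\<in>?P. ?l z = D} \<le> card ({d. d dvd D} \<times> {d. d dvd D})"
      using D by (intro card_mono) auto
    also have "\<dots> = divisor_count D ^ 2"
      by (simp add: divisor_count_def card_cartesian_product power2_eq_square)
    finally have "real (card {z\<in>?P. ?l z = D}) \<le> real (divisor_count D ^ 2)" by (rule of_nat_mono)
    hence "real (card {z\<in>?P. ?l z = D}) * Emax x D \<le> real (divisor_count D) ^ 2 * Emax x D"
      using D Emax_nonneg[of D x] by (intro mult_right_mono) auto
    moreover have "(\<Sum>z\<in>{z\<in>?P. ?l z = D}. Emax x (?l z)) = (\<Sum>z\<in>{z\<in>?P. ?l z = D}. Emax x D)"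
      by (intro sum.cong) auto
    ultimately show "(\<Sum>z\<in>{z\<in>?P. ?l z = D}. Emax x (?l z)) \<le> real (divisor_count D) ^ 2 * Emax x D"
      by simp
  qed
  finally show ?thesis .
qed

lemma card_residue_class_le:
  assumes "D > 0"
  shows "card {n. n \<in> {1..N} \<and> [int n = a] (mod int D)} \<le> N div D + 1"
proof -
  let ?S = "{n. n \<in> {1..N} \<and> [int n = a] (mod int D)}"
  have "inj_on (\<lambda>n. n div D) ?S"
  proof (rule inj_onI)
    fix m n assume *: "m \<in> ?S" "n \<in> ?S" "m div D = n div D"
    hence "[int m = int n] (mod int D)" by (auto intro: cong_trans cong_sym)
    hence "[m = n] (mod D)" by (simp only: cong_int_iff)
    hence "m mod D = n mod D" by (simp only: cong_def)
    thus "m = n" using *(3) by (metis mult_div_mod_eq)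
  qed
  moreover have "(\<lambda>n. n div D) ` ?S \<subseteq> {..N div D}" by (auto intro: div_le_mono)
  ultimately have "card ?S \<le> card {..N div D}" by (intro card_inj_on_le) auto
  thus ?thesis by simp
qed

text \<open>A class has at most N/D + 1 \<le> 2N/D members up to \<open>N\<close>, each with Lambda
  at most log N; the comparison term N/phi(D) is at most N/D times two logarithms.\<close>

lemma Emax_trivial_bound:
  assumes "1 \<le> D" "D \<le> N"
  shows "Emax (real N) D \<le> 3 * real N * (1 + ln (real N)) ^ 2 / real D"
proof (rule Emax_leI)
  show "D > 0" using assms by simp
  fix a assume a: "coprime a (int D)"
  define L where "L = 1 + ln (real N)"
  have L: "L \<ge> 1" using assms by (simp add: L_def)
  have L2: "L \<le> L ^ 2" using L by (simp add: power2_eq_square)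
  let ?S = "{n. n \<in> {1..N} \<and> [int n = a] (mod int D)}"
  have "psi (real N) D a = (\<Sum>n\<in>?S. mangoldt n)"
    unfolding psi_def by (intro sum.cong) auto
  also have "\<dots> \<le> (\<Sum>n\<in>?S. L)"
  proof (rule sum_mono)
    fix n assume n: "n \<in> ?S"
    have "mangoldt n \<le> ln (real n)" using n by (intro mangoldt_le) auto
    also have "\<dots> \<le> ln (real N)" using n by (intro ln_mono) auto
    finally show "mangoldt n \<le> L" by (simp add: L_def)
  qed
  also have "\<dots> = real (card ?S) * L" by simp
  also have "\<dots> \<le> (2 * real N / real D) * L"
  proof (intro mult_right_mono)
    have "card ?S \<le> N div D + 1" using assms by (intro card_residue_class_le) auto
    hence "real (card ?S) \<le> real (N div D + 1)" by (rule of_nat_mono)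
    also have "\<dots> = real (N div D) + 1" by simp
    also have "\<dots> \<le> real N / real D + real N / real D"
    proof (rule add_mono)
      show "real (N div D) \<le> real N / real D" by (rule of_nat_div_le_of_nat)
      show "1 \<le> real N / real D" using assms by simp
    qed
    finally show "real (card ?S) \<le> 2 * real N / real D" by simp
  qed (use L in auto)
  also have "\<dots> \<le> (2 * real N / real D) * L ^ 2"
    by (intro mult_left_mono L2) auto
  finally have 1: "psi (real N) D a \<le> 2 * ((real N / real D) * L ^ 2)" by simp
  have 0: "psi (real N) D a \<ge> 0" unfolding psi_def by (intro sum_nonneg mangoldt_nonneg)
  have "real D / real (totient D) \<le> harm D ^ 2" using assms by (intro real_div_totient_le) auto
  also have "harm D \<le> 1 + ln (real D)" using assms by (intro harm_le_ln) auto
  hence "harm D ^ 2 \<le> L ^ 2" unfolding L_def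
  proof (intro power_mono)
    assume "harm D \<le> 1 + ln (real D)"
    also have "\<dots> \<le> 1 + ln (real N)" using assms by simp
    finally show "harm D \<le> 1 + ln (real N)" .
  qed (simp add: harm_nonneg)
  finally have "(real N / real D) * (real D / real (totient D)) \<le> (real N / real D) * L ^ 2"
    by (intro mult_left_mono) auto
  hence 2: "real N / real (totient D) \<le> (real N / real D) * L ^ 2" using assms by simp
  have 3: "u + v \<le> 3 * t" if "u \<le> 2 * t" "v \<le> t" for u v t :: real using that by linarith
  have "\<bar>E (real N) D a\<bar> \<le> psi (real N) D a + real N / real (totient D)"
    using a 0 by (simp add: E_def abs_le_iff)
  also have "\<dots> \<le> 3 * ((real N / real D) * L ^ 2)" by (rule 3[OF 1 2])
  finally show "\<bar>E (real N) D a\<bar> \<le> 3 * real N * (1 + ln (real N)) ^ 2 / real D"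
    by (simp add: L_def)
qed

text \<open>Cauchy-Schwarz splits tau^2 Emax into tau^2 sqrt(Emax) and sqrt(Emax). In the first
  factor the trivial bound brings 2 logarithms and leaves the fourth moment of tau with weight 1/D,
  which brings 16 more.\<close>

lemma sum_divisor_count_Emax_le:
  assumes "Y \<le> N"
  shows "(\<Sum>D=1..Y. real (divisor_count D) ^ 2 * Emax (real N) D) ^ 2 \<le>
    3 * real N * (1 + ln (real N)) ^ 18 * (\<Sum>D=1..Y. Emax (real N) D)"
proof (cases "Y = 0")
  case False
  define L where "L = 1 + ln (real N)"
  have L: "L \<ge> 1" using assms False by (simp add: L_def)
  define e where "e D = Emax (real N) D" for D
  have e: "e D \<ge> 0" if "D \<in> {1..Y}" for D using that Emax_nonneg[of D] by (simp add: e_def)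
  have "(\<Sum>D=1..Y. real (divisor_count D) ^ 2 * e D) ^ 2 =
      (\<Sum>D=1..Y. (real (divisor_count D) ^ 2 * sqrt (e D)) * sqrt (e D)) ^ 2"
    using e by (intro arg_cong[of _ _ "\<lambda>x. x ^ 2"] sum.cong) auto
  also have "\<dots> \<le> (\<Sum>D=1..Y. (real (divisor_count D) ^ 2 * sqrt (e D)) ^ 2) * (\<Sum>D=1..Y. (sqrt (e D)) ^ 2)"
    by (rule Cauchy_Schwarz_ineq_sum)
  also have "(\<Sum>D=1..Y. (sqrt (e D)) ^ 2) = (\<Sum>D=1..Y. e D)" using e by (intro sum.cong) auto
  finally have CS: "(\<Sum>D=1..Y. real (divisor_count D) ^ 2 * e D) ^ 2 \<le>
      (\<Sum>D=1..Y. (real (divisor_count D) ^ 2 * sqrt (e D)) ^ 2) * (\<Sum>D=1..Y. e D)" .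
  have "(\<Sum>D=1..Y. (real (divisor_count D) ^ 2 * sqrt (e D)) ^ 2) =
      (\<Sum>D=1..Y. real (divisor_count D) ^ 4 * e D)"
    using e by (intro sum.cong) (auto simp: power_mult_distrib simp flip: power_mult)
  also have "\<dots> \<le> (\<Sum>D=1..Y. real (divisor_count D) ^ 4 * (3 * real N * L ^ 2 / real D))"
    unfolding e_def L_def using assms by (intro sum_mono mult_left_mono Emax_trivial_bound) auto
  also have "\<dots> = 3 * real N * L ^ 2 * (\<Sum>D=1..Y. real (divisor_count D) ^ 4 / real D)"
    by (simp add: sum_distrib_left mult_ac)
  also have "\<dots> \<le> 3 * real N * L ^ 2 * L ^ 16"
  proof (intro mult_left_mono)
    have "(\<Sum>D=1..Y. real (divisor_count D) ^ 4 / real D) \<le> harm Y ^ (2 ^ 4)"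
      by (rule sum_divisor_count_power_le)
    also have "\<dots> \<le> L ^ (2 ^ 4)"
    proof (rule power_mono)
      have "harm Y \<le> (harm N :: real)" using assms by (rule harm_mono)
      also have "\<dots> \<le> L" unfolding L_def using assms False by (intro harm_le_ln) auto
      finally show "harm Y \<le> L" .
    qed (simp add: harm_nonneg)
    finally show "(\<Sum>D=1..Y. real (divisor_count D) ^ 4 / real D) \<le> L ^ 16" by simp
  qed (use L in auto)
  also have "3 * real N * L ^ 2 * L ^ 16 = 3 * real N * L ^ 18"
    by (simp flip: power_add)
  finally have "(\<Sum>D=1..Y. (real (divisor_count D) ^ 2 * sqrt (e D)) ^ 2) * (\<Sum>D=1..Y. e D)
      \<le> 3 * real N * L ^ 18 * (\<Sum>D=1..Y. e D)"
    using e by (intro mult_right_mono sum_nonneg)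
  with CS show ?thesis unfolding e_def L_def by linarith
qed simp

lemma corr_asymptotics:
  assumes "EH \<theta>" "\<theta> \<le> 1" "\<epsilon>' > 0" "\<delta> > 0"
  shows "\<forall>\<^sub>F N in sequentially. \<forall>Q1 Q2 h1 h2. 1 \<le> Q1 \<longrightarrow> 1 \<le> Q2 \<longrightarrow>
    real (Q1 * Q2) \<le> real N powr (\<theta> - \<epsilon>') \<longrightarrow>
    \<bar>corr Q1 Q2 h1 h2 N - real N * main_term Q1 Q2 h1 h2\<bar> \<le> \<delta> * real N"
proof -
  define S where "S x = (\<Sum>q | 1 \<le> q \<and> real q \<le> x powr (\<theta> - \<epsilon>'). Emax x q)" for x :: real
  \<comment> \<open>The weights cost 6 logarithms and Cauchy-Schwarz costs 9, while EH with exponent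
    A gains A/2; any A above 30 would do.\<close>
  have "S \<in> O[at_top](\<lambda>x. x / ln x powr 50)"
    using assms(1,3) unfolding EH_def S_def Emax_def by (auto dest!: spec[of _ \<epsilon>'] spec[of _ 50])
  then obtain c where c: "c > 0" "\<forall>\<^sub>F x in at_top. norm (S x) \<le> c * norm (x / ln x powr 50)"
    by (elim landau_o.bigE)
  have "\<forall>\<^sub>F N in sequentially. norm (S (real N)) \<le> c * norm (real N / ln (real N) powr 50)"
    using filterlim_real_sequentially c(2) by (auto simp: filterlim_iff)
  moreover have "\<forall>\<^sub>F N in sequentially. (1 + ln (real N)) ^ 6 *
      (sqrt (3 * c * (1 + ln (real N)) ^ 18 / ln (real N) powr 50) + real N powr (- \<epsilon>') * ln (real N)) < \<delta>"
  proof (rule order_tendstoD)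
    show "((\<lambda>N. (1 + ln (real N)) ^ 6 *
      (sqrt (3 * c * (1 + ln (real N)) ^ 18 / ln (real N) powr 50) + real N powr (- \<epsilon>') * ln (real N)))
        \<longlongrightarrow> 0) sequentially"
      using c(1) assms(3) by real_asymp
  qed (use assms in auto)
  moreover have "\<forall>\<^sub>F N in sequentially. N \<ge> 3" by (rule eventually_ge_at_top)
  ultimately show ?thesis
  proof eventually_elim
    case (elim N)
    define L where "L = 1 + ln (real N)"
    have N: "N \<ge> 3" by fact
    have L: "L \<ge> 1" using N by (simp add: L_def)
    have lnN: "ln (real N) > 0" using N by simp
    show ?case
    proof (intro allI impI)
      fix Q1 Q2 :: nat and h1 h2 :: int
      assume Q: "1 \<le> Q1" "1 \<le> Q2" and Y: "real (Q1 * Q2) \<le> real N powr (\<theta> - \<epsilon>')"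
      define Y' where "Y' = Q1 * Q2"
      have "real N powr (\<theta> - \<epsilon>') \<le> real N powr (1 - \<epsilon>')"
        using N assms(2) by (intro powr_mono) auto
      with Y have Y1: "real Y' \<le> real N powr (1 - \<epsilon>')" by (simp add: Y'_def)
      also have "\<dots> \<le> real N powr 1" using N assms(3) by (intro powr_mono) auto
      finally have YN: "Y' \<le> N" using N by simp
      have "Q1 * 1 \<le> Q1 * Q2" "1 * Q2 \<le> Q1 * Q2" using Q by (intro mult_le_mono; simp)+
      hence QN: "Q1 \<le> N" "Q2 \<le> N" using YN unfolding Y'_def by linarith+
      have harmQ: "harm Q \<le> L" if "Q \<le> N" for Q
        using harm_mono[OF that, where ?'a = real] harm_le_ln[of N] N unfolding L_def by simp
      have "{q. 1 \<le> q \<and> real q \<le> real N powr (\<theta> - \<epsilon>')} \<subseteq> {..nat \<lfloor>real N powr (\<theta> - \<epsilon>')\<rfloor>}"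
        by (auto simp: le_nat_floor)
      hence fin: "finite {q. 1 \<le> q \<and> real q \<le> real N powr (\<theta> - \<epsilon>')}"
        by (rule finite_subset) simp
      have "(\<Sum>D=1..Y'. Emax (real N) D) \<le> S (real N)"
        unfolding S_def
      proof (rule sum_mono2[OF fin])
        show "{1..Y'} \<subseteq> {q. 1 \<le> q \<and> real q \<le> real N powr (\<theta> - \<epsilon>')}"
        proof safe
          fix q assume "q \<in> {1..Y'}"
          hence "real q \<le> real Y'" by simp
          thus "real q \<le> real N powr (\<theta> - \<epsilon>')" using Y by (simp add: Y'_def)
        qed auto
      qed (auto intro: Emax_nonneg)
      also have "\<dots> \<le> c * (real N / ln (real N) powr 50)" using elim(1) by simp
      finally have S: "(\<Sum>D=1..Y'. Emax (real N) D) \<le> c * (real N / ln (real N) powr 50)" .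
      define W where "W = (\<Sum>D=1..Y'. real (divisor_count D) ^ 2 * Emax (real N) D)"
      have "W ^ 2 \<le> 3 * real N * L ^ 18 * (\<Sum>D=1..Y'. Emax (real N) D)"
        unfolding W_def L_def by (rule sum_divisor_count_Emax_le[OF YN])
      also have "\<dots> \<le> 3 * real N * L ^ 18 * (c * (real N / ln (real N) powr 50))"
        using L by (intro mult_left_mono S) auto
      also have "\<dots> = (real N) ^ 2 * (3 * c * L ^ 18 / ln (real N) powr 50)"
        by (simp add: power2_eq_square)
      finally have "sqrt (W ^ 2) \<le> sqrt ((real N) ^ 2 * (3 * c * L ^ 18 / ln (real N) powr 50))"
        by (rule real_sqrt_le_mono)
      hence W: "W \<le> real N * sqrt (3 * c * L ^ 18 / ln (real N) powr 50)"
        unfolding real_sqrt_mult real_sqrt_abs by (simp only: abs_of_nat abs_le_iff)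
      have "\<bar>corr Q1 Q2 h1 h2 N - real N * main_term Q1 Q2 h1 h2\<bar> \<le>
          harm Q1 ^ 3 * harm Q2 ^ 3 *
            (\<Sum>d1=1..Q1. \<Sum>d2=1..Q2. Emax (real N) (lcm d1 d2) + ln (real N))"
        using N by (intro abs_corr_minus_main_le) auto
      also have "(\<Sum>d1=1..Q1. \<Sum>d2=1..Q2. Emax (real N) (lcm d1 d2) + ln (real N)) =
          (\<Sum>d1=1..Q1. \<Sum>d2=1..Q2. Emax (real N) (lcm d1 d2)) + real Y' * ln (real N)"
        by (simp add: sum.distrib Y'_def)
      also have "harm Q1 ^ 3 * harm Q2 ^ 3 * \<dots> \<le> L ^ 6 *
          (real N * sqrt (3 * c * L ^ 18 / ln (real N) powr 50) + real N * (real N powr (- \<epsilon>') * ln (real N)))"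
      proof (rule mult_mono)
        have "harm Q1 ^ 3 * harm Q2 ^ 3 \<le> L ^ 3 * L ^ 3"
          using L by (intro mult_mono power_mono harmQ QN) (auto simp: harm_nonneg)
        also have "L ^ 3 * L ^ 3 = L ^ 6" by (simp flip: power_add)
        finally show "harm Q1 ^ 3 * harm Q2 ^ 3 \<le> L ^ 6" .
        have "(\<Sum>d1=1..Q1. \<Sum>d2=1..Q2. Emax (real N) (lcm d1 d2)) \<le> W"
          unfolding W_def by (rule sum_Emax_lcm_le) (simp add: Y'_def)
        also note W
        finally have 1: "(\<Sum>d1=1..Q1. \<Sum>d2=1..Q2. Emax (real N) (lcm d1 d2)) \<le>
          real N * sqrt (3 * c * L ^ 18 / ln (real N) powr 50)" .
        \<comment> \<open>A loss of log N for each pair of moduli is affordable because there are at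
          most N^(1 - \<epsilon>') pairs.\<close>
        have "real Y' * ln (real N) \<le> real N powr (1 - \<epsilon>') * ln (real N)"
          using Y1 lnN by (intro mult_right_mono) auto
        also have "real N powr (1 - \<epsilon>') = real N * real N powr (- \<epsilon>')"
          using N powr_add[of "real N" 1 "- \<epsilon>'"] by simp
        finally have 2: "real Y' * ln (real N) \<le> real N * (real N powr (- \<epsilon>') * ln (real N))"
          by simp
        show "(\<Sum>d1=1..Q1. \<Sum>d2=1..Q2. Emax (real N) (lcm d1 d2)) + real Y' * ln (real N) \<le>
          real N * sqrt (3 * c * L ^ 18 / ln (real N) powr 50) + real N * (real N powr (- \<epsilon>') * ln (real N))"
          by (rule add_mono[OF 1 2])
        show "0 \<le> (\<Sum>d1=1..Q1. \<Sum>d2=1..Q2. Emax (real N) (lcm d1 d2)) + real Y' * ln (real N)"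
          using lnN by (intro add_nonneg_nonneg sum_nonneg Emax_nonneg) (auto simp: lcm_pos_nat)
      qed (use L in auto)
      also have "\<dots> = real N * (L ^ 6 * (sqrt (3 * c * L ^ 18 / ln (real N) powr 50) +
          real N powr (- \<epsilon>') * ln (real N)))"
        by (simp only: distrib_left mult.left_commute[of "real N"])
      also have "\<dots> \<le> real N * \<delta>" using elim(2) unfolding L_def by (intro mult_left_mono) auto
      finally show "\<bar>corr Q1 Q2 h1 h2 N - real N * main_term Q1 Q2 h1 h2\<bar> \<le> \<delta> * real N"
        by (simp add: mult.commute)
    qed
  qed
qed

section \<open>The main term as a sum over sets of primes\<close>

lemma prime_dvd_prod_primes_iff:
  fixes X :: "nat set"
  assumes "finite X" "\<And>p. p \<in> X \<Longrightarrow> prime p" "prime p"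
  shows "p dvd \<Prod>X \<longleftrightarrow> p \<in> X"
proof -
  have "p dvd \<Prod>X \<longleftrightarrow> p \<in> prime_factors (\<Prod>X)"
    using prod_primes_pos[of X] assms by (auto simp: prime_factors_dvd)
  thus ?thesis using prime_factors_prod_primes[of X] assms by simp
qed

lemma int_prod_primes_dvd_iff:
  fixes X :: "nat set"
  assumes "finite X" "\<And>p. p \<in> X \<Longrightarrow> prime p"
  shows "int (\<Prod>X) dvd h \<longleftrightarrow> (\<forall>p\<in>X. int p dvd h)"
  using assms
proof (induction X rule: finite_induct)
  case (insert q X)
  have "coprime q (\<Prod>X)"
    using insert prime_dvd_prod_primes_iff[of X q] by (intro prime_imp_coprime) auto
  hence "coprime (int q) (int (\<Prod>X))" by (simp only: coprime_int_iff)
  hence "int q * int (\<Prod>X) dvd h \<longleftrightarrow> int q dvd h \<and> int (\<Prod>X) dvd h"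
    using divides_mult[of "int q" h "int (\<Prod>X)"] dvd_mult_left[of "int q" "int (\<Prod>X)" h]
      dvd_mult_right[of "int q" "int (\<Prod>X)" h] by (simp only:) blast
  thus ?case using insert by simp
qed simp

lemma coprime_int_prod_primes_iff:
  fixes X :: "nat set"
  assumes "finite X" "\<And>p. p \<in> X \<Longrightarrow> prime p"
  shows "coprime (int (\<Prod>X)) h \<longleftrightarrow> (\<forall>p\<in>X. \<not> int p dvd h)"
  using assms
proof (induction X rule: finite_induct)
  case (insert q X)
  have "prime (int q)" using insert.prems by simp
  hence "coprime (int q) h \<longleftrightarrow> \<not> int q dvd h"
    using prime_imp_coprime[of "int q" h] by (auto simp: coprime_absorb_left prime_int_iff)
  thus ?case using insert by simp
qed simp

lemma totient_prod_primes:
  fixes X :: "nat set"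
  assumes "finite X" "\<And>p. p \<in> X \<Longrightarrow> prime p"
  shows "real (totient (\<Prod>X)) = (\<Prod>p\<in>X. real p - 1)"
  using assms
proof (induction X rule: finite_induct)
  case (insert q X)
  have "coprime q (\<Prod>X)"
    using insert prime_dvd_prod_primes_iff[of X q] by (intro prime_imp_coprime) auto
  hence "totient (q * \<Prod>X) = totient q * totient (\<Prod>X)" by (rule totient_mult_coprime)
  moreover have "real (totient q) = real q - 1"
    using insert.prems prime_gt_0_nat[of q] by (simp add: totient_prime of_nat_diff Suc_le_eq)
  ultimately show ?case using insert by simp
qed simp

lemma moebius_mu_prod_primes:
  fixes X :: "nat set"
  assumes "finite X" "\<And>p. p \<in> X \<Longrightarrow> prime p"
  shows "moebius_mu (\<Prod>X) = (-1) ^ card X"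
  using assms squarefree_prod_primes[of X] prime_factors_prod_primes[of X]
  by (simp add: moebius_mu_def)

lemma lcm_prod_primes:
  fixes X Y :: "nat set"
  assumes "finite X" "finite Y" "\<And>p. p \<in> X \<Longrightarrow> prime p" "\<And>p. p \<in> Y \<Longrightarrow> prime p"
  shows "lcm (\<Prod>X) (\<Prod>Y) = \<Prod>(X \<union> Y)"
proof (rule dvd_antisym)
  show "lcm (\<Prod>X) (\<Prod>Y) dvd \<Prod>(X \<union> Y)"
    using assms by (intro lcm_least prod_dvd_prod_subset) auto
  have "p dvd lcm (\<Prod>X) (\<Prod>Y)" if "p \<in> X \<union> Y" for p
    using that
  proof
    assume "p \<in> X"
    thus ?thesis using assms by (intro dvd_lcmI1 dvd_prodI)
  next
    assume "p \<in> Y"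
    thus ?thesis using assms by (intro dvd_lcmI2 dvd_prodI)
  qed
  hence "int (\<Prod>(X \<union> Y)) dvd int (lcm (\<Prod>X) (\<Prod>Y))"
    using assms by (subst int_prod_primes_dvd_iff) auto
  thus "\<Prod>(X \<union> Y) dvd lcm (\<Prod>X) (\<Prod>Y)" by (simp only: int_dvd_int_iff)
qed

lemma gcd_prod_primes:
  fixes X Y :: "nat set"
  assumes "finite X" "finite Y" "\<And>p. p \<in> X \<Longrightarrow> prime p" "\<And>p. p \<in> Y \<Longrightarrow> prime p"
  shows "gcd (\<Prod>X) (\<Prod>Y) = \<Prod>(X \<inter> Y)"
proof -
  let ?g = "gcd (\<Prod>X) (\<Prod>Y)"
  have X0: "\<Prod>X > 0" using assms by (intro prod_primes_pos)
  have "squarefree ?g"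
    by (rule squarefree_mono[OF gcd_dvd1 squarefree_prod_primes[OF assms(3)]])
  moreover have "prime_factors ?g = X \<inter> Y"
  proof (rule Set.set_eqI)
    fix p
    show "p \<in> prime_factors ?g \<longleftrightarrow> p \<in> X \<inter> Y"
    proof (cases "prime p")
      case True
      hence "p \<in> prime_factors ?g \<longleftrightarrow> p dvd \<Prod>X \<and> p dvd \<Prod>Y"
        using X0 by (auto simp: prime_factors_dvd)
      thus ?thesis using prime_dvd_prod_primes_iff[OF assms(1,3) True]
          prime_dvd_prod_primes_iff[OF assms(2,4) True] by simp
    next
      case False
      thus ?thesis using assms by auto
    qed
  qed
  ultimately show ?thesis using squarefree_prod_prime_factors[of ?g] by simp
qed

lemma divisors_prod_primes:
  fixes X :: "nat set"
  assumes "finite X" "\<And>p. p \<in> X \<Longrightarrow> prime p"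
  shows "{d. d dvd \<Prod>X} = Prod ` Pow X"
proof safe
  fix d assume d: "d dvd \<Prod>X"
  have X0: "\<Prod>X > 0" using assms by (intro prod_primes_pos)
  have "squarefree d" by (rule squarefree_mono[OF d squarefree_prod_primes[OF assms(2)]])
  moreover have "prime_factors d \<subseteq> X"
    using dvd_prime_factors[OF _ d] X0 prime_factors_prod_primes[OF assms] by simp
  ultimately show "d \<in> Prod ` Pow X"
    using squarefree_prod_prime_factors[of d] by (intro image_eqI[of _ _ "prime_factors d"]) auto
next
  fix Y assume "Y \<subseteq> X"
  thus "\<Prod>Y dvd \<Prod>X" using assms by (intro prod_dvd_prod_subset)
qed

lemma sum_Pow_insert:
  assumes "finite A" "a \<notin> A"
  shows "(\<Sum>Y\<in>Pow (insert a A). g Y) = (\<Sum>Y\<in>Pow A. g Y + g (insert a Y))"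
proof -
  have "(\<Sum>Y\<in>Pow (insert a A). g Y) = (\<Sum>Y\<in>Pow A. g Y) + (\<Sum>Y\<in>insert a ` Pow A. g Y)"
    unfolding Pow_insert using assms by (intro sum.union_disjoint) auto
  also have "(\<Sum>Y\<in>insert a ` Pow A. g Y) = (\<Sum>Y\<in>Pow A. g (insert a Y))"
    using assms by (subst sum.reindex) (auto simp: inj_on_def)
  finally show ?thesis by (simp add: sum.distrib)
qed

section \<open>Euler products over pairs of sets of primes\<close>

definition sum4 :: "(bool \<Rightarrow> bool \<Rightarrow> real) \<Rightarrow> real" where
  "sum4 f = f False False + f False True + f True False + f True True"

text \<open>Membership of \<open>p\<close> in \<open>X\<close> and in \<open>Y\<close> is chosen
  independently for every prime, so the sum over pairs of sets factors.\<close>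

lemma sum_Pow_Pow_prod:
  fixes f :: "'a \<Rightarrow> bool \<Rightarrow> bool \<Rightarrow> real"
  assumes "finite A"
  shows "(\<Sum>X\<in>Pow A. \<Sum>Y\<in>Pow A. \<Prod>p\<in>A. f p (p \<in> X) (p \<in> Y)) = (\<Prod>p\<in>A. sum4 (f p))"
  using assms
proof (induction A rule: finite_induct)
  case (insert a A)
  define g where "g X Y = (\<Prod>p\<in>A. f p (p \<in> X) (p \<in> Y))" for X Y
  have *: "(\<Prod>p\<in>insert a A. f p (p \<in> X) (p \<in> Y)) = f a (a \<in> X) (a \<in> Y) * g X Y" for X Y
    using insert by (simp add: g_def)
  have ins: "p \<in> insert a Z \<longleftrightarrow> p \<in> Z" if "p \<in> A" for p Z using insert.hyps(2) that by auto
  have g1: "g (insert a X) Y = g X Y" for X Y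
    unfolding g_def by (intro prod.cong refl) (simp only: ins)
  have g2: "g X (insert a Y) = g X Y" for X Y
    unfolding g_def by (intro prod.cong refl) (simp only: ins)
  have "(\<Sum>X\<in>Pow (insert a A). \<Sum>Y\<in>Pow (insert a A). f a (a \<in> X) (a \<in> Y) * g X Y) =
      (\<Sum>X\<in>Pow A. \<Sum>Y\<in>Pow A. sum4 (f a) * g X Y)"
    unfolding sum_Pow_insert[OF insert.hyps] sum.distrib [symmetric]
  proof (intro sum.cong refl)
    fix X Y assume "X \<in> Pow A" "Y \<in> Pow A"
    hence "a \<notin> X" "a \<notin> Y" using insert by auto
    thus "f a (a \<in> X) (a \<in> Y) * g X Y + f a (a \<in> X) (a \<in> insert a Y) * g X (insert a Y) +
      (f a (a \<in> insert a X) (a \<in> Y) * g (insert a X) Y +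
       f a (a \<in> insert a X) (a \<in> insert a Y) * g (insert a X) (insert a Y)) = sum4 (f a) * g X Y"
      by (simp add: g1 g2 sum4_def algebra_simps)
  qed
  also have "\<dots> = sum4 (f a) * (\<Sum>X\<in>Pow A. \<Sum>Y\<in>Pow A. g X Y)"
    by (simp add: sum_distrib_left)
  also have "\<dots> = (\<Prod>p\<in>insert a A. sum4 (f p))"
    using insert unfolding g_def by simp
  finally show ?case unfolding * .
qed (simp add: sum4_def)

text \<open>The coefficient at \<open>p\<close> belonging to a pair (q1, q2), where
  \<open>b1\<close> and \<open>b2\<close> say whether p divides q1 and q2. The outer factors come
  from 1/phi(q1) and 1/phi(q2). The bracket sums over whether p divides d1 and d2: each occurrence
  brings p mu(p) = -P, and together they bring one factor 1/(P - 1) from phi(lcm(d1, d2)).\<close>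

definition local_weight :: "int \<Rightarrow> int \<Rightarrow> nat \<Rightarrow> bool \<Rightarrow> bool \<Rightarrow> real" where
  "local_weight h1 h2 p b1 b2 =
    (let P = real p; e1 = of_bool (\<not> int p dvd h1); e2 = of_bool (\<not> int p dvd h2);
         e12 = of_bool (int p dvd h1 - h2)
     in (if b1 then 1 / (P - 1) else 1) * (if b2 then 1 / (P - 1) else 1) *
        (1 - of_bool b1 * (e1 * P / (P - 1)) - of_bool b2 * (e2 * P / (P - 1)) +
         of_bool (b1 \<and> b2) * (e1 * e2 * e12 * P\<^sup>2 / (P - 1))))"

text \<open>With q1 and q2 outside, truncation concerns only them, and the inner double divisor sum
  is multiplicative.\<close>

lemma main_term_eq_sum_totient:
  "main_term Q1 Q2 h1 h2 = (\<Sum>q1=1..Q1. \<Sum>q2=1..Q2.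
     (moebius_mu q1)\<^sup>2 / real (totient q1) * ((moebius_mu q2)\<^sup>2 / real (totient q2)) *
     (\<Sum>d1 | d1 dvd q1. \<Sum>d2 | d2 dvd q2.
        real d1 * moebius_mu d1 * (real d2 * moebius_mu d2) * rho2 h1 h2 d1 d2))"
proof -
  define c where "c q = (moebius_mu q)\<^sup>2 / real (totient q)" for q
  define m where "m d = real d * moebius_mu d" for d
  have w: "lam_weight Q d = (\<Sum>q=1..Q. if d dvd q then m d * c q else 0)" for Q d
  proof -
    have "lam_weight Q d = m d * (\<Sum>q\<in>{q\<in>{1..Q}. d dvd q}. c q)"
      by (simp add: lam_weight_def m_def c_def)
    also have "(\<Sum>q\<in>{q\<in>{1..Q}. d dvd q}. c q) = (\<Sum>q\<in>{1..Q}. if d dvd q then c q else 0)"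
      by (rule sum.inter_filter) simp
    finally show ?thesis by (simp add: sum_distrib_left if_distrib cong: if_cong)
  qed
  define F where "F d1 d2 q1 q2 = (if d1 dvd q1 then m d1 * c q1 else 0) *
      (if d2 dvd q2 then m d2 * c q2 else 0) * rho2 h1 h2 d1 d2" for d1 d2 q1 q2
  have "main_term Q1 Q2 h1 h2 = (\<Sum>d1=1..Q1. \<Sum>d2=1..Q2. \<Sum>q1=1..Q1. \<Sum>q2=1..Q2. F d1 d2 q1 q2)"
  proof -
    have "(\<Sum>q\<in>S. f q) * (\<Sum>q\<in>T. g q) * r = (\<Sum>p\<in>S. \<Sum>q\<in>T. f p * g q * r)"
      for S T :: "nat set" and f g :: "nat \<Rightarrow> real" and r
      unfolding sum_product by (simp only: sum_distrib_right)
    thus ?thesis unfolding main_term_def w F_def by (simp only:)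
  qed
  also have "\<dots> = (\<Sum>d1=1..Q1. \<Sum>q1=1..Q1. \<Sum>d2=1..Q2. \<Sum>q2=1..Q2. F d1 d2 q1 q2)"
    by (intro sum.cong refl sum.swap)
  also have "\<dots> = (\<Sum>q1=1..Q1. \<Sum>d1=1..Q1. \<Sum>d2=1..Q2. \<Sum>q2=1..Q2. F d1 d2 q1 q2)"
    by (rule sum.swap)
  also have "\<dots> = (\<Sum>q1=1..Q1. \<Sum>d1=1..Q1. \<Sum>q2=1..Q2. \<Sum>d2=1..Q2. F d1 d2 q1 q2)"
    by (intro sum.cong refl sum.swap)
  also have "\<dots> = (\<Sum>q1=1..Q1. \<Sum>q2=1..Q2. \<Sum>d1=1..Q1. \<Sum>d2=1..Q2. F d1 d2 q1 q2)"
    by (intro sum.cong refl sum.swap)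
  also have "\<dots> = (\<Sum>q1=1..Q1. \<Sum>q2=1..Q2. c q1 * c q2 *
     (\<Sum>d1 | d1 dvd q1. \<Sum>d2 | d2 dvd q2. m d1 * m d2 * rho2 h1 h2 d1 d2))"
  proof (intro sum.cong refl)
    fix q1 q2 assume q: "q1 \<in> {1..Q1}" "q2 \<in> {1..Q2}"
    have D: "d \<in> {1..Q}" if "d dvd q" "q \<in> {1..Q}" for d q Q :: nat
      using that dvd_imp_le[of d q] by (auto simp: Suc_le_eq intro!: Nat.gr0I)
    have "(\<Sum>d1=1..Q1. \<Sum>d2=1..Q2. F d1 d2 q1 q2) = (\<Sum>d1 | d1 dvd q1. \<Sum>d2=1..Q2. F d1 d2 q1 q2)"
      using D[OF _ q(1)] by (intro sum.mono_neutral_right) (auto simp: F_def)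
    also have "\<dots> = (\<Sum>d1 | d1 dvd q1. \<Sum>d2 | d2 dvd q2. F d1 d2 q1 q2)"
      using D[OF _ q(2)] by (intro sum.cong[OF refl] sum.mono_neutral_right) (auto simp: F_def)
    also have "\<dots> = (\<Sum>d1 | d1 dvd q1. \<Sum>d2 | d2 dvd q2. c q1 * c q2 * (m d1 * m d2 * rho2 h1 h2 d1 d2))"
      by (intro sum.cong refl) (simp add: F_def)
    finally show "(\<Sum>d1=1..Q1. \<Sum>d2=1..Q2. F d1 d2 q1 q2) = c q1 * c q2 *
     (\<Sum>d1 | d1 dvd q1. \<Sum>d2 | d2 dvd q2. m d1 * m d2 * rho2 h1 h2 d1 d2)"
      by (simp add: sum_distrib_left)
  qed
  finally show ?thesis unfolding c_def m_def .
qed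

text \<open>For squarefree arguments the three conditions and the totient of the lcm are read off
  prime by prime; one failing prime annihilates the product.\<close>

lemma rho2_prod_primes:
  fixes X Y A :: "nat set"
  assumes A: "finite A" "\<And>p. p \<in> A \<Longrightarrow> prime p" and XY: "X \<subseteq> A" "Y \<subseteq> A"
  shows "rho2 h1 h2 (\<Prod>X) (\<Prod>Y) = (\<Prod>p\<in>A.
    (if (p \<in> X \<longrightarrow> \<not> int p dvd h1) \<and> (p \<in> Y \<longrightarrow> \<not> int p dvd h2) \<and>
        (p \<in> X \<and> p \<in> Y \<longrightarrow> int p dvd h1 - h2)
     then if p \<in> X \<or> p \<in> Y then 1 / (real p - 1) else 1 else 0))"
    (is "_ = (\<Prod>p\<in>A. if ?C p then ?v p else 0)")
proof -
  have fin: "finite X" "finite Y" by (rule finite_subset[OF XY(1) A(1)], rule finite_subset[OF XY(2) A(1)])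
  have prX: "\<And>p. p \<in> X \<Longrightarrow> prime p" and prY: "\<And>p. p \<in> Y \<Longrightarrow> prime p" using A(2) XY by blast+
  have cond: "coprime (int (\<Prod>X)) h1 \<and> coprime (int (\<Prod>Y)) h2 \<and> int (gcd (\<Prod>X) (\<Prod>Y)) dvd h1 - h2
      \<longleftrightarrow> (\<forall>p\<in>A. ?C p)"
  proof -
    have "gcd (\<Prod>X) (\<Prod>Y) = \<Prod>(X \<inter> Y)" by (rule gcd_prod_primes[OF fin prX prY])
    moreover have "coprime (int (\<Prod>X)) h1 \<longleftrightarrow> (\<forall>p\<in>X. \<not> int p dvd h1)"
      by (rule coprime_int_prod_primes_iff[OF fin(1) prX])
    moreover have "coprime (int (\<Prod>Y)) h2 \<longleftrightarrow> (\<forall>p\<in>Y. \<not> int p dvd h2)"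
      by (rule coprime_int_prod_primes_iff[OF fin(2) prY])
    moreover have "int (\<Prod>(X \<inter> Y)) dvd h1 - h2 \<longleftrightarrow> (\<forall>p\<in>X \<inter> Y. int p dvd h1 - h2)"
      using fin prX by (intro int_prod_primes_dvd_iff) auto
    moreover have "(\<forall>p\<in>X. \<not> int p dvd h1) \<and> (\<forall>p\<in>Y. \<not> int p dvd h2) \<and>
      (\<forall>p\<in>X \<inter> Y. int p dvd h1 - h2) \<longleftrightarrow> (\<forall>p\<in>A. ?C p)" using XY by blast
    ultimately show ?thesis by (simp only:)
  qed
  show ?thesis
  proof (cases "\<forall>p\<in>A. ?C p")
    case True
    have "rho2 h1 h2 (\<Prod>X) (\<Prod>Y) = 1 / (\<Prod>p\<in>X \<union> Y. real p - 1)"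
    proof -
      have "real (totient (\<Prod>(X \<union> Y))) = (\<Prod>p\<in>X \<union> Y. real p - 1)"
        using fin prX prY by (intro totient_prod_primes) auto
      moreover have "lcm (\<Prod>X) (\<Prod>Y) = \<Prod>(X \<union> Y)" by (rule lcm_prod_primes[OF fin prX prY])
      ultimately show ?thesis unfolding rho2_def if_P[OF iffD2[OF cond True]] by (simp only:)
    qed
    also have "\<dots> = (\<Prod>p\<in>X \<union> Y. 1 / (real p - 1))" by (simp only: prod_dividef prod.neutral_const)
    also have "\<dots> = (\<Prod>p\<in>A. ?v p)"
      using XY A by (intro prod.mono_neutral_cong_left) auto
    also have "\<dots> = (\<Prod>p\<in>A. if ?C p then ?v p else 0)" using True by (intro prod.cong) auto
    finally show ?thesis .
  next
    case False
    then obtain p where "p \<in> A" "\<not> ?C p" by blast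
    hence 0: "(\<Prod>p\<in>A. if ?C p then ?v p else 0) = 0" using A(1) by (intro prod_zero) auto
    have nc: "\<not> (coprime (int (\<Prod>X)) h1 \<and> coprime (int (\<Prod>Y)) h2 \<and>
      int (gcd (\<Prod>X) (\<Prod>Y)) dvd h1 - h2)"
      using False cond by blast
    show ?thesis unfolding rho2_def if_not_P[OF nc] 0 ..
  qed
qed

lemma local_weight_prod:
  fixes X1 X2 A :: "nat set"
  assumes A: "finite A" "\<And>p. p \<in> A \<Longrightarrow> prime p" and X: "X1 \<subseteq> A" "X2 \<subseteq> A"
  shows "1 / real (totient (\<Prod>X1)) * (1 / real (totient (\<Prod>X2))) *
      (\<Sum>d1 | d1 dvd \<Prod>X1. \<Sum>d2 | d2 dvd \<Prod>X2.
        real d1 * moebius_mu d1 * (real d2 * moebius_mu d2) * rho2 h1 h2 d1 d2) =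
      (\<Prod>p\<in>A. local_weight h1 h2 p (p \<in> X1) (p \<in> X2))"
proof -
  have fin: "finite Z" if "Z \<subseteq> A" for Z by (rule finite_subset[OF that A(1)])
  have pr: "prime p" if "p \<in> Z" "Z \<subseteq> A" for p Z using A that by auto
  define t where "t X p = (if p \<in> X then 1 / (real p - 1) else 1)" for X and p :: nat
  define s where "s b p = (if b then - real p else 1)" for b and p :: nat
  define r where "r p b1 b2 = (if (b1 \<longrightarrow> \<not> int p dvd h1) \<and> (b2 \<longrightarrow> \<not> int p dvd h2) \<and>
      (b1 \<and> b2 \<longrightarrow> int p dvd h1 - h2) then if b1 \<or> b2 then 1 / (real p - 1) else 1 else 0)" for p b1 b2
  \<comment> \<open>Building the condition d_i | q_i into the local factor lets both inner sums run
    over all subsets of \<open>A\<close>.\<close>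
  define f where "f p b1 b2 = (if (b1 \<longrightarrow> p \<in> X1) \<and> (b2 \<longrightarrow> p \<in> X2)
      then s b1 p * s b2 p * r p b1 b2 else 0)" for p b1 b2
  have tot: "1 / real (totient (\<Prod>Z)) = (\<Prod>p\<in>A. t Z p)" if "Z \<subseteq> A" for Z
  proof -
    have "1 / real (totient (\<Prod>Z)) = (\<Prod>p\<in>Z. 1 / (real p - 1))"
    proof -
      have "real (totient (\<Prod>Z)) = (\<Prod>p\<in>Z. real p - 1)"
        by (rule totient_prod_primes[OF fin[OF that] pr[OF _ that]])
      thus ?thesis by (simp only: prod_dividef prod.neutral_const)
    qed
    also have "\<dots> = (\<Prod>p\<in>A. t Z p)"
      using that A by (intro prod.mono_neutral_cong_left) (auto simp: t_def)
    finally show ?thesis .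
  qed
  have mu: "real (\<Prod>Z) * moebius_mu (\<Prod>Z) = (\<Prod>p\<in>A. s (p \<in> Z) p)" if "Z \<subseteq> A" for Z
  proof -
    have "real (\<Prod>Z) * moebius_mu (\<Prod>Z) = (\<Prod>p\<in>Z. - real p)"
    proof -
      have "moebius_mu (\<Prod>Z) = (-1) ^ card Z"
        by (rule moebius_mu_prod_primes[OF fin[OF that] pr[OF _ that]])
      thus ?thesis by (simp add: prod_uminus)
    qed
    also have "\<dots> = (\<Prod>p\<in>A. s (p \<in> Z) p)"
      using that A by (intro prod.mono_neutral_cong_left) (auto simp: s_def)
    finally show ?thesis .
  qed
  have inj: "inj_on Prod (Pow Z)" if "Z \<subseteq> A" for Z
    using bij_betw_prod_primes[OF fin[OF that] pr[OF _ that]] by (auto simp: bij_betw_def)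
  have "(\<Sum>d1 | d1 dvd \<Prod>X1. \<Sum>d2 | d2 dvd \<Prod>X2.
        real d1 * moebius_mu d1 * (real d2 * moebius_mu d2) * rho2 h1 h2 d1 d2) =
      (\<Sum>Y1\<in>Pow X1. \<Sum>Y2\<in>Pow X2. real (\<Prod>Y1) * moebius_mu (\<Prod>Y1) *
        (real (\<Prod>Y2) * moebius_mu (\<Prod>Y2)) * rho2 h1 h2 (\<Prod>Y1) (\<Prod>Y2))"
  proof -
    have "{d. d dvd \<Prod>X1} = Prod ` Pow X1" by (rule divisors_prod_primes[OF fin[OF X(1)] pr[OF _ X(1)]])
    moreover have "{d. d dvd \<Prod>X2} = Prod ` Pow X2"
      by (rule divisors_prod_primes[OF fin[OF X(2)] pr[OF _ X(2)]])
    ultimately show ?thesis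
      by (simp only: sum.reindex[OF inj[OF X(1)]] sum.reindex[OF inj[OF X(2)]] o_def)
  qed
  also have "\<dots> = (\<Sum>Y1\<in>Pow X1. \<Sum>Y2\<in>Pow X2. \<Prod>p\<in>A. f p (p \<in> Y1) (p \<in> Y2))"
  proof (intro sum.cong refl)
    fix Y1 Y2 assume Y: "Y1 \<in> Pow X1" "Y2 \<in> Pow X2"
    hence YA: "Y1 \<subseteq> A" "Y2 \<subseteq> A" using X by auto
    have "rho2 h1 h2 (\<Prod>Y1) (\<Prod>Y2) = (\<Prod>p\<in>A. r p (p \<in> Y1) (p \<in> Y2))"
      unfolding r_def by (rule rho2_prod_primes[OF A YA])
    hence "real (\<Prod>Y1) * moebius_mu (\<Prod>Y1) * (real (\<Prod>Y2) * moebius_mu (\<Prod>Y2)) *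
        rho2 h1 h2 (\<Prod>Y1) (\<Prod>Y2) = (\<Prod>p\<in>A. s (p \<in> Y1) p * s (p \<in> Y2) p * r p (p \<in> Y1) (p \<in> Y2))"
      unfolding mu[OF YA(1)] mu[OF YA(2)] by (simp only: prod.distrib)
    also have "\<dots> = (\<Prod>p\<in>A. f p (p \<in> Y1) (p \<in> Y2))"
      using Y by (intro prod.cong) (auto simp: f_def)
    finally show "real (\<Prod>Y1) * moebius_mu (\<Prod>Y1) * (real (\<Prod>Y2) * moebius_mu (\<Prod>Y2)) *
        rho2 h1 h2 (\<Prod>Y1) (\<Prod>Y2) = (\<Prod>p\<in>A. f p (p \<in> Y1) (p \<in> Y2))" .
  qed
  also have "\<dots> = (\<Sum>Y1\<in>Pow X1. \<Sum>Y2\<in>Pow A. \<Prod>p\<in>A. f p (p \<in> Y1) (p \<in> Y2))"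
  proof (rule sum.cong[OF refl], rule sum.mono_neutral_left, goal_cases)
    case (3 Y1)
    show ?case
    proof
      fix Y2 assume "Y2 \<in> Pow A - Pow X2"
    then obtain p where "p \<in> A" "p \<in> Y2" "p \<notin> X2" by blast
    thus "(\<Prod>p\<in>A. f p (p \<in> Y1) (p \<in> Y2)) = 0"
      using A(1) by (intro prod_zero) (auto simp: f_def)
    qed
  qed (use A X in auto)
  also have "\<dots> = (\<Sum>Y1\<in>Pow A. \<Sum>Y2\<in>Pow A. \<Prod>p\<in>A. f p (p \<in> Y1) (p \<in> Y2))"
  proof (rule sum.mono_neutral_left, goal_cases)
    case 3
    show ?case
    proof
      fix Y1 assume "Y1 \<in> Pow A - Pow X1"
    then obtain p where "p \<in> A" "p \<in> Y1" "p \<notin> X1" by blast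
    hence "(\<Prod>p\<in>A. f p (p \<in> Y1) (p \<in> Y2)) = 0" for Y2
      using A(1) by (intro prod_zero) (auto simp: f_def)
    thus "(\<Sum>Y2\<in>Pow A. \<Prod>p\<in>A. f p (p \<in> Y1) (p \<in> Y2)) = 0" by simp
    qed
  qed (use A X in auto)
  also have "\<dots> = (\<Prod>p\<in>A. sum4 (f p))" by (rule sum_Pow_Pow_prod[OF A(1)])
  finally have "1 / real (totient (\<Prod>X1)) * (1 / real (totient (\<Prod>X2))) *
      (\<Sum>d1 | d1 dvd \<Prod>X1. \<Sum>d2 | d2 dvd \<Prod>X2.
        real d1 * moebius_mu d1 * (real d2 * moebius_mu d2) * rho2 h1 h2 d1 d2) =
      (\<Prod>p\<in>A. t X1 p * t X2 p * sum4 (f p))"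
    unfolding tot[OF X(1)] tot[OF X(2)] by (simp only: prod.distrib)
  also have "\<dots> = (\<Prod>p\<in>A. local_weight h1 h2 p (p \<in> X1) (p \<in> X2))"
  proof (intro prod.cong refl)
    fix p
    define v where "v = 1 / (real p - 1)"
    have v: "x / (real p - 1) = x * v" for x by (simp add: v_def)
    \<comment> \<open>With 1/(p - 1) replaced by a free variable, the local identity is polynomial
      and is checked in all 32 Boolean cases.\<close>
    have gen: "(if b1 then 1 * v else 1) * (if b2 then 1 * v else 1) *
      (let g = (\<lambda>c1 c2. if (c1 \<longrightarrow> b1) \<and> (c2 \<longrightarrow> b2) then (if c1 then - P else 1) * (if c2 then - P else 1) *
         (if (c1 \<longrightarrow> \<not> e1) \<and> (c2 \<longrightarrow> \<not> e2) \<and> (c1 \<and> c2 \<longrightarrow> e12) then if c1 \<or> c2 then 1 * v else 1 else 0) else 0)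
       in g False False + g False True + g True False + g True True) =
      (if b1 then 1 * v else 1) * (if b2 then 1 * v else 1) *
      (1 - of_bool b1 * (of_bool (\<not> e1) * P * v) - of_bool b2 * (of_bool (\<not> e2) * P * v) +
       of_bool (b1 \<and> b2) * (of_bool (\<not> e1) * of_bool (\<not> e2) * of_bool e12 * P\<^sup>2 * v))"
      for b1 b2 e1 e2 e12 :: bool and P v :: real
      by (cases b1; cases b2; cases e1; cases e2; cases e12; simp add: power2_eq_square algebra_simps)
    show "t X1 p * t X2 p * sum4 (f p) = local_weight h1 h2 p (p \<in> X1) (p \<in> X2)"
      unfolding local_weight_def Let_def sum4_def f_def t_def s_def r_def v
      by (rule gen[unfolded Let_def])
  qed
  finally show ?thesis .
qed

abbreviation truncated_sum :: "nat set \<Rightarrow> nat \<Rightarrow> nat \<Rightarrow> (nat \<Rightarrow> bool \<Rightarrow> bool \<Rightarrow> real) \<Rightarrow> real" where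
  "truncated_sum A Q1 Q2 c \<equiv> (\<Sum>X1\<in>Pow A. \<Sum>X2\<in>Pow A. if \<Prod>X1 \<le> Q1 \<and> \<Prod>X2 \<le> Q2
     then (\<Prod>p\<in>A. c p (p \<in> X1) (p \<in> X2)) else 0)"

text \<open>Primes of \<open>A\<close> beyond both truncation points lie in no admissible set and
  contribute the factor 1. The freedom to enlarge \<open>A\<close> is what later permits a limit
  with Q1 and Q2 fixed.\<close>

lemma main_term_eq_sum_Pow:
  fixes A :: "nat set"
  assumes A: "finite A" "\<And>p. p \<in> A \<Longrightarrow> prime p"
    and AQ: "\<And>p. prime p \<Longrightarrow> p \<le> Q1 \<or> p \<le> Q2 \<Longrightarrow> p \<in> A"
  shows "main_term Q1 Q2 h1 h2 = truncated_sum A Q1 Q2 (local_weight h1 h2)"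
proof -
  define G where "G q1 q2 = 1 / real (totient q1) * (1 / real (totient q2)) *
      (\<Sum>d1 | d1 dvd q1. \<Sum>d2 | d2 dvd q2.
        real d1 * moebius_mu d1 * (real d2 * moebius_mu d2) * rho2 h1 h2 d1 d2)" for q1 q2
  let ?P = "\<lambda>Q. {X\<in>Pow A. \<Prod>X \<le> Q}"
  have fin: "finite Z" if "Z \<subseteq> A" for Z by (rule finite_subset[OF that A(1)])
  have pr: "prime p" if "p \<in> Z" "Z \<subseteq> A" for p Z using A that by auto
  have bij: "bij_betw Prod (?P Q) {q\<in>{1..Q}. squarefree q}"
    if Q: "\<And>p. prime p \<Longrightarrow> p \<le> Q \<Longrightarrow> p \<in> A" for Q
  proof -
    have "bij_betw Prod (?P Q) (Prod ` ?P Q)"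
      using bij_betw_prod_primes[OF A] by (intro inj_on_imp_bij_betw) (auto simp: bij_betw_def inj_on_def)
    also have "Prod ` ?P Q = {q\<in>{1..Q}. squarefree q}"
    proof safe
      fix X assume "X \<subseteq> A" "\<Prod>X \<le> Q"
      moreover have "\<Prod>X > 0" by (rule prod_primes_pos[OF pr[OF _ \<open>X \<subseteq> A\<close>]])
      ultimately show "\<Prod>X \<in> {1..Q}" by simp
      show "squarefree (\<Prod>X)" by (rule squarefree_prod_primes[OF pr[OF _ \<open>X \<subseteq> A\<close>]])
    next
      fix q assume q: "q \<in> {1..Q}" "squarefree q"
      have "prime_factors q \<subseteq> A"
      proof
        fix p assume p: "p \<in> prime_factors q"
        hence "p \<le> q" using q by (intro dvd_imp_le) auto
        thus "p \<in> A" using p q by (intro Q) auto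
      qed
      thus "q \<in> Prod ` ?P Q" using q squarefree_prod_prime_factors[OF q(2)]
        by (intro image_eqI[of _ _ "prime_factors q"]) auto
    qed
    finally show ?thesis .
  qed
  have sqf: "(\<Sum>q=1..Q. (moebius_mu q)\<^sup>2 * g q) = (\<Sum>X\<in>?P Q. g (\<Prod>X))"
    if "\<And>p. prime p \<Longrightarrow> p \<le> Q \<Longrightarrow> p \<in> A" for Q and g :: "nat \<Rightarrow> real"
  proof -
    have "(\<Sum>q=1..Q. (moebius_mu q)\<^sup>2 * g q) = (\<Sum>q\<in>{q\<in>{1..Q}. squarefree q}. g q)"
      by (intro sum.mono_neutral_cong_right) (auto simp: moebius_mu_def simp flip: power_mult)
    also have "\<dots> = (\<Sum>X\<in>?P Q. g (\<Prod>X))"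
      by (rule sum.reindex_bij_betw[OF bij[OF that], symmetric])
    finally show ?thesis .
  qed
  have "main_term Q1 Q2 h1 h2 =
      (\<Sum>q1=1..Q1. (moebius_mu q1)\<^sup>2 * (\<Sum>q2=1..Q2. (moebius_mu q2)\<^sup>2 * G q1 q2))"
    unfolding main_term_eq_sum_totient G_def sum_distrib_left[of "(moebius_mu _)\<^sup>2"]
    by (intro sum.cong refl) simp
  also have "\<dots> = (\<Sum>X1\<in>?P Q1. \<Sum>X2\<in>?P Q2. G (\<Prod>X1) (\<Prod>X2))"
  proof -
    have Q1: "(\<Sum>q=1..Q1. (moebius_mu q)\<^sup>2 * g q) = (\<Sum>X\<in>?P Q1. g (\<Prod>X))" for g :: "nat \<Rightarrow> real"
      using AQ by (intro sqf) blast
    have Q2: "(\<Sum>q=1..Q2. (moebius_mu q)\<^sup>2 * g q) = (\<Sum>X\<in>?P Q2. g (\<Prod>X))" for g :: "nat \<Rightarrow> real"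
      using AQ by (intro sqf) blast
    show ?thesis unfolding Q1 Q2 ..
  qed
  also have "\<dots> = (\<Sum>X1\<in>?P Q1. \<Sum>X2\<in>?P Q2. \<Prod>p\<in>A. local_weight h1 h2 p (p \<in> X1) (p \<in> X2))"
    unfolding G_def by (intro sum.cong refl local_weight_prod A) auto
  also have "\<dots> = (\<Sum>X1\<in>Pow A. if \<Prod>X1 \<le> Q1 then (\<Sum>X2\<in>Pow A. if \<Prod>X2 \<le> Q2
      then \<Prod>p\<in>A. local_weight h1 h2 p (p \<in> X1) (p \<in> X2) else 0) else 0)"
    using A by (simp only: sum.inter_filter finite_Pow_iff)
  also have "\<dots> = truncated_sum A Q1 Q2 (local_weight h1 h2)"
    by (intro sum.cong refl) simp
  finally show ?thesis .
qed

section \<open>Local factors and truncation\<close>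

text \<open>The value zeta(3/2), the term n = 0 being 0 because \<open>0 powr x = 0\<close>. The
  exponent is what remains of p^(-2) after Rankin weights of total size at most p^(1/2).\<close>

definition zeta32 :: real where
  "zeta32 = (\<Sum>n. real n powr (-3/2))"

text \<open>By 1 + x \<le> e^x, the factors outside \<open>B\<close> cost a constant altogether, and
  only the primes in \<open>B\<close>, in the applications those dividing the shifts, are charged
  individually.\<close>

lemma euler_product_le:
  fixes A B :: "nat set" and F b :: "nat \<Rightarrow> real"
  assumes "finite A" "K \<ge> 0"
    and "\<And>p. p \<in> A \<Longrightarrow> F p \<ge> 0"
    and "\<And>p. p \<in> A \<Longrightarrow> p \<notin> B \<Longrightarrow> F p \<le> 1 + K * real p powr (-3/2)"
    and "\<And>p. p \<in> A \<Longrightarrow> p \<in> B \<Longrightarrow> F p \<le> 1 + b p"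
    and "\<And>p. p \<in> B \<Longrightarrow> b p \<ge> 0"
  shows "(\<Prod>p\<in>A. F p) \<le> exp (K * zeta32 + (\<Sum>p\<in>A \<inter> B. b p))"
proof -
  have "(\<Prod>p\<in>A. F p) \<le> (\<Prod>p\<in>A. 1 + (if p \<in> B then b p else K * real p powr (-3/2)))"
    using assms(3-5) by (intro prod_mono) auto
  also have "\<dots> \<le> exp (\<Sum>p\<in>A. if p \<in> B then b p else K * real p powr (-3/2))"
    using assms(2,6) by (intro prod_le_exp_sum) auto
  also have "(\<Sum>p\<in>A. if p \<in> B then b p else K * real p powr (-3/2)) =
      (\<Sum>p\<in>A \<inter> B. b p) + (\<Sum>p\<in>A - B. K * real p powr (-3/2))"
    using assms(1) by (simp add: sum.If_cases Diff_eq)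
  also have "(\<Sum>p\<in>A - B. K * real p powr (-3/2)) = K * (\<Sum>p\<in>A - B. real p powr (-3/2))"
    by (simp add: sum_distrib_left)
  also have "(\<Sum>p\<in>A - B. real p powr (-3/2)) \<le> zeta32"
    unfolding zeta32_def using assms(1)
    by (intro sum_le_suminf) (auto simp: summable_real_powr_iff)
  finally show ?thesis using assms(2) by (simp add: mult_left_mono add.commute)
qed

definition prime_wt :: "real \<Rightarrow> nat \<Rightarrow> bool \<Rightarrow> real" where
  "prime_wt s p b = (if b then real p powr s else 1)"

lemma prod_prime_wt:
  fixes A :: "nat set"
  assumes "finite A" "X \<subseteq> A"
  shows "(\<Prod>p\<in>A. prime_wt s p (p \<in> X)) = real (\<Prod>X) powr s"
proof -
  have "(\<Prod>p\<in>A. prime_wt s p (p \<in> X)) = (\<Prod>p\<in>X. real p powr s)"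
    using assms by (intro prod.mono_neutral_cong_right) (auto simp: prime_wt_def)
  also have "\<dots> = real (\<Prod>X) powr s"
    by (simp add: prod_powr_distrib)
  finally show ?thesis .
qed

abbreviation rankin_factor :: "real \<Rightarrow> (nat \<Rightarrow> bool \<Rightarrow> bool \<Rightarrow> real) \<Rightarrow> nat \<Rightarrow> real" where
  "rankin_factor s c p \<equiv> sum4 (\<lambda>b1 b2. \<bar>c p b1 b2\<bar> * prime_wt s p b1 * prime_wt s p b2)"

text \<open>The completed sum is the Euler product. A pair removed by the truncation has one of its
  two products at least Q + 1, so multiplying by the s-th power of both products over Q + 1 only
  increases its absolute value; the weighted sum over all pairs factors again.\<close>

lemma rankin_tail:
  fixes A :: "nat set" and c :: "nat \<Rightarrow> bool \<Rightarrow> bool \<Rightarrow> real"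
  assumes A: "finite A" "\<And>p. p \<in> A \<Longrightarrow> prime p" and s: "s > 0"
  shows "\<bar>truncated_sum A Q Q c - (\<Prod>p\<in>A. sum4 (c p))\<bar>
    \<le> (\<Prod>p\<in>A. rankin_factor s c p) / real (Suc Q) powr s"
proof -
  define C where "C X1 X2 = (\<Prod>p\<in>A. c p (p \<in> X1) (p \<in> X2))" for X1 X2
  have "(\<Sum>X1\<in>Pow A. \<Sum>X2\<in>Pow A. if \<Prod>X1 \<le> Q \<and> \<Prod>X2 \<le> Q then C X1 X2 else 0)
      - (\<Prod>p\<in>A. sum4 (c p)) =
      (\<Sum>X1\<in>Pow A. \<Sum>X2\<in>Pow A. (if \<Prod>X1 \<le> Q \<and> \<Prod>X2 \<le> Q then C X1 X2 else 0) - C X1 X2)"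
    unfolding sum_Pow_Pow_prod[OF A(1), symmetric] C_def by (simp only: sum_subtractf)
  also have "\<bar>\<dots>\<bar> \<le> (\<Sum>X1\<in>Pow A. \<Sum>X2\<in>Pow A.
      (\<Prod>p\<in>A. \<bar>c p (p \<in> X1) (p \<in> X2)\<bar> * prime_wt s p (p \<in> X1) * prime_wt s p (p \<in> X2))
        / real (Suc Q) powr s)"
  proof (rule order_trans[OF sum_abs], rule sum_mono, rule order_trans[OF sum_abs], rule sum_mono)
    fix X1 X2 assume X: "X1 \<in> Pow A" "X2 \<in> Pow A"
    have "prime p" if "p \<in> X1 \<or> p \<in> X2" for p using A(2) X that by blast
    hence pos: "\<Prod>X1 > 0" "\<Prod>X2 > 0" by (intro prod_primes_pos; simp)+
    have rhs: "(\<Prod>p\<in>A. \<bar>c p (p \<in> X1) (p \<in> X2)\<bar> * prime_wt s p (p \<in> X1) * prime_wt s p (p \<in> X2)) =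
        \<bar>C X1 X2\<bar> * (real (\<Prod>X1) powr s * real (\<Prod>X2) powr s)"
    proof -
      have "(\<Prod>p\<in>A. prime_wt s p (p \<in> X1)) = real (\<Prod>X1) powr s"
        "(\<Prod>p\<in>A. prime_wt s p (p \<in> X2)) = real (\<Prod>X2) powr s"
        using X by (intro prod_prime_wt A(1); blast)+
      thus ?thesis unfolding C_def abs_prod prod.distrib by (simp only: mult.assoc)
    qed
    show "\<bar>(if \<Prod>X1 \<le> Q \<and> \<Prod>X2 \<le> Q then C X1 X2 else 0) - C X1 X2\<bar> \<le>
      (\<Prod>p\<in>A. \<bar>c p (p \<in> X1) (p \<in> X2)\<bar> * prime_wt s p (p \<in> X1) * prime_wt s p (p \<in> X2))
        / real (Suc Q) powr s"
    proof (cases "\<Prod>X1 \<le> Q \<and> \<Prod>X2 \<le> Q")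
      case False
      have "real (Suc Q) powr s \<le> real (\<Prod>X1) powr s * real (\<Prod>X2) powr s"
      proof -
        have ge1: "real (\<Prod>X1) powr s \<ge> 1" "real (\<Prod>X2) powr s \<ge> 1"
          using pos s by (intro ge_one_powr_ge_zero; simp only: real_of_nat_ge_one_iff Suc_le_eq One_nat_def less_imp_le)+
        from False consider "Suc Q \<le> \<Prod>X1" | "Suc Q \<le> \<Prod>X2" by linarith
        thus ?thesis
        proof cases
          case 1
          hence "real (Suc Q) \<le> real (\<Prod>X1)" by (rule of_nat_mono)
          hence "real (Suc Q) powr s \<le> real (\<Prod>X1) powr s" using s by (intro powr_mono2) auto
          thus ?thesis using mult_mono[of _ _ 1 "real (\<Prod>X2) powr s"] ge1 by fastforce
        next
          case 2
          hence "real (Suc Q) \<le> real (\<Prod>X2)" by (rule of_nat_mono)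
          hence "real (Suc Q) powr s \<le> real (\<Prod>X2) powr s" using s by (intro powr_mono2) auto
          thus ?thesis using mult_mono[of 1 "real (\<Prod>X1) powr s"] ge1 by fastforce
        qed
      qed
      hence "\<bar>C X1 X2\<bar> * real (Suc Q) powr s \<le> \<bar>C X1 X2\<bar> * (real (\<Prod>X1) powr s * real (\<Prod>X2) powr s)"
        by (rule mult_left_mono) simp
      thus ?thesis unfolding rhs using False by (simp only: if_False diff_0 abs_minus_cancel) (simp add: pos_le_divide_eq)
    next
      case True
      thus ?thesis unfolding rhs by simp
    qed
  qed
  also have "\<dots> = (\<Prod>p\<in>A. rankin_factor s c p)
      / real (Suc Q) powr s"
    unfolding sum_Pow_Pow_prod[OF A(1), symmetric] by (simp only: sum_divide_distrib)
  finally show ?thesis unfolding C_def .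
qed

section \<open>Local weights and the factors of the singular series\<close>

context
  fixes p :: nat and v :: real
  assumes p: "prime p"
  defines "v \<equiv> 1 / (real p - 1)"
begin

text \<open>In terms of v = 1/(p - 1), the relation p v = 1 + v reduces the local identities to
  polynomial ones.\<close>

lemma prime_recip_facts:
  shows "0 < v" "v \<le> 1" "v \<le> 2 / real p" "real p * v = 1 + v"
    "v\<^sup>2 \<le> 4 / (real p)\<^sup>2" "1 / real p = v / (1 + v)" "(1 - 1 / real p) * (1 + v) = 1"
proof -
  have P: "real p \<ge> 2" using prime_ge_2_nat[OF p] by simp
  show v0: "0 < v" using P by (simp add: v_def)
  show "v \<le> 1" using P by (simp add: v_def)
  show v2: "v \<le> 2 / real p" using P by (simp add: v_def field_simps)
  show pv: "real p * v = 1 + v" using P by (simp add: v_def field_simps)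
  have "v\<^sup>2 \<le> (2 / real p)\<^sup>2" using v0 v2 by (intro power_mono) auto
  thus "v\<^sup>2 \<le> 4 / (real p)\<^sup>2" by (simp add: power_divide)
  show "1 / real p = v / (1 + v)" unfolding pv [symmetric] using P v0 by simp
  thus "(1 - 1 / real p) * (1 + v) = 1" using v0 by (simp add: field_simps)
qed

lemma local_weight_eq:
  "local_weight h1 h2 p False False = 1"
  "local_weight h1 h2 p True False = (if int p dvd h1 then v else - v\<^sup>2)"
  "local_weight h1 h2 p False True = (if int p dvd h2 then v else - v\<^sup>2)"
  "local_weight h1 h2 p True True = v\<^sup>2 * (1 - (if int p dvd h1 then 0 else 1 + v) -
     (if int p dvd h2 then 0 else 1 + v) +
     (if \<not> int p dvd h1 \<and> \<not> int p dvd h2 \<and> int p dvd h1 - h2 then real p * (1 + v) else 0))"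
proof -
  have v: "1 / (real p - 1) = v" by (simp add: v_def)
  have pv: "(t * real p) / (real p - 1) = t * (1 + v)" for t
    unfolding prime_recip_facts(4) [symmetric] by (simp add: v_def)
  have pv2: "(t * (real p)\<^sup>2) / (real p - 1) = t * (real p * (1 + v))" for t
    unfolding prime_recip_facts(4) [symmetric] by (simp add: v_def power2_eq_square)
  show "local_weight h1 h2 p False False = 1" by (simp add: local_weight_def)
  show "local_weight h1 h2 p True False = (if int p dvd h1 then v else - v\<^sup>2)"
    unfolding local_weight_def Let_def pv pv2 v by (simp add: power2_eq_square)
  show "local_weight h1 h2 p False True = (if int p dvd h2 then v else - v\<^sup>2)"
    unfolding local_weight_def Let_def pv pv2 v by (simp add: power2_eq_square)
  show "local_weight h1 h2 p True True = v\<^sup>2 * (1 - (if int p dvd h1 then 0 else 1 + v) -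
     (if int p dvd h2 then 0 else 1 + v) +
     (if \<not> int p dvd h1 \<and> \<not> int p dvd h2 \<and> int p dvd h1 - h2 then real p * (1 + v) else 0))"
    unfolding local_weight_def Let_def pv pv2 v by (simp add: power2_eq_square)
qed

text \<open>If 0, -h1 and -h2 are distinct modulo \<open>p\<close>, the terms of order 1/p cancel.
  This is the absolute convergence away from the diagonal.\<close>

lemma abs_local_weight_generic_le:
  assumes "\<not> int p dvd h1" "\<not> int p dvd h2" "\<not> int p dvd h1 - h2"
  shows "\<bar>local_weight h1 h2 p True False\<bar> \<le> 4 / (real p)\<^sup>2"
    "\<bar>local_weight h1 h2 p False True\<bar> \<le> 4 / (real p)\<^sup>2"
    "\<bar>local_weight h1 h2 p True True\<bar> \<le> 12 / (real p)\<^sup>2"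
proof -
  note v = prime_recip_facts
  show "\<bar>local_weight h1 h2 p True False\<bar> \<le> 4 / (real p)\<^sup>2"
    "\<bar>local_weight h1 h2 p False True\<bar> \<le> 4 / (real p)\<^sup>2"
    using assms v(5) unfolding local_weight_eq by simp_all
  have "\<bar>local_weight h1 h2 p True True\<bar> = v\<^sup>2 * (1 + 2 * v)"
    using assms v(1) unfolding local_weight_eq by (simp add: abs_mult)
  also have "\<dots> \<le> (4 / (real p)\<^sup>2) * 3" using v(1,2,5) by (intro mult_mono) auto
  finally show "\<bar>local_weight h1 h2 p True True\<bar> \<le> 12 / (real p)\<^sup>2" by simp
qed

text \<open>Without any assumption on the shifts only the order 1/p survives; the worst case is that
  p divides h1 - h2 alone, where p (1 + v) v^2 enters.\<close>

lemma abs_local_weight_le: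
  shows "\<bar>local_weight h1 h2 p True False\<bar> \<le> 2 / real p"
    "\<bar>local_weight h1 h2 p False True\<bar> \<le> 2 / real p"
    "\<bar>local_weight h1 h2 p True True\<bar> \<le> 20 / real p"
proof -
  note v = prime_recip_facts
  have P: "real p \<ge> 2" using prime_ge_2_nat[OF p] by simp
  have v2: "v\<^sup>2 \<le> v" using v(1,2) by (simp add: power2_eq_square mult_left_le)
  show "\<bar>local_weight h1 h2 p True False\<bar> \<le> 2 / real p"
    "\<bar>local_weight h1 h2 p False True\<bar> \<le> 2 / real p"
    using v(1,3) v2 unfolding local_weight_eq by auto
  have "real p * (1 + v) \<le> real p * 2" using v(2) by (intro mult_left_mono) auto
  moreover have "real p * (1 + v) \<ge> 0" using v(1) by simp
  ultimately have "\<bar>1 - (if int p dvd h1 then 0 else 1 + v) - (if int p dvd h2 then 0 else 1 + v) +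
     (if \<not> int p dvd h1 \<and> \<not> int p dvd h2 \<and> int p dvd h1 - h2 then real p * (1 + v) else 0)\<bar> \<le> 5 * real p"
    (is "\<bar>?t\<bar> \<le> _") using v(1,2) P by (simp only: abs_le_iff split: if_splits) linarith
  hence "v\<^sup>2 * \<bar>?t\<bar> \<le> (4 / (real p)\<^sup>2) * (5 * real p)"
    using v(5) by (intro mult_mono) auto
  also have "\<dots> = 20 / real p" using P by (simp add: power2_eq_square)
  finally show "\<bar>local_weight h1 h2 p True True\<bar> \<le> 20 / real p"
    unfolding local_weight_eq by (simp add: abs_mult)
qed

text \<open>The coefficient for p dividing q1 but not q2 ignores the second shift, hence the free
  \<open>h2\<close>.\<close>

lemma singular_factor_2:
  fixes j :: "nat \<Rightarrow> int"
  shows "(1 - 1 / real p) powi (- int 2) * (1 - real (nu p 2 j) / real p) =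
     1 + local_weight (j 1 - j 2) h2 p True False"
proof -
  note v = prime_recip_facts
  have inv: "inverse (1 - 1 / real p) = 1 + v" by (rule inverse_unique) (fact v(7))
  have pw: "(1 - 1 / real p) powi (- int 2) = (1 + v)\<^sup>2"
    by (simp only: power_int_minus power_int_of_nat power_inverse [symmetric] inv)
  have dvd: "j 1 mod int p = j 2 mod int p \<longleftrightarrow> int p dvd j 1 - j 2" by (simp add: mod_eq_dvd_iff)
  have "{1..2} = {1, 2::nat}" by auto
  hence nu: "nu p 2 j = (if int p dvd j 1 - j 2 then 1 else 2)"
    unfolding nu_def dvd [symmetric] by (auto simp: card_insert_if)
  have x: "real n / real p = real n * (v / (1 + v))" for n
    unfolding v(6) [symmetric] by simp
  have y: "(1 + v)\<^sup>2 * (1 - t * (v / (1 + v))) = (1 + v) * (1 + v - t * v)" for t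
    using v(1) by (simp add: field_simps power2_eq_square)
  show ?thesis unfolding pw x nu y local_weight_eq
    by (simp add: power2_eq_square algebra_simps)
qed

text \<open>With the third point as origin, \<open>nu\<close> is determined by which of h1, h2 and
  h1 - h2 the prime divides; each pattern gives a polynomial identity in \<open>v\<close>.\<close>

lemma singular_factor_3:
  fixes j :: "nat \<Rightarrow> int"
  shows "(1 - 1 / real p) powi (- int 3) * (1 - real (nu p 3 j) / real p) =
     sum4 (local_weight (j 1 - j 3) (j 2 - j 3) p)"
proof -
  note v = prime_recip_facts
  have inv: "inverse (1 - 1 / real p) = 1 + v" by (rule inverse_unique) (fact v(7))
  have pw: "(1 - 1 / real p) powi (- int 3) = (1 + v) ^ 3"
    by (simp only: power_int_minus power_int_of_nat power_inverse [symmetric] inv)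
  have dvd: "j 1 mod int p = j 3 mod int p \<longleftrightarrow> int p dvd j 1 - j 3"
    "j 2 mod int p = j 3 mod int p \<longleftrightarrow> int p dvd j 2 - j 3"
    "j 1 mod int p = j 2 mod int p \<longleftrightarrow> int p dvd (j 1 - j 3) - (j 2 - j 3)"
    by (simp_all add: mod_eq_dvd_iff)
  have "{1..3} = {1, 2, 3::nat}" by auto
  hence "nu p 3 j = card {j 1 mod int p, j 2 mod int p, j 3 mod int p}"
    unfolding nu_def by simp
  also have "card {a, b, c} = (if a = c then (if b = c then 1 else 2) else if b = c then 2
      else if a = b then 2 else 3)" for a b c :: int
    by (auto simp: card_insert_if)
  finally have nu: "nu p 3 j = (if j 1 mod int p = j 3 mod int p
      then (if j 2 mod int p = j 3 mod int p then 1 else 2)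
      else if j 2 mod int p = j 3 mod int p then 2
      else if j 1 mod int p = j 2 mod int p then 2 else 3)" .
  have x: "real n / real p = real n * (v / (1 + v))" for n
    unfolding v(6) [symmetric] by simp
  have y: "(1 + v) ^ 3 * (1 - t * (v / (1 + v))) = (1 + v) * (1 + v) * (1 + v - t * v)" for t
    using v(1) by (simp add: field_simps power3_eq_cube)
  \<comment> \<open>The one term still containing p is made polynomial in \<open>v\<close> by p v =
    1 + v.\<close>
  have z: "v\<^sup>2 * (a + real p * (1 + v)) = v\<^sup>2 * a + v * (1 + v) * (1 + v)" for a
    unfolding v(4) [symmetric] by (simp add: algebra_simps power2_eq_square)
  show ?thesis unfolding pw x nu y sum4_def local_weight_eq dvd [symmetric]
    by (auto simp: z) (auto simp: power2_eq_square algebra_simps)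
qed

end

section \<open>From finite to infinite Euler products\<close>

definition primes_upto :: "nat \<Rightarrow> nat set" where
  "primes_upto M = {p. prime p \<and> p \<le> M}"

lemma finite_primes_upto [simp]: "finite (primes_upto M)"
  by (rule finite_subset[of _ "{..M}"]) (auto simp: primes_upto_def)

text \<open>A number larger than |H| cannot divide H, so all but finitely many factors deviate from
  1 by a summable amount; vanishing factors do no harm to the limit.\<close>

lemma tendsto_prod_primes:
  fixes f :: "nat \<Rightarrow> real" and H :: int
  assumes "H \<noteq> 0"
    and "\<And>p. prime p \<Longrightarrow> \<not> int p dvd H \<Longrightarrow> \<bar>f p - 1\<bar> \<le> K * real p powr (-3/2)"
    and "K \<ge> 0"
  shows "(\<lambda>M. \<Prod>p\<in>primes_upto M. f p) \<longlonglongrightarrow> prodinf (\<lambda>p. if prime p then f p else 1)"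
proof -
  define g where "g p = (if prime p then f p else 1)" for p
  have "summable (\<lambda>p. norm (g p - 1))"
  proof (rule summable_comparison_test_ev)
    show "summable (\<lambda>n. K * real n powr (-3/2))"
      by (intro summable_mult) (simp add: summable_real_powr_iff)
    show "\<forall>\<^sub>F n in sequentially. norm (norm (g n - 1)) \<le> K * real n powr (-3/2)"
      using eventually_gt_at_top[of "nat \<bar>H\<bar>"]
    proof eventually_elim
      case (elim n)
      have "\<not> int n dvd H"
        using elim dvd_imp_le_int[OF assms(1), of "int n"] by auto
      thus ?case using assms(2,3) by (auto simp: g_def)
    qed
  qed
  hence "convergent_prod g"
    by (intro abs_convergent_prod_imp_convergent_prod)
       (simp add: abs_convergent_prod_conv_summable)
  hence "(\<lambda>M. \<Prod>p\<le>M. g p) \<longlonglongrightarrow> prodinf g" by (rule convergent_prod_LIMSEQ)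
  moreover have "(\<Prod>p\<le>M. g p) = (\<Prod>p\<in>primes_upto M. f p)" for M
    by (rule prod.mono_neutral_cong_right) (auto simp: g_def primes_upto_def)
  ultimately show ?thesis by (simp add: g_def [abs_def])
qed

lemma powr_neg2_le: "prime p \<Longrightarrow> K \<ge> 0 \<Longrightarrow> K / (real p)\<^sup>2 \<le> K * real p powr (-3/2)"
proof -
  assume p: "prime p" and K: "K \<ge> 0"
  have P: "real p \<ge> 2" using prime_ge_2_nat[OF p] by simp
  have "1 / (real p)\<^sup>2 = real p powr (-2)" using P by (simp add: powr_minus divide_inverse)
  also have "\<dots> \<le> real p powr (-3/2)" using P by (intro powr_mono) auto
  finally have "K * (1 / (real p)\<^sup>2) \<le> K * real p powr (-3/2)" using K by (rule mult_left_mono)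
  thus ?thesis by simp
qed

text \<open>The exponent 1/4 in both variables multiplies a weight by at most p^(1/2): a generic
  p^(-2) becomes the summable p^(-3/2), and an exceptional 1/p stays bounded. The constants are 20 =
  4 + 4 + 12 and 24 = 2 + 2 + 20.\<close>

lemma weighted_local_sum_le:
  fixes h1 h2 :: int
  assumes p: "prime p"
  defines "F \<equiv> rankin_factor (1/4) (local_weight h1 h2) p"
  shows "\<not> int p dvd h1 * h2 * (h1 - h2) \<Longrightarrow> F \<le> 1 + 20 * real p powr (-3/2)"
    and "F \<le> 1 + 24"
proof -
  have P: "real p \<ge> 2" using prime_ge_2_nat[OF p] by simp
  define w where "w = real p powr (1/4)"
  have w: "w \<ge> 1" unfolding w_def using P by (intro ge_one_powr_ge_zero) auto
  have ww: "w * w \<ge> 1" "w \<le> w * w" using w mult_mono[of 1 w 1 w] mult_left_mono[of 1 w w] by auto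
  have F: "F = 1 + \<bar>local_weight h1 h2 p False True\<bar> * w + \<bar>local_weight h1 h2 p True False\<bar> * w +
      \<bar>local_weight h1 h2 p True True\<bar> * (w * w)"
    by (simp add: F_def sum4_def prime_wt_def w_def local_weight_eq(1)[OF p])
  have bound: "F \<le> 1 + (a + a + b) * (w * w)"
    if "\<bar>local_weight h1 h2 p True False\<bar> \<le> a" "\<bar>local_weight h1 h2 p False True\<bar> \<le> a"
      "\<bar>local_weight h1 h2 p True True\<bar> \<le> b" for a b
  proof -
    have "\<bar>local_weight h1 h2 p False True\<bar> * w \<le> a * (w * w)"
      using that(2) w ww by (intro mult_mono) auto
    moreover have "\<bar>local_weight h1 h2 p True False\<bar> * w \<le> a * (w * w)"
      using that(1) w ww by (intro mult_mono) auto
    moreover have "\<bar>local_weight h1 h2 p True True\<bar> * (w * w) \<le> b * (w * w)"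
      using that(3) ww by (intro mult_right_mono) auto
    ultimately show ?thesis unfolding F by (simp add: distrib_right)
  qed
  have w2: "w * w = real p powr (1/2)" by (simp add: w_def flip: powr_add)
  {
    assume "\<not> int p dvd h1 * h2 * (h1 - h2)"
    hence nd: "\<not> int p dvd h1" "\<not> int p dvd h2" "\<not> int p dvd h1 - h2" by auto
    have "F \<le> 1 + (4 / (real p)\<^sup>2 + 4 / (real p)\<^sup>2 + 12 / (real p)\<^sup>2) * (w * w)"
      by (rule bound[OF abs_local_weight_generic_le[OF p nd]])
    also have "4 / (real p)\<^sup>2 + 4 / (real p)\<^sup>2 + 12 / (real p)\<^sup>2 = 20 * real p powr (-2)"
      using P by (simp add: powr_minus divide_inverse)
    also have "20 * real p powr (-2) * (w * w) = 20 * real p powr (-3/2)"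
      unfolding w2 by (simp add: mult.assoc flip: powr_add)
    finally show "F \<le> 1 + 20 * real p powr (-3/2)" .
  }
  have "F \<le> 1 + (2 / real p + 2 / real p + 20 / real p) * (w * w)"
    by (rule bound[OF abs_local_weight_le[OF p]])
  also have "(2 / real p + 2 / real p + 20 / real p) * (w * w) \<le> (24 / real p) * real p"
  proof (rule mult_mono)
    have "real p powr (1/2) \<le> real p powr 1" using P by (intro powr_mono) auto
    thus "w * w \<le> real p" unfolding w2 using P by simp
  qed (use ww in auto)
  finally show "F \<le> 1 + 24" using P by simp
qed

abbreviation bad_prime_factor :: "int \<Rightarrow> real" where
  "bad_prime_factor H \<equiv> exp (20 * zeta32 + 24 * real (card (prime_factors (nat \<bar>H\<bar>))))"

lemma weighted_local_product_le:
  fixes h1 h2 :: int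
  assumes "h1 \<noteq> 0" "h2 \<noteq> 0" "h1 \<noteq> h2" "finite A" "\<And>p. p \<in> A \<Longrightarrow> prime p"
  shows "(\<Prod>p\<in>A. rankin_factor (1/4) (local_weight h1 h2) p)
    \<le> bad_prime_factor (h1 * h2 * (h1 - h2))"
proof -
  let ?H = "h1 * h2 * (h1 - h2)"
  let ?B = "{p. int p dvd ?H}"
  have H: "?H \<noteq> 0" using assms by simp
  have nonneg: "rankin_factor (1/4) (local_weight h1 h2) p \<ge> 0" for p
    by (simp add: sum4_def prime_wt_def)
  have "(\<Prod>p\<in>A. rankin_factor (1/4) (local_weight h1 h2) p)
      \<le> exp (20 * zeta32 + (\<Sum>p\<in>A \<inter> ?B. 24))"
    using assms(4,5) nonneg weighted_local_sum_le by (intro euler_product_le) auto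
  also have "\<dots> \<le> bad_prime_factor ?H"
  proof -
    have "A \<inter> ?B \<subseteq> prime_factors (nat \<bar>?H\<bar>)"
    proof
      fix p assume "p \<in> A \<inter> ?B"
      hence "prime p" "int p dvd \<bar>?H\<bar>" using assms(5) by auto
      hence "p dvd nat \<bar>?H\<bar>" by (simp only: int_dvd_int_iff [symmetric] int_nat_eq abs_ge_zero if_True)
      thus "p \<in> prime_factors (nat \<bar>?H\<bar>)" using H \<open>prime p\<close> by (simp add: prime_factors_dvd)
    qed
    hence "card (A \<inter> ?B) \<le> card (prime_factors (nat \<bar>?H\<bar>))" by (intro card_mono) auto
    thus ?thesis by simp
  qed
  finally show ?thesis .
qed

lemma main_term_truncation:
  fixes c :: "nat \<Rightarrow> bool \<Rightarrow> bool \<Rightarrow> real" and h1 h2 :: int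
  assumes h: "h1 \<noteq> 0" "h2 \<noteq> 0" "h1 \<noteq> h2"
    and T: "\<And>A. finite A \<Longrightarrow> (\<And>p. p \<in> A \<Longrightarrow> prime p) \<Longrightarrow> (\<And>p. prime p \<Longrightarrow> p \<le> Q \<Longrightarrow> p \<in> A) \<Longrightarrow>
      T = truncated_sum A Q Q c"
    and c: "\<And>p b1 b2. prime p \<Longrightarrow> \<bar>c p b1 b2\<bar> \<le> \<bar>local_weight h1 h2 p b1 b2\<bar>"
    and c1: "\<And>p. prime p \<Longrightarrow> c p False False = 1"
  shows "\<bar>T - prodinf (\<lambda>p. if prime p then sum4 (c p) else 1)\<bar> \<le>
    bad_prime_factor (h1 * h2 * (h1 - h2)) / real (Suc Q) powr (1/4)"
    (is "\<bar>T - ?S\<bar> \<le> ?B")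
proof -
  have pr: "prime p" if "p \<in> primes_upto M" for p M using that by (simp add: primes_upto_def)
  have lim: "(\<lambda>M. \<Prod>p\<in>primes_upto M. sum4 (c p)) \<longlonglongrightarrow> ?S"
  proof (rule tendsto_prod_primes)
    show "h1 * h2 * (h1 - h2) \<noteq> 0" using h by simp
    fix p assume p: "prime p" and "\<not> int p dvd h1 * h2 * (h1 - h2)"
    hence nd: "\<not> int p dvd h1" "\<not> int p dvd h2" "\<not> int p dvd h1 - h2" by auto
    note b = order_trans[OF c[OF p] abs_local_weight_generic_le(1)[OF p nd]]
      order_trans[OF c[OF p] abs_local_weight_generic_le(2)[OF p nd]]
      order_trans[OF c[OF p] abs_local_weight_generic_le(3)[OF p nd]]
    have "\<bar>sum4 (c p) - 1\<bar> \<le> 4 / (real p)\<^sup>2 + 4 / (real p)\<^sup>2 + 12 / (real p)\<^sup>2"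
      unfolding sum4_def c1[OF p] using b by linarith
    also have "\<dots> = 20 / (real p)\<^sup>2" by simp
    also have "\<dots> \<le> 20 * real p powr (-3/2)" using p by (intro powr_neg2_le) auto
    finally show "\<bar>sum4 (c p) - 1\<bar> \<le> 20 * real p powr (-3/2)" .
  qed simp
  have "\<forall>M\<ge>Q. \<bar>T - (\<Prod>p\<in>primes_upto M. sum4 (c p))\<bar> \<le> ?B"
  proof (intro allI impI)
    fix M assume M: "M \<ge> Q"
    have T': "T = truncated_sum (primes_upto M) Q Q c"
      using M by (intro T) (auto simp: primes_upto_def)
    have "\<bar>T - (\<Prod>p\<in>primes_upto M. sum4 (c p))\<bar> \<le>
        (\<Prod>p\<in>primes_upto M. rankin_factor (1/4) c p) /
        real (Suc Q) powr (1/4)"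
      unfolding T' by (intro rankin_tail pr) auto
    also have "\<dots> \<le> ?B"
    proof (rule divide_right_mono)
      have "(\<Prod>p\<in>primes_upto M. rankin_factor (1/4) c p)
        \<le> (\<Prod>p\<in>primes_upto M. rankin_factor (1/4) (local_weight h1 h2) p)"
        unfolding sum4_def
        by (intro prod_mono conjI add_mono mult_right_mono add_nonneg_nonneg mult_nonneg_nonneg c pr)
           (auto simp: prime_wt_def)
      also have "\<dots> \<le> bad_prime_factor (h1 * h2 * (h1 - h2))"
        by (intro weighted_local_product_le h pr) auto
      finally show "(\<Prod>p\<in>primes_upto M. rankin_factor (1/4) c p)
        \<le> bad_prime_factor (h1 * h2 * (h1 - h2))" .
    qed simp
    finally show "\<bar>T - (\<Prod>p\<in>primes_upto M. sum4 (c p))\<bar> \<le> ?B" .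
  qed
  moreover have "(\<lambda>M. \<bar>T - (\<Prod>p\<in>primes_upto M. sum4 (c p))\<bar>) \<longlonglongrightarrow> \<bar>T - ?S\<bar>"
    by (intro tendsto_intros lim)
  ultimately show ?thesis by (intro LIMSEQ_le_const2) blast+
qed

lemma main_term_tuple3:
  fixes j :: "nat \<Rightarrow> int"
  assumes "j 1 \<noteq> j 3" "j 2 \<noteq> j 3" "j 1 \<noteq> j 2"
  shows "\<bar>main_term Q Q (j 1 - j 3) (j 2 - j 3) - singular_series 3 j\<bar> \<le>
    bad_prime_factor ((j 1 - j 3) * (j 2 - j 3) * (j 1 - j 2))
      / real (Suc Q) powr (1/4)"
proof -
  let ?c = "local_weight (j 1 - j 3) (j 2 - j 3)"
  have eq: "singular_series 3 j = prodinf (\<lambda>p. if prime p then sum4 (?c p) else 1)"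
    unfolding singular_series_def by (intro prodinf_cong if_cong refl singular_factor_3)
  have h: "j 1 - j 3 - (j 2 - j 3) = j 1 - j 2" by simp
  show ?thesis unfolding eq h [symmetric]
  proof (rule main_term_truncation)
    fix A :: "nat set" assume A: "finite A" "\<And>p. p \<in> A \<Longrightarrow> prime p"
      and AQ: "\<And>p. prime p \<Longrightarrow> p \<le> Q \<Longrightarrow> p \<in> A"
    show "main_term Q Q (j 1 - j 3) (j 2 - j 3) = truncated_sum A Q Q ?c"
      using AQ by (intro main_term_eq_sum_Pow A) auto
  qed (use assms in \<open>auto simp: local_weight_eq(1)\<close>)
qed

text \<open>Only the empty set has product at most Q2 = 1, so the coefficients with p | q2 can be
  set to 0 and the second truncation raised to \<open>Q\<close>. The second shift is a dummy: with
  -h the numbers h, -h and 2h are all nonzero, as \<open>main_term_truncation\<close>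
  demands.\<close>

lemma main_term_tuple2:
  fixes j :: "nat \<Rightarrow> int"
  assumes "j 1 \<noteq> j 2" "Q \<ge> 1"
  defines "h \<equiv> j 1 - j 2"
  shows "\<bar>main_term Q 1 h (- h) - singular_series 2 j\<bar> \<le>
    bad_prime_factor (h * - h * (h - - h))
      / real (Suc Q) powr (1/4)"
proof -
  define c where "c p b1 b2 = (if b2 then 0 else local_weight h (- h) p b1 False)" for p b1 b2
  have eq: "singular_series 2 j = prodinf (\<lambda>p. if prime p then sum4 (c p) else 1)"
    unfolding singular_series_def
  proof (intro prodinf_cong if_cong refl)
    fix p :: nat assume p: "prime p"
    show "(1 - 1 / real p) powi (- int 2) * (1 - real (nu p 2 j) / real p) = sum4 (c p)"
      unfolding singular_factor_2[OF p, of j "- h"]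
      by (simp add: sum4_def c_def local_weight_eq(1)[OF p] h_def)
  qed
  show ?thesis unfolding eq
  proof (rule main_term_truncation)
    fix A :: "nat set" assume A: "finite A" "\<And>p. p \<in> A \<Longrightarrow> prime p"
      and AQ: "\<And>p. prime p \<Longrightarrow> p \<le> Q \<Longrightarrow> p \<in> A"
    have "main_term Q 1 h (- h) = truncated_sum A Q 1 (local_weight h (- h))"
      using AQ assms(2) by (intro main_term_eq_sum_Pow A) auto
    also have "\<dots> = truncated_sum A Q Q c"
    proof (intro sum.cong refl)
      fix X1 X2 assume X: "X1 \<in> Pow A" "X2 \<in> Pow A"
      show "(if \<Prod>X1 \<le> Q \<and> \<Prod>X2 \<le> 1 then (\<Prod>p\<in>A. local_weight h (- h) p (p \<in> X1) (p \<in> X2)) else 0) =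
        (if \<Prod>X1 \<le> Q \<and> \<Prod>X2 \<le> Q then (\<Prod>p\<in>A. c p (p \<in> X1) (p \<in> X2)) else 0)"
      proof (cases "X2 = {}")
        case True
        thus ?thesis using assms(2) by (simp add: c_def)
      next
        case False
        then obtain p where p: "p \<in> X2" by blast
        have fin: "finite X2" using X(2) A(1) by (auto intro: finite_subset)
        have pr2: "prime q" if "q \<in> X2" for q using A(2) X(2) that by blast
        have "p dvd \<Prod>X2" using p fin by (intro dvd_prodI)
        moreover have "\<Prod>X2 > 0" by (rule prod_primes_pos[OF pr2])
        ultimately have "p \<le> \<Prod>X2" by (rule dvd_imp_le)
        hence "\<not> \<Prod>X2 \<le> 1" using prime_gt_1_nat[OF pr2[OF p]] by simp
        moreover have "(\<Prod>p\<in>A. c p (p \<in> X1) (p \<in> X2)) = 0"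
          using A(1) p X(2) by (intro prod_zero bexI[of _ p]) (auto simp: c_def)
        ultimately show ?thesis by simp
      qed
    qed
    finally show "main_term Q 1 h (- h) = truncated_sum A Q Q c" .
  qed (use assms in \<open>auto simp: c_def local_weight_eq(1)\<close>)
qed

section \<open>The logarithmically divergent diagonal\<close>

text \<open>Let X and Y multiply the first and the second argument of \<open>W\<close> by p. This is
  the polynomial in X and Y with coefficients \<open>g p a b\<close>, applied to \<open>W\<close>.
  Degree 2 leaves room for a bilinear local factor times 1 - XY/p.\<close>

definition shift_sum :: "(nat \<Rightarrow> nat \<Rightarrow> nat \<Rightarrow> real) \<Rightarrow> nat \<Rightarrow> (nat \<Rightarrow> nat \<Rightarrow> real) \<Rightarrow> nat \<Rightarrow> nat \<Rightarrow> real" where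
  "shift_sum g p W x y = (\<Sum>a\<le>2. \<Sum>b\<le>2. g p a b * W (x * p ^ a) (y * p ^ b))"

text \<open>The Euler product of these operators, composed along a list so that \<open>W\<close> can
  vary in the inductions.\<close>

fun euler_op :: "nat list \<Rightarrow> (nat \<Rightarrow> nat \<Rightarrow> nat \<Rightarrow> real) \<Rightarrow> (nat \<Rightarrow> nat \<Rightarrow> real) \<Rightarrow> nat \<Rightarrow> nat \<Rightarrow> real" where
  "euler_op [] g W = W"
| "euler_op (p # ps) g W = euler_op ps g (shift_sum g p W)"

lemma euler_op_cong:
  assumes "\<And>p. p \<in> set ps \<Longrightarrow> p > 0"
    and "\<And>x y. x > 0 \<Longrightarrow> y > 0 \<Longrightarrow> W x y = W' x y" and "x > 0" "y > 0"
  shows "euler_op ps g W x y = euler_op ps g W' x y"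
  using assms
proof (induction ps arbitrary: W W')
  case (Cons p ps)
  have "shift_sum g p W x y = shift_sum g p W' x y" if "x > 0" "y > 0" for x y
    unfolding shift_sum_def using that Cons.prems(1)[of p]
    by (intro sum.cong refl arg_cong2[of _ _ _ _ "(*)"] Cons.prems(2)) auto
  thus ?case using Cons.prems by (auto intro: Cons.IH)
qed simp

lemma abs_euler_op_le:
  assumes "\<And>p. p \<in> set ps \<Longrightarrow> p > 0"
    and "\<And>x y. x > 0 \<Longrightarrow> y > 0 \<Longrightarrow> \<bar>W x y\<bar> \<le> U x y" and "x > 0" "y > 0"
  shows "\<bar>euler_op ps g W x y\<bar> \<le> euler_op ps (\<lambda>p a b. \<bar>g p a b\<bar>) U x y"
  using assms
proof (induction ps arbitrary: W U)
  case (Cons p ps)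
  have "\<bar>shift_sum g p W x y\<bar> \<le> shift_sum (\<lambda>p a b. \<bar>g p a b\<bar>) p U x y" if "x > 0" "y > 0" for x y
    unfolding shift_sum_def
  proof (rule order_trans[OF sum_abs], rule sum_mono, rule order_trans[OF sum_abs], rule sum_mono)
    fix a b :: nat
    have "\<bar>W (x * p ^ a) (y * p ^ b)\<bar> \<le> U (x * p ^ a) (y * p ^ b)"
      using that Cons.prems(1)[of p] by (intro Cons.prems(2)) auto
    thus "\<bar>g p a b * W (x * p ^ a) (y * p ^ b)\<bar> \<le> \<bar>g p a b\<bar> * U (x * p ^ a) (y * p ^ b)"
      unfolding abs_mult by (intro mult_left_mono) auto
  qed
  thus ?case using Cons.prems by (auto intro: Cons.IH)
qed simp

lemma euler_op_diff:
  "euler_op ps g (\<lambda>x y. W x y - k * W' x y) x y = euler_op ps g W x y - k * euler_op ps g W' x y"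
proof (induction ps arbitrary: W W')
  case (Cons p ps)
  have "shift_sum g p (\<lambda>x y. W x y - k * W' x y) =
      (\<lambda>x y. shift_sum g p W x y - k * shift_sum g p W' x y)"
    by (intro ext) (simp add: shift_sum_def sum_distrib_left sum_subtractf right_diff_distrib mult.left_commute)
  thus ?case using Cons.IH by simp
qed simp

text \<open>For completely multiplicative u, the function u(x) u(y) is an eigenfunction of all
  shifts, with the local factors as eigenvalues. The choice u = 1 gives the complete product, u(x) =
  x^s the Rankin product.\<close>

lemma euler_op_multiplicative:
  assumes u: "\<And>x y. u (x * y) = u x * u y" and u1: "u 1 = 1"
  shows "euler_op ps g (\<lambda>x y. k * (u x * u y)) x y =
    k * (u x * u y) * (\<Prod>p\<leftarrow>ps. \<Sum>a\<le>2. \<Sum>b\<le>2. g p a b * u p ^ (a + b))"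
proof (induction ps arbitrary: k)
  case (Cons p ps)
  have up: "u (p ^ n) = u p ^ n" for n
    by (induction n) (use u1 in \<open>simp_all add: u\<close>)
  let ?c = "\<Sum>a\<le>2. \<Sum>b\<le>2. g p a b * u p ^ (a + b)"
  have "shift_sum g p (\<lambda>x y. k * (u x * u y)) = (\<lambda>x y. (k * ?c) * (u x * u y))"
  proof (intro ext)
    fix x y
    have "shift_sum g p (\<lambda>x y. k * (u x * u y)) x y =
        (\<Sum>a\<le>2. \<Sum>b\<le>2. (k * (u x * u y)) * (g p a b * u p ^ (a + b)))"
      unfolding shift_sum_def u up by (intro sum.cong refl) (simp add: power_add)
    also have "\<dots> = (k * ?c) * (u x * u y)" by (simp only: sum_distrib_left [symmetric] mult_ac)
    finally show "shift_sum g p (\<lambda>x y. k * (u x * u y)) x y = (k * ?c) * (u x * u y)" .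
  qed
  thus ?case using Cons.IH by simp
qed simp

text \<open>The inverse of the product of 1 - XY/p over p in \<open>P\<close>: its expansion scales
  both arguments by the integers u composed of primes in \<open>P\<close>, with weight 1/u. Stopping
  at u \<le> Q loses nothing when \<open>W\<close> vanishes for x > Q.\<close>

definition smooth_sum :: "nat \<Rightarrow> nat set \<Rightarrow> (nat \<Rightarrow> nat \<Rightarrow> real) \<Rightarrow> nat \<Rightarrow> nat \<Rightarrow> real" where
  "smooth_sum Q P W x y = (\<Sum>u | u \<in> {1..Q} \<and> prime_factors u \<subseteq> P. W (x * u) (y * u) / real u)"

lemma smooth_sum_insert:
  assumes p: "prime p" "p \<notin> P" and W: "\<And>x y. x > Q \<Longrightarrow> W x y = 0" and x: "x > 0"
  shows "smooth_sum Q (insert p P) W x y =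
    smooth_sum Q P W x y + smooth_sum Q (insert p P) W (x * p) (y * p) / real p"
proof -
  have p0: "p > 0" using p prime_gt_0_nat by blast
  let ?U = "{u. u \<in> {1..Q} \<and> prime_factors u \<subseteq> insert p P}"
  let ?V = "{u. u \<in> {1..Q} \<and> prime_factors u \<subseteq> P}"
  let ?f = "\<lambda>u. W (x * u) (y * u) / real u"
  have fin: "finite ?U" "finite ?V" by (rule finite_subset[of _ "{1..Q}"]; blast)+
  have "smooth_sum Q (insert p P) W x y = (\<Sum>u\<in>?V. ?f u) + (\<Sum>u\<in>?U - ?V. ?f u)"
    unfolding smooth_sum_def using fin by (subst sum.subset_diff[of ?V ?U]) auto
  also have "(\<Sum>u\<in>?U - ?V. ?f u) = (\<Sum>u\<in>(\<lambda>u. p * u) ` {u\<in>?U. p * u \<le> Q}. ?f u)"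
  proof (rule sum.cong)
    show "?U - ?V = (\<lambda>u. p * u) ` {u\<in>?U. p * u \<le> Q}"
    proof (rule Set.set_eqI, rule iffI)
      fix u assume u: "u \<in> ?U - ?V"
      hence "p \<in> prime_factors u" by blast
      hence "p dvd u" by auto
      then obtain w where w: "u = p * w" by auto
      have "w > 0" "w \<le> Q" using u w p0 by (auto intro!: Nat.gr0I intro: le_trans[of _ "p * w"])
      moreover have "prime_factors w \<subseteq> prime_factors u"
        using w u by (intro dvd_prime_factors) auto
      ultimately show "u \<in> (\<lambda>u. p * u) ` {u\<in>?U. p * u \<le> Q}"
        using u w by (intro image_eqI[of _ _ w]) auto
    next
      fix u assume "u \<in> (\<lambda>u. p * u) ` {u\<in>?U. p * u \<le> Q}"
      then obtain w where w: "u = p * w" "w \<in> {1..Q}" "prime_factors w \<subseteq> insert p P" "p * w \<le> Q"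
        by blast
      have "prime_factors u = insert p (prime_factors w)"
        using w p p0 by (simp add: prime_factors_product prime_prime_factors)
      thus "u \<in> ?U - ?V" using w p p0 by auto
    qed
  qed simp
  also have "\<dots> = (\<Sum>u\<in>{u\<in>?U. p * u \<le> Q}. ?f (p * u))"
    using p0 by (subst sum.reindex) (auto simp: inj_on_def)
  also have "\<dots> = (\<Sum>u\<in>?U. ?f (p * u))"
  proof (rule sum.mono_neutral_left)
    show "\<forall>u\<in>?U - {u\<in>?U. p * u \<le> Q}. ?f (p * u) = 0"
    proof
      fix u assume "u \<in> ?U - {u\<in>?U. p * u \<le> Q}"
      hence "p * u > Q" by auto
      moreover have "p * u \<le> x * (p * u)" using x by simp
      ultimately have "x * (p * u) > Q" by linarith
      thus "?f (p * u) = 0" using W by simp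
    qed
  qed (use fin in auto)
  also have "\<dots> = smooth_sum Q (insert p P) W (x * p) (y * p) / real p"
    unfolding smooth_sum_def sum_divide_distrib by (intro sum.cong refl) (simp add: mult_ac)
  finally show ?thesis by (simp add: smooth_sum_def)
qed

text \<open>Exponents instead of Booleans, extended by 0, make multiplication by 1 - XY/p an index
  shift.\<close>

definition pair_weight :: "(nat \<Rightarrow> bool \<Rightarrow> bool \<Rightarrow> real) \<Rightarrow> nat \<Rightarrow> nat \<Rightarrow> nat \<Rightarrow> real" where
  "pair_weight c p a b = (if a \<le> 1 \<and> b \<le> 1 then c p (a = 1) (b = 1) else 0)"

text \<open>The coefficients of the local factor \<open>\<Sum> c\<^sub>a\<^sub>b X\<^sup>a Y\<^sup>b\<close> multiplied by \<open>1 - XY/p\<close>: this divides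
  out the factor \<open>\<zeta>(s + 1)\<close> that makes the diagonal sum diverge logarithmically.\<close>
definition diag_weight :: "(nat \<Rightarrow> bool \<Rightarrow> bool \<Rightarrow> real) \<Rightarrow> nat \<Rightarrow> nat \<Rightarrow> nat \<Rightarrow> real" where
  "diag_weight c p a b = pair_weight c p a b -
     (if a \<ge> 1 \<and> b \<ge> 1 then pair_weight c p (a - 1) (b - 1) / real p else 0)"

lemma sum_upto2: "(\<Sum>a\<le>2. \<Sum>b\<le>2. f a b) = f 0 0 + f 0 1 + f 0 2 + f 1 0 + f 1 1 + f 1 2 +
    f 2 0 + f 2 1 + f (2::nat) (2::nat)" for f :: "nat \<Rightarrow> nat \<Rightarrow> real"
  by (simp add: numeral_2_eq_2)

text \<open>The factor 1 - XY/p contained in \<open>diag_weight\<close> cancels the corresponding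
  factor of \<open>smooth_sum\<close>, which thereby loses the prime \<open>p\<close>.\<close>

lemma shift_sum_smooth_sum:
  assumes p: "prime p" "p \<notin> P" and W: "\<And>x y. x > Q \<Longrightarrow> W x y = 0" and x: "x > 0"
  shows "shift_sum (diag_weight c) p (smooth_sum Q (insert p P) W) x y =
    smooth_sum Q P (shift_sum (pair_weight c) p W) x y"
proof -
  let ?V = "smooth_sum Q (insert p P) W"
  have p0: "p > 0" using p prime_gt_0_nat by blast
  have step: "smooth_sum Q P W x' y' = ?V x' y' - ?V (x' * p) (y' * p) / real p" if "x' > 0" for x' y'
    using smooth_sum_insert[OF p W that, where y = y'] by simp
  have "smooth_sum Q P (shift_sum (pair_weight c) p W) x y =
      (\<Sum>u | u \<in> {1..Q} \<and> prime_factors u \<subseteq> P. \<Sum>a\<le>2. \<Sum>b\<le>2.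
        pair_weight c p a b * (W (x * p ^ a * u) (y * p ^ b * u) / real u))"
    unfolding smooth_sum_def shift_sum_def
    by (intro sum.cong refl) (simp add: sum_divide_distrib mult_ac)
  also have "\<dots> = (\<Sum>a\<le>2. \<Sum>u | u \<in> {1..Q} \<and> prime_factors u \<subseteq> P. \<Sum>b\<le>2.
        pair_weight c p a b * (W (x * p ^ a * u) (y * p ^ b * u) / real u))"
    by (rule sum.swap)
  also have "\<dots> = (\<Sum>a\<le>2. \<Sum>b\<le>2. \<Sum>u | u \<in> {1..Q} \<and> prime_factors u \<subseteq> P.
        pair_weight c p a b * (W (x * p ^ a * u) (y * p ^ b * u) / real u))"
    by (intro sum.cong refl sum.swap)
  also have "\<dots> = (\<Sum>a\<le>2. \<Sum>b\<le>2. pair_weight c p a b * smooth_sum Q P W (x * p ^ a) (y * p ^ b))"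
    unfolding smooth_sum_def sum_distrib_left ..
  also have "\<dots> = (\<Sum>a\<le>2. \<Sum>b\<le>2. pair_weight c p a b *
      (?V (x * p ^ a) (y * p ^ b) - ?V (x * p ^ a * p) (y * p ^ b * p) / real p))"
    using x p0 by (intro sum.cong refl arg_cong2[of _ _ _ _ "(*)"] step) auto
  also have "\<dots> = shift_sum (diag_weight c) p ?V x y"
    unfolding shift_sum_def sum_upto2
    by (simp add: pair_weight_def diag_weight_def algebra_simps power2_eq_square
        add_divide_distrib diff_divide_distrib)
  finally show ?thesis by simp
qed

text \<open>The cancellation is repeated prime by prime until only u = 1 is left, which Q \<ge> 1
  keeps in range.\<close>

lemma euler_op_smooth_sum:
  assumes "\<And>p. p \<in> set ps \<Longrightarrow> prime p" "distinct ps" "Q \<ge> 1"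
    and "\<And>x y. x > Q \<Longrightarrow> W x y = 0" and "x > 0" "y > 0"
  shows "euler_op ps (diag_weight c) (smooth_sum Q (set ps) W) x y = euler_op ps (pair_weight c) W x y"
  using assms
proof (induction ps arbitrary: W)
  case Nil
  have "{u. u \<in> {1..Q} \<and> prime_factors u \<subseteq> {}} = {1}"
    using Nil by (auto simp: prime_factorization_empty_iff)
  thus ?case unfolding smooth_sum_def by simp
next
  case (Cons p ps)
  have p: "prime p" "p \<notin> set ps" using Cons.prems by auto
  have pos: "q > 0" if "q \<in> set ps" for q using Cons.prems(1)[of q] that prime_gt_0_nat by auto
  \<comment> \<open>Shifts never decrease x, so the vanishing beyond \<open>Q\<close> is inherited
    and the induction can continue.\<close>
  have vanish: "shift_sum (pair_weight c) p W x y = 0" if "x > Q" for x y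
  proof -
    have "x * p ^ a > Q" for a
      using that prime_gt_0_nat[OF p(1)] by (metis One_nat_def Suc_leI less_le_trans mult.right_neutral mult_le_mono2 zero_less_power)
    thus ?thesis unfolding shift_sum_def using Cons.prems(4) by (intro sum.neutral ballI) simp
  qed
  have "euler_op (p # ps) (diag_weight c) (smooth_sum Q (set (p # ps)) W) x y =
      euler_op ps (diag_weight c) (shift_sum (diag_weight c) p (smooth_sum Q (insert p (set ps)) W)) x y"
    by simp
  also have "\<dots> = euler_op ps (diag_weight c) (smooth_sum Q (set ps) (shift_sum (pair_weight c) p W)) x y"
  proof (rule euler_op_cong)
    fix x y :: nat assume "x > 0"
    thus "shift_sum (diag_weight c) p (smooth_sum Q (insert p (set ps)) W) x y =
        smooth_sum Q (set ps) (shift_sum (pair_weight c) p W) x y"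
      by (intro shift_sum_smooth_sum p Cons.prems(4))
  qed (use pos Cons.prems(5,6) in auto)
  also have "\<dots> = euler_op ps (pair_weight c) (shift_sum (pair_weight c) p W) x y"
    using Cons.prems vanish by (intro Cons.IH) auto
  finally show ?case by simp
qed

lemma euler_op_pair_weight:
  assumes "distinct ps" and "\<And>p. p \<in> set ps \<Longrightarrow> c p False False = 1"
  shows "euler_op ps (pair_weight c) W x y = (\<Sum>X1\<in>Pow (set ps). \<Sum>X2\<in>Pow (set ps).
    (\<Prod>p\<in>set ps. c p (p \<in> X1) (p \<in> X2)) * W (x * \<Prod>X1) (y * \<Prod>X2))"
  using assms
proof (induction ps arbitrary: W)
  case (Cons a ps)
  let ?A = "set ps"
  have a: "a \<notin> ?A" "finite ?A" using Cons.prems by auto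
  define g where "g X Y = (\<Prod>p\<in>?A. c p (p \<in> X) (p \<in> Y))" for X Y
  have *: "(\<Prod>p\<in>insert a ?A. c p (p \<in> X) (p \<in> Y)) = c a (a \<in> X) (a \<in> Y) * g X Y" for X Y
    using a by (simp add: g_def)
  have ins: "p \<in> insert a Z \<longleftrightarrow> p \<in> Z" if "p \<in> ?A" for p Z using a that by auto
  have g1: "g (insert a X) Y = g X Y" for X Y
    unfolding g_def by (intro prod.cong refl) (simp only: ins)
  have g2: "g X (insert a Y) = g X Y" for X Y
    unfolding g_def by (intro prod.cong refl) (simp only: ins)
  have "euler_op (a # ps) (pair_weight c) W x y =
      (\<Sum>X1\<in>Pow ?A. \<Sum>X2\<in>Pow ?A. g X1 X2 * shift_sum (pair_weight c) a W (x * \<Prod>X1) (y * \<Prod>X2))"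
    unfolding g_def euler_op.simps using Cons.prems by (intro Cons.IH) auto
  also have "\<dots> = (\<Sum>X1\<in>Pow (insert a ?A). \<Sum>X2\<in>Pow (insert a ?A).
      c a (a \<in> X1) (a \<in> X2) * g X1 X2 * W (x * \<Prod>X1) (y * \<Prod>X2))"
    unfolding sum_Pow_insert[OF a(2,1)] sum.distrib [symmetric]
  proof (intro sum.cong refl)
    fix X Y assume "X \<in> Pow ?A" "Y \<in> Pow ?A"
    hence n: "a \<notin> X" "a \<notin> Y" and f: "finite X" "finite Y" using a by (auto intro: finite_subset)
    have "\<Prod>(insert a X) = a * \<Prod>X" "\<Prod>(insert a Y) = a * \<Prod>Y" using n f by simp_all
    thus "g X Y * shift_sum (pair_weight c) a W (x * \<Prod>X) (y * \<Prod>Y) =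
      c a (a \<in> X) (a \<in> Y) * g X Y * W (x * \<Prod>X) (y * \<Prod>Y) +
      c a (a \<in> X) (a \<in> insert a Y) * g X (insert a Y) * W (x * \<Prod>X) (y * \<Prod>(insert a Y)) +
      (c a (a \<in> insert a X) (a \<in> Y) * g (insert a X) Y * W (x * \<Prod>(insert a X)) (y * \<Prod>Y) +
       c a (a \<in> insert a X) (a \<in> insert a Y) * g (insert a X) (insert a Y) *
         W (x * \<Prod>(insert a X)) (y * \<Prod>(insert a Y)))"
      unfolding g1 g2 shift_sum_def sum_upto2 using n
      by (simp add: pair_weight_def algebra_simps)
  qed
  finally show ?case by (simp only: list.set *)
qed simp

text \<open>The two truncations form an indicator function. As M \<ge> Q, every u \<le> Q is
  composed of the available primes, so \<open>smooth_sum\<close> turns this indicator into the full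
  harmonic sum up to Q / max(x, y).\<close>

lemma main_term_diagonal_eq:
  fixes c :: "nat \<Rightarrow> bool \<Rightarrow> bool \<Rightarrow> real"
  assumes "Q \<ge> 1" "Q \<le> M" and c: "\<And>p. prime p \<Longrightarrow> c p False False = 1"
  defines "ps \<equiv> sorted_list_of_set (primes_upto M)"
  shows "truncated_sum (primes_upto M) Q Q c =
    euler_op ps (diag_weight c) (\<lambda>x y. harm (Q div max x y)) 1 1"
proof -
  have ps: "set ps = primes_upto M" "distinct ps" unfolding ps_def by simp_all
  have pr: "prime p" if "p \<in> set ps" for p using that ps by (simp add: primes_upto_def)
  define W where "W x y = (if x \<le> Q \<and> y \<le> Q then 1 else 0 :: real)" for x y :: nat
  have smooth: "smooth_sum Q (set ps) W x y = harm (Q div max x y)" if "x > 0" "y > 0" for x y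
  proof -
    let ?m = "max x y"
    have m: "?m > 0" using that by simp
    have U: "{u. u \<in> {1..Q} \<and> prime_factors u \<subseteq> set ps} = {1..Q}"
    proof safe
      fix u p assume u: "u \<in> {1..Q}" and p: "p \<in> prime_factors u"
      have "p \<le> u" using u p by (intro dvd_imp_le) auto
      thus "p \<in> set ps" using u p assms(2) by (auto simp: ps primes_upto_def)
    qed
    have le: "x * u \<le> Q \<and> y * u \<le> Q \<longleftrightarrow> u \<le> Q div ?m" for u
    proof -
      have "x * u \<le> Q \<and> y * u \<le> Q \<longleftrightarrow> ?m * u \<le> Q" by (simp add: nat_mult_max_left)
      thus ?thesis using m by (simp add: less_eq_div_iff_mult_less_eq mult.commute)
    qed
    have "smooth_sum Q (set ps) W x y = (\<Sum>u\<in>{1..Q}. if u \<le> Q div ?m then 1 / real u else 0)"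
      unfolding smooth_sum_def U W_def le by (intro sum.cong refl) simp
    also have "\<dots> = (\<Sum>u\<in>{u\<in>{1..Q}. u \<le> Q div ?m}. 1 / real u)"
      by (rule sum.inter_filter [symmetric]) simp
    also have "{u\<in>{1..Q}. u \<le> Q div ?m} = {1..Q div ?m}"
    proof -
      have "u \<le> Q" if "u \<le> Q div ?m" for u
        using that div_le_dividend[of Q ?m] by (rule le_trans)
      thus ?thesis by auto
    qed
    finally show ?thesis by (simp add: harm_def divide_inverse)
  qed
  have "truncated_sum (primes_upto M) Q Q c =
    (\<Sum>X1\<in>Pow (set ps). \<Sum>X2\<in>Pow (set ps).
      (\<Prod>p\<in>set ps. c p (p \<in> X1) (p \<in> X2)) * W (1 * \<Prod>X1) (1 * \<Prod>X2))"
    unfolding ps W_def by (intro sum.cong refl) simp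
  also have "\<dots> = euler_op ps (pair_weight c) W 1 1"
    using ps pr c by (intro euler_op_pair_weight [symmetric]) auto
  also have "\<dots> = euler_op ps (diag_weight c) (smooth_sum Q (set ps) W) 1 1"
    using ps pr assms(1) by (intro euler_op_smooth_sum [symmetric]) (auto simp: W_def)
  also have "\<dots> = euler_op ps (diag_weight c) (\<lambda>x y. harm (Q div max x y)) 1 1"
    using smooth pr by (intro euler_op_cong) (auto simp: prime_gt_0_nat)
  finally show ?thesis .
qed

text \<open>The case m > Q is included: the harmonic sum is then empty and log Q \<le> log
  m.\<close>

lemma abs_harm_div_minus_ln_le:
  assumes "Q \<ge> 1" "m \<ge> 1"
  shows "\<bar>harm (Q div m) - ln (real Q)\<bar> \<le> 1 + ln (real m)"
proof -
  have lnm: "ln (real m) \<ge> 0" and lnQ: "ln (real Q) \<ge> 0" using assms by simp_all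
  have "Q < m * (Q div m + 1)" using assms mod_less_divisor[of m Q] mult_div_mod_eq[of m Q]
    by (simp only: distrib_left mult_1_right) linarith
  hence "real Q \<le> real (m * (Q div m + 1))" by (intro of_nat_mono) simp
  hence "ln (real Q) \<le> ln (real (m * (Q div m + 1)))" using assms by (intro ln_mono) auto
  also have "\<dots> = ln (real m) + ln (real (Q div m) + 1)"
  proof -
    have "real (m * (Q div m + 1)) = real m * (real (Q div m) + 1)"
      by (simp only: of_nat_mult of_nat_add of_nat_1)
    also have "ln \<dots> = ln (real m) + ln (real (Q div m) + 1)" using assms by (intro ln_mult_pos) auto
    finally show ?thesis .
  qed
  also have "\<dots> \<le> ln (real m) + harm (Q div m)" using ln_le_harm[of "Q div m"] by simp
  finally have 1: "ln (real Q) - harm (Q div m) \<le> ln (real m)" by simp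
  have 2: "harm (Q div m) \<le> 1 + ln (real Q)"
  proof -
    have "harm (Q div m) \<le> (harm Q :: real)" by (intro harm_mono div_le_dividend)
    also have "\<dots> \<le> 1 + ln (real Q)" using assms by (intro harm_le_ln) auto
    finally show ?thesis .
  qed
  show ?thesis using 1 2 lnm by (simp add: abs_le_iff)
qed

abbreviation diagonal_factor :: "real \<Rightarrow> (nat \<Rightarrow> bool \<Rightarrow> bool \<Rightarrow> real) \<Rightarrow> nat \<Rightarrow> real" where
  "diagonal_factor s c p \<equiv> (\<Sum>a\<le>2. \<Sum>b\<le>2. \<bar>diag_weight c p a b\<bar> * (real p powr s) ^ (a + b))"

text \<open>Replacing every harmonic sum by log Q leaves the complete product of
  \<open>diag_weight\<close>. The remainder 1 + log max(x, y) is at most x^s y^s / s, and against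
  this majorant the absolute values sum to another Euler product.\<close>

lemma main_term_diagonal_truncation:
  fixes c :: "nat \<Rightarrow> bool \<Rightarrow> bool \<Rightarrow> real"
  assumes Q: "Q \<ge> 1" "Q \<le> M" and c: "\<And>p. prime p \<Longrightarrow> c p False False = 1" and s: "0 < s" "s \<le> 1"
  shows "\<bar>truncated_sum (primes_upto M) Q Q c -
      ln (real Q) * (\<Prod>p\<in>primes_upto M. \<Sum>a\<le>2. \<Sum>b\<le>2. diag_weight c p a b)\<bar>
    \<le> (\<Prod>p\<in>primes_upto M. diagonal_factor s c p) / s"
proof -
  define ps where "ps = sorted_list_of_set (primes_upto M)"
  have ps: "set ps = primes_upto M" "distinct ps" unfolding ps_def by simp_all
  have pos: "p > 0" if "p \<in> set ps" for p
    using that prime_gt_0_nat by (simp add: ps primes_upto_def)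
  let ?D = "diag_weight c"
  let ?W = "\<lambda>x y. harm (Q div max x y) :: real"
  have prod: "prod_list (map F ps) = (\<Prod>p\<in>primes_upto M. F p)" for F :: "nat \<Rightarrow> real"
    using prod.distinct_set_conv_list[OF ps(2), of F] by (simp add: ps(1))
  have one: "euler_op ps ?D (\<lambda>x y. 1) 1 1 = (\<Prod>p\<in>primes_upto M. \<Sum>a\<le>2. \<Sum>b\<le>2. ?D p a b)"
    using euler_op_multiplicative[of "\<lambda>_. 1" ps ?D 1 1 1] by (simp add: prod)
  have "euler_op ps ?D ?W 1 1 - ln (real Q) * euler_op ps ?D (\<lambda>x y. 1) 1 1 =
      euler_op ps ?D (\<lambda>x y. ?W x y - ln (real Q) * 1) 1 1"
    by (rule euler_op_diff [symmetric])
  also have "\<bar>\<dots>\<bar> \<le> euler_op ps (\<lambda>p a b. \<bar>?D p a b\<bar>) (\<lambda>x y. (1 / s) * (real x powr s * real y powr s)) 1 1"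
  proof (rule abs_euler_op_le[OF pos])
    fix x y :: nat assume xy: "x > 0" "y > 0"
    have px: "real x powr s \<ge> 1" "real y powr s \<ge> 1"
      using xy s by (auto intro!: ge_one_powr_ge_zero)
    have "\<bar>?W x y - ln (real Q) * 1\<bar> \<le> 1 + ln (real (max x y))"
      using abs_harm_div_minus_ln_le[OF Q(1), of "max x y"] xy by simp
    also have "\<dots> \<le> real (max x y) powr s / s"
      using xy s by (intro one_plus_ln_le_powr) auto
    also have "real (max x y) powr s \<le> real x powr s * real y powr s"
    proof (cases "x \<le> y")
      case True
      thus ?thesis using mult_right_mono[OF px(1), of "real y powr s"] by (simp add: max_def)
    next
      case False
      thus ?thesis using mult_left_mono[OF px(2), of "real x powr s"] by (simp add: max_def)
    qed
    hence "real (max x y) powr s / s \<le> (1 / s) * (real x powr s * real y powr s)"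
      using s by (simp add: divide_right_mono)
    finally show "\<bar>?W x y - ln (real Q) * 1\<bar> \<le> (1 / s) * (real x powr s * real y powr s)" .
  qed auto
  also have "\<dots> = (\<Prod>p\<in>primes_upto M. \<Sum>a\<le>2. \<Sum>b\<le>2. \<bar>?D p a b\<bar> * (real p powr s) ^ (a + b)) / s"
    using euler_op_multiplicative[of "\<lambda>x. real x powr s" ps "\<lambda>p a b. \<bar>?D p a b\<bar>" "1 / s" 1 1]
    by (simp add: powr_mult prod)
  finally show ?thesis
    using main_term_diagonal_eq[where c = c, OF Q c] one unfolding ps_def by simp
qed

lemma diag_weight_eq:
  assumes "c p False False = 1"
  shows "diag_weight c p 0 0 = 1" "diag_weight c p 0 1 = c p False True"
    "diag_weight c p 0 2 = 0" "diag_weight c p 1 0 = c p True False"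
    "diag_weight c p 1 1 = c p True True - 1 / real p" "diag_weight c p 1 2 = - c p False True / real p"
    "diag_weight c p 2 0 = 0" "diag_weight c p 2 1 = - c p True False / real p"
    "diag_weight c p 2 2 = - c p True True / real p"
  using assms by (simp_all add: diag_weight_def pair_weight_def)

section \<open>Local factors on the diagonal\<close>

context
  fixes p :: nat and v :: real and h :: int
  assumes p: "prime p"
  defines "v \<equiv> 1 / (real p - 1)"
begin

text \<open>For p not dividing \<open>h\<close> the coefficient of XY is 1/p + O(1/p^2): this is the
  source of the logarithmic divergence.\<close>

lemma local_weight_diag:
  "local_weight h h p True False = (if int p dvd h then v else - v\<^sup>2)"
  "local_weight h h p False True = (if int p dvd h then v else - v\<^sup>2)"
  "local_weight h h p True True = (if int p dvd h then v\<^sup>2 else v + v\<^sup>2 - v ^ 3)"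
proof -
  note v = prime_recip_facts[OF p, folded v_def]
  have z: "v\<^sup>2 * (a + real p * (1 + v)) = v\<^sup>2 * a + v * (1 + v) * (1 + v)" for a
    unfolding v(4) [symmetric] by (simp add: algebra_simps power2_eq_square)
  show "local_weight h h p True False = (if int p dvd h then v else - v\<^sup>2)"
    "local_weight h h p False True = (if int p dvd h then v else - v\<^sup>2)"
    unfolding local_weight_eq[OF p, folded v_def] by simp_all
  show "local_weight h h p True True = (if int p dvd h then v\<^sup>2 else v + v\<^sup>2 - v ^ 3)"
    unfolding local_weight_eq[OF p, folded v_def]
    by (auto simp: z) (simp add: power2_eq_square power3_eq_cube algebra_simps)
qed

text \<open>At X = Y = 1 the inserted factor 1 - 1/p cancels the 1 + v in the sum of the local
  weights. By \<open>singular_factor_2\<close>, what remains is the factor of the singular series of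
  a pair.\<close>

lemma sum_diag_weight_local:
  "(\<Sum>a\<le>2. \<Sum>b\<le>2. diag_weight (local_weight h h) p a b) = 1 + local_weight h h p True False"
proof -
  note v = prime_recip_facts[OF p, folded v_def]
  have "(\<Sum>a\<le>2. \<Sum>b\<le>2. diag_weight (local_weight h h) p a b) =
      sum4 (local_weight h h p) * (1 - 1 / real p)"
    unfolding sum_upto2 diag_weight_eq[of "local_weight h h", OF local_weight_eq(1)[OF p]] sum4_def
      local_weight_eq(1)[OF p]
    by (simp add: algebra_simps)
  also have "sum4 (local_weight h h p) = (1 + v) * (1 + local_weight h h p True False)"
    unfolding sum4_def local_weight_eq(1)[OF p] local_weight_diag
    by (auto simp: power2_eq_square power3_eq_cube algebra_simps)
  also have "(1 + v) * (1 + local_weight h h p True False) * (1 - 1 / real p) =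
      1 + local_weight h h p True False"
    using v(7) by (simp add: mult_ac)
  finally show ?thesis .
qed

text \<open>As a + b \<le> 4, the Rankin weights are at most p^(4s). For p not dividing
  \<open>h\<close>, all coefficients have order p^(-2) once 1/p is removed, and s \<le> 1/8 keeps
  p^(4s - 2) below p^(-3/2); for p | h only the order 1/p is available.\<close>

lemma abs_diag_weight_sum_le:
  assumes s: "s > 0" "s \<le> 1/8"
  defines "G \<equiv> diagonal_factor s (local_weight h h) p"
  shows "\<not> int p dvd h \<Longrightarrow> G \<le> 1 + 24 * real p powr (-3/2)"
    and "int p dvd h \<Longrightarrow> G \<le> 1 + 10 * real p powr (4 * s - 1)"
proof -
  note v = prime_recip_facts[OF p, folded v_def]
  have P: "real p \<ge> 2" using prime_ge_2_nat[OF p] by simp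
  define w where "w = real p powr s"
  have w: "w \<ge> 1" unfolding w_def using P s by (intro ge_one_powr_ge_zero) auto
  define f B where "f = local_weight h h p True False" and "B = local_weight h h p True True"
  have fT: "local_weight h h p False True = f" by (simp add: f_def local_weight_diag)
  have wk: "w ^ k \<le> w ^ 4" if "k \<le> 4" for k using that w by (intro power_increasing) auto
  have w4: "w ^ 4 = real p powr (4 * s)"
    using P by (simp add: w_def powr_powr mult.commute flip: powr_realpow)
  have "G = 1 + \<bar>f\<bar> * w ^ 1 + \<bar>f\<bar> * w ^ 1 + \<bar>B - 1 / real p\<bar> * w ^ 2 + \<bar>f / real p\<bar> * w ^ 3 +
      \<bar>f / real p\<bar> * w ^ 3 + \<bar>B / real p\<bar> * w ^ 4"
    unfolding G_def sum_upto2 diag_weight_eq[of "local_weight h h", OF local_weight_eq(1)[OF p]]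
      fT f_def [symmetric] B_def [symmetric] w_def [symmetric]
    by (simp add: power3_eq_cube eval_nat_numeral)
  also have "\<dots> \<le> 1 + \<bar>f\<bar> * w ^ 4 + \<bar>f\<bar> * w ^ 4 + \<bar>B - 1 / real p\<bar> * w ^ 4 + \<bar>f / real p\<bar> * w ^ 4 +
      \<bar>f / real p\<bar> * w ^ 4 + \<bar>B / real p\<bar> * w ^ 4"
    by (intro add_mono mult_left_mono wk order_refl) auto
  also have "\<dots> = 1 + (2 * \<bar>f\<bar> + \<bar>B - 1 / real p\<bar> + 2 * (\<bar>f\<bar> / real p) + \<bar>B\<bar> / real p) * w ^ 4"
    by (simp add: algebra_simps)
  finally have G: "G \<le> 1 + (2 * \<bar>f\<bar> + \<bar>B - 1 / real p\<bar> + 2 * (\<bar>f\<bar> / real p) + \<bar>B\<bar> / real p) * w ^ 4" .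
  have v2: "v\<^sup>2 \<le> v" using v(1,2) by (simp add: power2_eq_square mult_left_le)
  have v2': "0 < v\<^sup>2" using v(1) by simp
  {
    assume nd: "\<not> int p dvd h"
    have f: "\<bar>f\<bar> \<le> 4 / (real p)\<^sup>2" using nd v(5) by (simp add: f_def local_weight_diag)
    have f': "\<bar>f\<bar> / real p \<le> 2 / (real p)\<^sup>2"
    proof -
      have "\<bar>f\<bar> / real p \<le> (4 / (real p)\<^sup>2) / 2" using f P by (intro frac_le) auto
      thus ?thesis by simp
    qed
    have B: "B = v + v\<^sup>2 - v ^ 3" using nd by (simp add: B_def local_weight_diag)
    have "v ^ 3 \<le> v\<^sup>2" using v(1,2) by (intro power_decreasing) auto
    moreover have "0 \<le> v ^ 3" using v(1) by simp
    ultimately have B0: "0 \<le> B" "B \<le> 2 * v" using v(1) v2 unfolding B by linarith+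
    have "B / real p \<le> (2 * (2 / real p)) / real p" using B0 v(3) by (intro divide_right_mono) auto
    hence B': "\<bar>B\<bar> / real p \<le> 4 / (real p)\<^sup>2" using B0 by (simp add: power2_eq_square)
    \<comment> \<open>Here the first-order terms cancel, by the expression of 1/p through
      \<open>v\<close>.\<close>
    have "B - 1 / real p = (2 * v\<^sup>2 - v ^ 4) / (1 + v)"
      unfolding B v(6) using v(1) by (simp add: field_simps power2_eq_square power3_eq_cube power4_eq_xxxx)
    moreover have "v ^ 4 \<le> v\<^sup>2" "0 \<le> v ^ 4" using v(1,2) by (auto intro: power_decreasing)
    hence "0 \<le> 2 * v\<^sup>2 - v ^ 4" "2 * v\<^sup>2 - v ^ 4 \<le> 2 * v\<^sup>2" using v2' by linarith+
    moreover have "(2 * v\<^sup>2 - v ^ 4) / (1 + v) \<le> 2 * v\<^sup>2 / 1"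
      using calculation v(1) by (intro frac_le) auto
    ultimately have B1: "\<bar>B - 1 / real p\<bar> \<le> 8 / (real p)\<^sup>2" using v(1,5) by simp
    have "G \<le> 1 + (2 * (4 / (real p)\<^sup>2) + 8 / (real p)\<^sup>2 + 2 * (2 / (real p)\<^sup>2) + 4 / (real p)\<^sup>2) * w ^ 4"
      using w by (intro order_trans[OF G] add_left_mono mult_right_mono add_mono mult_left_mono f f' B' B1) auto
    also have "2 * (4 / (real p)\<^sup>2) + 8 / (real p)\<^sup>2 + 2 * (2 / (real p)\<^sup>2) + 4 / (real p)\<^sup>2 = 24 * real p powr (-2)"
      using P by (simp add: powr_minus divide_inverse)
    also have "24 * real p powr (-2) * w ^ 4 = 24 * real p powr (4 * s - 2)"
      unfolding w4 by (simp add: mult.assoc flip: powr_add)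
    also have "\<dots> \<le> 24 * real p powr (-3/2)"
      using s P by (intro mult_left_mono powr_mono) auto
    finally show "G \<le> 1 + 24 * real p powr (-3/2)" by simp
  }
  {
    assume d: "int p dvd h"
    have f: "\<bar>f\<bar> \<le> 2 / real p" using d v(1,3) by (simp add: f_def local_weight_diag)
    have B: "B = v\<^sup>2" using d by (simp add: B_def local_weight_diag)
    have f': "\<bar>f\<bar> / real p \<le> 1 / real p"
      using d v(1,2) P by (intro divide_right_mono) (auto simp: f_def local_weight_diag)
    have B': "\<bar>B\<bar> / real p \<le> 1 / real p" unfolding B
      using v2 v(2) v2' P by (intro divide_right_mono) auto
    have B1: "\<bar>B - 1 / real p\<bar> \<le> 3 / real p"
    proof -
      have "\<bar>B\<bar> \<le> 2 / real p" unfolding B using v2 v(3) v2' by simp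
      moreover have "\<bar>B - 1 / real p\<bar> \<le> \<bar>B\<bar> + 1 / real p"
        using abs_triangle_ineq4[of B "1 / real p"] by simp
      moreover have "2 / real p + 1 / real p = 3 / real p" by (simp flip: add_divide_distrib)
      ultimately show ?thesis by linarith
    qed
    have "G \<le> 1 + (2 * (2 / real p) + 3 / real p + 2 * (1 / real p) + 1 / real p) * w ^ 4"
      using w by (intro order_trans[OF G] add_left_mono mult_right_mono add_mono mult_left_mono f f' B' B1) auto
    also have "2 * (2 / real p) + 3 / real p + 2 * (1 / real p) + 1 / real p = 10 * real p powr (-1)"
      using P by (simp add: powr_minus divide_inverse)
    also have "10 * real p powr (-1) * w ^ 4 = 10 * real p powr (4 * s - 1)"
      unfolding w4 using P by (simp add: powr_diff powr_minus divide_inverse)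
    finally show "G \<le> 1 + 10 * real p powr (4 * s - 1)" by simp
  }
qed

end

abbreviation diagonal_error :: "int \<Rightarrow> real \<Rightarrow> real" where
  "diagonal_error h s \<equiv>
     exp (24 * zeta32 + 10 * (\<Sum>p\<in>prime_factors (nat \<bar>h\<bar>). real p powr (4 * s - 1))) / s"

lemma main_term_diagonal:
  fixes j :: "nat \<Rightarrow> int"
  assumes "j 1 \<noteq> j 2" "Q \<ge> 1" and s: "0 < s" "s \<le> 1/8"
  defines "h \<equiv> j 1 - j 2"
  shows "\<bar>main_term Q Q h h - ln (real Q) * singular_series 2 j\<bar> \<le>
    diagonal_error h s"
    (is "_ \<le> ?B")
proof -
  have h: "h \<noteq> 0" using assms(1) by (simp add: h_def)
  let ?f = "\<lambda>p. 1 + local_weight h h p True False"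
  have pr: "prime p" if "p \<in> primes_upto M" for p M using that by (simp add: primes_upto_def)
  have eq: "singular_series 2 j = prodinf (\<lambda>p. if prime p then ?f p else 1)"
    unfolding singular_series_def h_def
    by (intro prodinf_cong if_cong refl singular_factor_2)
  have lim: "(\<lambda>M. \<Prod>p\<in>primes_upto M. ?f p) \<longlonglongrightarrow> singular_series 2 j"
    unfolding eq
  proof (rule tendsto_prod_primes[OF h])
    fix p assume p: "prime p" and nd: "\<not> int p dvd h"
    have "\<bar>?f p - 1\<bar> \<le> 4 / (real p)\<^sup>2"
      using nd prime_recip_facts(5)[OF p] by (simp add: local_weight_diag[OF p])
    also have "\<dots> \<le> 4 * real p powr (-3/2)" using p by (intro powr_neg2_le) auto
    finally show "\<bar>?f p - 1\<bar> \<le> 4 * real p powr (-3/2)" .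
  qed simp
  \<comment> \<open>The bound is independent of M, so the finite product may be replaced by its
    limit.\<close>
  have "\<forall>M\<ge>Q. \<bar>main_term Q Q h h - ln (real Q) * (\<Prod>p\<in>primes_upto M. ?f p)\<bar> \<le> ?B"
  proof (intro allI impI)
    fix M assume M: "M \<ge> Q"
    have T: "main_term Q Q h h = truncated_sum (primes_upto M) Q Q (local_weight h h)"
      using M by (intro main_term_eq_sum_Pow) (auto simp: primes_upto_def)
    have F: "(\<Prod>p\<in>primes_upto M. ?f p) =
        (\<Prod>p\<in>primes_upto M. \<Sum>a\<le>2. \<Sum>b\<le>2. diag_weight (local_weight h h) p a b)"
      by (intro prod.cong refl sum_diag_weight_local [symmetric] pr)
    have "\<bar>main_term Q Q h h - ln (real Q) * (\<Prod>p\<in>primes_upto M. ?f p)\<bar> \<le>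
        (\<Prod>p\<in>primes_upto M. diagonal_factor s (local_weight h h) p) / s"
      unfolding T F using s by (intro main_term_diagonal_truncation assms(2) M local_weight_eq(1)) auto
    also have "\<dots> \<le> exp (24 * zeta32 + (\<Sum>p\<in>primes_upto M \<inter> {p. int p dvd h}. 10 * real p powr (4 * s - 1))) / s"
    proof (rule divide_right_mono, rule euler_product_le)
      fix p assume p: "p \<in> primes_upto M"
      show "p \<notin> {p. int p dvd h} \<Longrightarrow> diagonal_factor s (local_weight h h) p \<le> 1 + 24 * real p powr (-3/2)"
        using abs_diag_weight_sum_le(1)[OF pr[OF p] s] by simp
      show "p \<in> {p. int p dvd h} \<Longrightarrow> diagonal_factor s (local_weight h h) p \<le> 1 + 10 * real p powr (4 * s - 1)"
        using abs_diag_weight_sum_le(2)[OF pr[OF p] s] by simp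
    qed (use s in \<open>auto intro!: sum_nonneg\<close>)
    also have "\<dots> \<le> ?B"
    proof -
      have "primes_upto M \<inter> {p. int p dvd h} \<subseteq> prime_factors (nat \<bar>h\<bar>)"
      proof
        fix p assume "p \<in> primes_upto M \<inter> {p. int p dvd h}"
        hence p: "prime p" "int p dvd \<bar>h\<bar>" using pr by auto
        hence "p dvd nat \<bar>h\<bar>" by (simp only: int_dvd_int_iff [symmetric] int_nat_eq abs_ge_zero if_True)
        thus "p \<in> prime_factors (nat \<bar>h\<bar>)" using h p by (simp add: prime_factors_dvd)
      qed
      hence "(\<Sum>p\<in>primes_upto M \<inter> {p. int p dvd h}. 10 * real p powr (4 * s - 1)) \<le>
          (\<Sum>p\<in>prime_factors (nat \<bar>h\<bar>). 10 * real p powr (4 * s - 1))"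
        by (intro sum_mono2) auto
      thus ?thesis using s by (simp add: divide_right_mono sum_distrib_left)
    qed
    finally show "\<bar>main_term Q Q h h - ln (real Q) * (\<Prod>p\<in>primes_upto M. ?f p)\<bar> \<le> ?B" .
  qed
  moreover have "(\<lambda>M. \<bar>main_term Q Q h h - ln (real Q) * (\<Prod>p\<in>primes_upto M. ?f p)\<bar>) \<longlonglongrightarrow>
      \<bar>main_term Q Q h h - ln (real Q) * singular_series 2 j\<bar>"
    by (intro tendsto_intros lim)
  ultimately show ?thesis by (intro LIMSEQ_le_const2) blast+
qed

text \<open>The exponent 1/log y is chosen because y^(1/log y) = e. Primes up to y cost only a
  factor e over 1/p, and each of the at most 2 log n larger prime factors contributes at most
  e/y.\<close>

lemma sum_prime_factors_powr_le:
  assumes "n > 0" "y \<ge> 3"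
  shows "(\<Sum>p\<in>prime_factors n. real p powr (1 / ln (real y) - 1)) \<le>
    exp 1 * (sqrt (2 + 4 * ln (real y)) + 2 * ln (real n) / real y)"
proof -
  let ?A = "prime_factors n"
  let ?t = "1 / ln (real y)"
  \<comment> \<open>From y \<ge> 3 > e it follows that 1/log y - 1 is not positive, so the power
    decreases beyond y.\<close>
  have "ln (exp 1) \<le> ln (real y)" using assms(2) exp_le by (intro ln_mono) auto
  hence ly: "ln (real y) \<ge> 1" by simp
  have yt: "real y powr ?t = exp 1" using ly assms by (simp add: powr_def)
  have t1: "?t \<le> 1" using ly by simp
  have "(\<Sum>p\<in>?A. real p powr (?t - 1)) \<le> (\<Sum>p\<in>?A. exp 1 * (if p \<le> y then 1 / real p else 1 / real y))"
  proof (rule sum_mono)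
    fix p assume "p \<in> ?A"
    hence "prime p" by auto
    hence p: "p > 0" by (rule prime_gt_0_nat)
    show "real p powr (?t - 1) \<le> exp 1 * (if p \<le> y then 1 / real p else 1 / real y)"
    proof (cases "p \<le> y")
      case True
      have "real p powr (?t - 1) = real p powr ?t * (1 / real p)"
        using p by (simp add: powr_diff)
      also have "\<dots> \<le> real y powr ?t * (1 / real p)"
        using True p ly by (intro mult_right_mono powr_mono2) auto
      finally show ?thesis using True by (simp add: yt)
    next
      case False
      have "real p powr (?t - 1) \<le> real y powr (?t - 1)"
        using False p assms t1 by (intro powr_mono2') auto
      also have "\<dots> = real y powr ?t * (1 / real y)" using assms by (simp add: powr_diff)
      finally show ?thesis using False by (simp add: yt)
    qed
  qed
  also have "\<dots> = exp 1 * ((\<Sum>p\<in>?A \<inter> {p. p \<le> y}. 1 / real p) + (\<Sum>p\<in>?A \<inter> - {p. p \<le> y}. 1 / real y))"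
    by (simp add: sum_distrib_left [symmetric] sum.If_cases)
  also have "\<dots> \<le> exp 1 * (sqrt (2 + 4 * ln (real y)) + 2 * ln (real n) / real y)"
  proof (intro mult_left_mono add_mono)
    have "(\<Sum>p\<in>?A \<inter> {p. p \<le> y}. 1 / real p) \<le> (\<Sum>p | prime p \<and> p \<le> y. 1 / real p)"
      by (intro sum_mono2) (auto intro: finite_subset[of _ "{..y}"])
    also have "\<dots> = sqrt ((\<Sum>p | prime p \<and> p \<le> y. 1 / real p)\<^sup>2)"
      by (simp add: sum_nonneg)
    also have "\<dots> \<le> sqrt (2 * harm (y\<^sup>2))"
      by (intro real_sqrt_le_mono sum_prime_reciprocals_le)
    also have "\<dots> \<le> sqrt (2 + 4 * ln (real y))"
    proof (rule real_sqrt_le_mono)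
      have "harm (y\<^sup>2) \<le> 1 + ln (real (y\<^sup>2))" using assms by (intro harm_le_ln) auto
      also have "ln (real (y\<^sup>2)) = 2 * ln (real y)" using assms by (simp add: ln_realpow)
      finally show "2 * harm (y\<^sup>2) \<le> 2 + 4 * ln (real y)" by simp
    qed
    finally show "(\<Sum>p\<in>?A \<inter> {p. p \<le> y}. 1 / real p) \<le> sqrt (2 + 4 * ln (real y))" .
    have "card (?A \<inter> - {p. p \<le> y}) \<le> card ?A" by (intro card_mono) auto
    hence "real (card (?A \<inter> - {p. p \<le> y})) \<le> real (card ?A)" by (rule of_nat_mono)
    also have "\<dots> \<le> 2 * ln (real n)" by (rule card_prime_factors_le_ln[OF assms(1)])
    finally show "(\<Sum>p\<in>?A \<inter> - {p. p \<le> y}. 1 / real y) \<le> 2 * ln (real n) / real y"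
      by (simp add: divide_right_mono)
  qed simp
  finally show ?thesis .
qed

section \<open>Boundary terms and uniform error bounds\<close>

text \<open>The argument 0 needs its own factor \<open>Q\<close>: every modulus divides 0, so the
  divisor bound says nothing there.\<close>

lemma abs_lam_le_uniform:
  assumes C: "C \<ge> 1" "\<And>n. n > 0 \<Longrightarrow> real (divisor_count n) \<le> C * real n powr \<delta>" and "\<delta> > 0"
    and Q: "Q \<ge> 1" "Q \<le> N" and n: "\<bar>n\<bar> \<le> 4 * int N"
  shows "\<bar>lam Q n\<bar> \<le> C * (4 * real N) powr \<delta> * (1 + ln (real N)) ^ 3 * (if n = 0 then real Q else 1)"
proof -
  have N: "real N \<ge> 1" using Q by simp
  have "harm Q \<le> (harm N :: real)" using Q by (intro harm_mono)
  also have "\<dots> \<le> 1 + ln (real N)" using Q by (intro harm_le_ln) auto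
  finally have H: "harm Q ^ 3 \<le> (1 + ln (real N)) ^ 3" by (intro power_mono) (auto simp: harm_nonneg)
  have H0: "(0::real) \<le> harm Q ^ 3" by (simp add: harm_nonneg)
  have one: "1 \<le> C * (4 * real N) powr \<delta>"
  proof -
    have "1 * 1 \<le> C * (4 * real N) powr \<delta>"
      using C(1) N assms(3) by (intro mult_mono ge_one_powr_ge_zero) auto
    thus ?thesis by simp
  qed
  show ?thesis
  proof (cases "n = 0")
    case True
    have "\<bar>lam Q n\<bar> \<le> 1 * harm Q ^ 3 * real Q" using abs_lam_le[of Q n] by (simp add: mult.commute)
    also have "\<dots> \<le> C * (4 * real N) powr \<delta> * (1 + ln (real N)) ^ 3 * real Q"
      using one H H0 by (intro mult_right_mono mult_mono) auto
    finally show ?thesis using True by simp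
  next
    case False
    have "\<bar>lam Q n\<bar> \<le> real (divisor_count (nat \<bar>n\<bar>)) * harm Q ^ 3"
      using False by (rule abs_lam_le_divisor_count)
    also have "\<dots> \<le> C * (4 * real N) powr \<delta> * (1 + ln (real N)) ^ 3"
    proof (rule mult_mono)
      have "real (divisor_count (nat \<bar>n\<bar>)) \<le> C * real (nat \<bar>n\<bar>) powr \<delta>"
        using False by (intro C(2)) simp
      also have "\<dots> \<le> C * (4 * real N) powr \<delta>"
        using n C(1) assms(3) by (intro mult_left_mono powr_mono2) auto
      finally show "real (divisor_count (nat \<bar>n\<bar>)) \<le> C * (4 * real N) powr \<delta>" .
    qed (use H H0 one in auto)
    finally show ?thesis using False by simp
  qed
qed

text \<open>After m = n + t the sum runs over t + 1..t + N instead of 1..N, and \<open>F\<close> may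
  be cut off where an argument of lambda is not positive. Both deviations are confined to O(J)
  values of m, where trivial bounds suffice.\<close>

lemma boundary_terms_le:
  fixes F :: "int \<Rightarrow> real" and J t h1 h2 :: int
  assumes C: "C \<ge> 1" "\<And>n. n > 0 \<Longrightarrow> real (divisor_count n) \<le> C * real n powr \<delta>" and d: "\<delta> > 0"
    and Q: "Q1 \<ge> 1" "Q2 \<ge> 1" "Q1 * Q2 \<le> N"
    and J: "\<bar>t\<bar> \<le> J" "\<bar>h1\<bar> \<le> 2 * J" "\<bar>h2\<bar> \<le> 2 * J" "2 * J \<le> int N"
    and F1: "\<And>m. m > 0 \<Longrightarrow> \<bar>F m\<bar> \<le> \<bar>lam Q1 (m + h1) * lam Q2 (m + h2)\<bar>"
    and F2: "\<And>m. m + h1 > 0 \<Longrightarrow> m + h2 > 0 \<Longrightarrow> F m = lam Q1 (m + h1) * lam Q2 (m + h2)"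
  shows "\<bar>(\<Sum>n=1..N. F (int n + t) * Lambda (int n + t)) - corr Q1 Q2 h1 h2 N\<bar> \<le>
    2 * (ln (2 * real N) * (C * (4 * real N) powr \<delta> * (1 + ln (real N)) ^ 3)\<^sup>2 *
      (4 * real_of_int J + 2 * real (Q1 * Q2)))"
proof -
  define T where "T m = F m * Lambda m" for m
  define U where "U m = Lambda m * lam Q1 (m + h1) * lam Q2 (m + h2)" for m
  define D where "D = C * (4 * real N) powr \<delta> * (1 + ln (real N)) ^ 3"
  let ?A = "{t + 1..t + int N}" and ?B = "{1..int N}"
  \<comment> \<open>Up to 2J a cutoff may act or the lower ends may differ; around N the upper ends
    may differ.\<close>
  let ?Z = "{1..2 * J} \<union> {int N - J + 1..int N + J}"
  let ?W = "?A \<union> ?B \<union> ?Z"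
  have "Q1 * 1 \<le> Q1 * Q2" "1 * Q2 \<le> Q1 * Q2" using Q by (intro mult_le_mono; simp)+
  hence QN: "Q1 \<le> N" "Q2 \<le> N" using Q by linarith+
  have N: "N \<ge> 1" using QN Q by simp
  have J0: "J \<ge> 0" using J(1) by linarith
  have D0: "D \<ge> 0" unfolding D_def using C(1) N by (intro mult_nonneg_nonneg) auto
  have "(\<Sum>n=1..N. F (int n + t) * Lambda (int n + t)) = (\<Sum>m\<in>?A. T m)"
    by (rule sum.reindex_bij_witness[of _ "\<lambda>m. nat (m - t)" "\<lambda>n. int n + t"]) (auto simp: T_def)
  also have "\<dots> = (\<Sum>m\<in>?W. if m \<in> ?A then T m else 0)"
    by (intro sum.mono_neutral_cong_left) auto
  finally have s1: "(\<Sum>n=1..N. F (int n + t) * Lambda (int n + t)) = (\<Sum>m\<in>?W. if m \<in> ?A then T m else 0)" .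
  have "corr Q1 Q2 h1 h2 N = (\<Sum>m\<in>?B. U m)"
    unfolding corr_def
    by (rule sum.reindex_bij_witness[of _ nat int]) (auto simp: U_def Lambda_def)
  also have "\<dots> = (\<Sum>m\<in>?W. if m \<in> ?B then U m else 0)"
    by (intro sum.mono_neutral_cong_left) auto
  finally have s2: "corr Q1 Q2 h1 h2 N = (\<Sum>m\<in>?W. if m \<in> ?B then U m else 0)" .
  have two: "\<bar>(if P then x else 0) - (if P' then y else 0)\<bar> \<le> 2 * \<bar>y\<bar>"
    if "\<bar>x\<bar> \<le> \<bar>y\<bar>" for P P' and x y :: real
    using that by (cases P; cases P'; simp only: if_True if_False; linarith)
  have "\<bar>(\<Sum>n=1..N. F (int n + t) * Lambda (int n + t)) - corr Q1 Q2 h1 h2 N\<bar> \<le>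
      (\<Sum>m\<in>?W. \<bar>(if m \<in> ?A then T m else 0) - (if m \<in> ?B then U m else 0)\<bar>)"
    unfolding s1 s2 sum_subtractf [symmetric] by (rule sum_abs)
  also have "\<dots> \<le> (\<Sum>m\<in>?W. if m \<in> ?Z then 2 * \<bar>U m\<bar> else 0)"
  proof (rule sum_mono)
    fix m
    consider "m \<le> 0" | "m > 0" "m \<in> ?Z" | "m > 0" "m \<notin> ?Z" by linarith
    thus "\<bar>(if m \<in> ?A then T m else 0) - (if m \<in> ?B then U m else 0)\<bar> \<le>
        (if m \<in> ?Z then 2 * \<bar>U m\<bar> else 0)"
    proof cases
      case 1
      hence "T m = 0" "U m = 0" by (simp_all add: T_def U_def Lambda_def)
      thus ?thesis by simp
    next
      case 2
      have "\<bar>T m\<bar> \<le> \<bar>U m\<bar>"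
        using mult_right_mono[OF F1[OF 2(1)], of "\<bar>Lambda m\<bar>"]
        by (simp add: T_def U_def abs_mult mult_ac)
      hence "\<bar>(if m \<in> ?A then T m else 0) - (if m \<in> ?B then U m else 0)\<bar> \<le> 2 * \<bar>U m\<bar>"
        by (rule two)
      thus ?thesis using 2(2) by (simp only: if_True)
    next
      case 3
      have "m > 2 * J" using 3 by auto
      hence "m + h1 > 0" "m + h2 > 0" using J by linarith+
      hence "T m = U m" unfolding T_def U_def using F2[of m] by simp
      moreover have "m \<in> ?A \<longleftrightarrow> m \<in> ?B"
        using 3 \<open>m > 2 * J\<close> J J0 by auto
      ultimately show ?thesis using 3(2) by simp
    qed
  qed
  also have "\<dots> = (\<Sum>m\<in>?Z. 2 * \<bar>U m\<bar>)"
    by (intro sum.mono_neutral_cong_right) auto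
  also have "\<dots> \<le> (\<Sum>m\<in>?Z. 2 * (ln (2 * real N) * D\<^sup>2 * (1 +
      ((if m = - h1 then real (Q1 * Q2) else 0) + (if m = - h2 then real (Q1 * Q2) else 0)))))"
  proof (rule sum_mono)
    fix m assume m: "m \<in> ?Z"
    have m0: "m > 0" "m \<le> 2 * int N" using m J J0 by auto
    have "Lambda m = mangoldt (nat m)" using m0 by (simp add: Lambda_def)
    also have "\<dots> \<le> ln (real (nat m))" using m0 by (intro mangoldt_le) auto
    also have "\<dots> \<le> ln (2 * real N)" using m0 by (intro ln_mono) auto
    finally have L: "\<bar>Lambda m\<bar> \<le> ln (2 * real N)"
      using mangoldt_nonneg[of "nat m"] m0 by (simp add: Lambda_def)
    have l1: "\<bar>lam Q1 (m + h1)\<bar> \<le> D * (if m + h1 = 0 then real Q1 else 1)"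
      unfolding D_def using m0 J by (intro abs_lam_le_uniform C d Q QN) auto
    have l2: "\<bar>lam Q2 (m + h2)\<bar> \<le> D * (if m + h2 = 0 then real Q2 else 1)"
      unfolding D_def using m0 J by (intro abs_lam_le_uniform C d Q QN) auto
    have lnN: "ln (2 * real N) \<ge> 0" using N by simp
    have "\<bar>U m\<bar> = \<bar>Lambda m\<bar> * (\<bar>lam Q1 (m + h1)\<bar> * \<bar>lam Q2 (m + h2)\<bar>)"
      by (simp add: U_def abs_mult)
    also have "\<dots> \<le> ln (2 * real N) * ((D * (if m + h1 = 0 then real Q1 else 1)) *
        (D * (if m + h2 = 0 then real Q2 else 1)))"
      using D0 lnN by (intro mult_mono L l1 l2) auto
    also have "\<dots> = ln (2 * real N) * D\<^sup>2 *
        ((if m + h1 = 0 then real Q1 else 1) * (if m + h2 = 0 then real Q2 else 1))"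
      by (simp only: power2_eq_square mult_ac)
    also have "\<dots> \<le> ln (2 * real N) * D\<^sup>2 * (1 +
        ((if m = - h1 then real (Q1 * Q2) else 0) + (if m = - h2 then real (Q1 * Q2) else 0)))"
    proof (rule mult_left_mono)
      \<comment> \<open>At m = -h1 or m = -h2 an argument of lambda is 0. If h1 = h2 both are, hence
        the allowance Q1 Q2.\<close>
      have "real Q1 * 1 \<le> real Q1 * real Q2" "1 * real Q2 \<le> real Q1 * real Q2"
        using Q by (intro mult_mono; simp)+
      moreover have "m + h1 = 0 \<longleftrightarrow> m = - h1" "m + h2 = 0 \<longleftrightarrow> m = - h2" by linarith+
      ultimately show "(if m + h1 = 0 then real Q1 else 1) * (if m + h2 = 0 then real Q2 else 1) \<le> 1 +
        ((if m = - h1 then real (Q1 * Q2) else 0) + (if m = - h2 then real (Q1 * Q2) else 0))"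
        by (cases "m = - h1"; cases "m = - h2"; simp)
    qed (use lnN in simp)
    finally show "2 * \<bar>U m\<bar> \<le> 2 * (ln (2 * real N) * D\<^sup>2 * (1 +
        ((if m = - h1 then real (Q1 * Q2) else 0) + (if m = - h2 then real (Q1 * Q2) else 0))))" by simp
  qed
  also have "\<dots> = 2 * (ln (2 * real N) * D\<^sup>2 * (real (card ?Z) +
      ((\<Sum>m\<in>?Z. if m = - h1 then real (Q1 * Q2) else 0) +
       (\<Sum>m\<in>?Z. if m = - h2 then real (Q1 * Q2) else 0))))"
    unfolding sum_distrib_left [symmetric] sum.distrib by simp
  also have "\<dots> \<le> 2 * (ln (2 * real N) * D\<^sup>2 * (4 * real_of_int J + (real (Q1 * Q2) + real (Q1 * Q2))))"
  proof (intro mult_left_mono add_mono)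
    have "card ?Z \<le> card {1..2 * J} + card {int N - J + 1..int N + J}" by (rule card_Un_le)
    also have "\<dots> = nat (2 * J) + nat (2 * J)" by simp
    finally have "int (card ?Z) \<le> 4 * J" using J0 by linarith
    hence "real_of_int (int (card ?Z)) \<le> real_of_int (4 * J)" by (simp only: of_int_le_iff)
    thus "real (card ?Z) \<le> 4 * real_of_int J" by simp
    have "finite ?Z" by simp
    thus "(\<Sum>m\<in>?Z. if m = - h1 then real (Q1 * Q2) else 0) \<le> real (Q1 * Q2)"
      "(\<Sum>m\<in>?Z. if m = - h2 then real (Q1 * Q2) else 0) \<le> real (Q1 * Q2)"
      by (simp_all only: sum.delta) auto
  qed (use N in auto)
  finally show ?thesis by (simp add: D_def)
qed

text \<open>Leaving \<open>F\<close> general lets one statement serve a product of two lambdas, a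
  square, and a single lambda paired with the constant \<open>lam 1\<close>.\<close>

lemma pair_correlation:
  assumes "EH \<theta>" "\<theta> \<le> 1" "\<epsilon> > 0" "D > 0" "\<delta> > 0"
  shows "\<forall>\<^sub>F N in sequentially. \<forall>Q1 Q2 t h1 h2 J F. 1 \<le> Q1 \<longrightarrow> 1 \<le> Q2 \<longrightarrow>
    real (Q1 * Q2) \<le> real N powr (\<theta> - \<epsilon> / 2) \<longrightarrow>
    real_of_int J \<le> D * real N powr (1 - \<epsilon>) \<longrightarrow>
    \<bar>t\<bar> \<le> J \<longrightarrow> \<bar>h1\<bar> \<le> 2 * J \<longrightarrow> \<bar>h2\<bar> \<le> 2 * J \<longrightarrow>
    (\<forall>m>0. \<bar>F m\<bar> \<le> \<bar>lam Q1 (m + h1) * lam Q2 (m + h2)\<bar>) \<longrightarrow>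
    (\<forall>m. m + h1 > 0 \<longrightarrow> m + h2 > 0 \<longrightarrow> F m = lam Q1 (m + h1) * lam Q2 (m + h2)) \<longrightarrow>
    \<bar>(\<Sum>n=1..N. F (int n + t) * Lambda (int n + t)) - real N * main_term Q1 Q2 h1 h2\<bar> \<le> \<delta> * real N"
proof -
  \<comment> \<open>The squared divisor bound costs N^(2d) = N^(\<epsilon>/8), less than the
    N^(\<epsilon>/2) by which J and Q1 Q2 stay below N.\<close>
  define d where "d = \<epsilon> / 16"
  have d: "d > 0" using assms by (simp add: d_def)
  obtain C0 where C0: "C0 > 0" "\<And>n. n > 0 \<Longrightarrow> real (divisor_count n) \<le> C0 * real n powr d"
    using divisor_count_le_powr[OF d] by blast
  define C where "C = max 1 C0"
  have C: "C \<ge> 1" "\<And>n. n > 0 \<Longrightarrow> real (divisor_count n) \<le> C * real n powr d"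
  proof -
    show "C \<ge> 1" by (simp add: C_def)
    fix n :: nat assume "n > 0"
    hence "real (divisor_count n) \<le> C0 * real n powr d" by (rule C0(2))
    also have "\<dots> \<le> C * real n powr d" unfolding C_def by (intro mult_right_mono) auto
    finally show "real (divisor_count n) \<le> C * real n powr d" .
  qed
  have "\<forall>\<^sub>F N in sequentially. \<forall>Q1 Q2 h1 h2. 1 \<le> Q1 \<longrightarrow> 1 \<le> Q2 \<longrightarrow>
    real (Q1 * Q2) \<le> real N powr (\<theta> - \<epsilon> / 2) \<longrightarrow>
    \<bar>corr Q1 Q2 h1 h2 N - real N * main_term Q1 Q2 h1 h2\<bar> \<le> (\<delta> / 2) * real N"
    using assms by (intro corr_asymptotics) auto
  moreover have "\<forall>\<^sub>F N in sequentially. 2 * (ln (2 * real N) * (C * (4 * real N) powr d * (1 + ln (real N)) ^ 3)\<^sup>2 *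
      ((4 * D + 2) * real N powr (- (\<epsilon> / 2)))) < \<delta> / 2"
  proof (rule order_tendstoD)
    show "((\<lambda>N. 2 * (ln (2 * real N) * (C * (4 * real N) powr d * (1 + ln (real N)) ^ 3)\<^sup>2 *
      ((4 * D + 2) * real N powr (- (\<epsilon> / 2))))) \<longlongrightarrow> 0) sequentially"
      using assms C(1) unfolding d_def by real_asymp
  qed (use assms in auto)
  moreover have "\<forall>\<^sub>F N in sequentially. D * real N powr (- \<epsilon>) < 1 / 2"
  proof (rule order_tendstoD)
    show "((\<lambda>N. D * real N powr (- \<epsilon>)) \<longlongrightarrow> 0) sequentially" using assms by real_asymp
  qed auto
  moreover have "\<forall>\<^sub>F N in sequentially. N \<ge> 1" by (rule eventually_ge_at_top)
  ultimately show ?thesis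
  proof eventually_elim
    case (elim N)
    have N: "real N \<ge> 1" using elim(4) by simp
    show ?case
    proof (intro allI impI)
      fix Q1 Q2 :: nat and t h1 h2 J :: int and F :: "int \<Rightarrow> real"
      assume Q: "1 \<le> Q1" "1 \<le> Q2" "real (Q1 * Q2) \<le> real N powr (\<theta> - \<epsilon> / 2)"
        and J: "real_of_int J \<le> D * real N powr (1 - \<epsilon>)"
        and h: "\<bar>t\<bar> \<le> J" "\<bar>h1\<bar> \<le> 2 * J" "\<bar>h2\<bar> \<le> 2 * J"
        and F: "\<forall>m>0. \<bar>F m\<bar> \<le> \<bar>lam Q1 (m + h1) * lam Q2 (m + h2)\<bar>"
          "\<forall>m. m + h1 > 0 \<longrightarrow> m + h2 > 0 \<longrightarrow> F m = lam Q1 (m + h1) * lam Q2 (m + h2)"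
      have np: "real N powr (1 - e) = real N * real N powr (- e)" for e
        using N powr_add[of "real N" 1 "- e"] by simp
      have "real N powr (\<theta> - \<epsilon> / 2) \<le> real N powr (1 - \<epsilon> / 2)"
        using N assms by (intro powr_mono) auto
      hence Q': "real (Q1 * Q2) \<le> real N * real N powr (- (\<epsilon> / 2))"
        using order_trans[OF Q(3)] by (simp only: np)
      have "real N powr (- (\<epsilon> / 2)) \<le> real N powr 0" using N assms by (intro powr_mono) auto
      hence le1: "real N powr (- (\<epsilon> / 2)) \<le> 1" using N by simp
      note Q'
      also have "real N * real N powr (- (\<epsilon> / 2)) \<le> real N * 1"
        by (intro mult_left_mono le1) simp
      finally have QN: "Q1 * Q2 \<le> N" by (simp only: mult_1_right of_nat_le_iff)
      have "real_of_int J \<le> real N * (D * real N powr (- \<epsilon>))" using J unfolding np by (simp add: mult_ac)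
      also have "\<dots> \<le> real N * (1 / 2)" using elim(3) by (intro mult_left_mono) auto
      finally have "real_of_int (2 * J) \<le> real_of_int (int N)" by simp
      hence JN: "2 * J \<le> int N" by (simp only: of_int_le_iff)
      have "real N powr (- \<epsilon>) \<le> real N powr (- (\<epsilon> / 2))"
        using N assms by (intro powr_mono) auto
      hence "D * real N powr (- \<epsilon>) \<le> D * real N powr (- (\<epsilon> / 2))" using assms by (intro mult_left_mono) auto
      hence "real N * (D * real N powr (- \<epsilon>)) \<le> real N * (D * real N powr (- (\<epsilon> / 2)))"
        by (rule mult_left_mono) simp
      hence J': "real_of_int J \<le> real N * (D * real N powr (- (\<epsilon> / 2)))"
        using J unfolding np by (simp add: mult_ac)
      define K where "K = ln (2 * real N) * (C * (4 * real N) powr d * (1 + ln (real N)) ^ 3)\<^sup>2"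
      have K: "K \<ge> 0" unfolding K_def using N by (intro mult_nonneg_nonneg) auto
      have "\<bar>(\<Sum>n=1..N. F (int n + t) * Lambda (int n + t)) - corr Q1 Q2 h1 h2 N\<bar> \<le>
          2 * (K * (4 * real_of_int J + 2 * real (Q1 * Q2)))"
        unfolding K_def using F by (intro boundary_terms_le C d Q QN h JN) auto
      also have "\<dots> \<le> 2 * (K * (4 * (real N * (D * real N powr (- (\<epsilon> / 2)))) +
          2 * (real N * real N powr (- (\<epsilon> / 2)))))"
        using K by (intro mult_left_mono add_mono J' Q') auto
      also have "\<dots> = real N * (2 * (K * ((4 * D + 2) * real N powr (- (\<epsilon> / 2)))))"
        by (simp add: algebra_simps)
      also have "\<dots> \<le> real N * (\<delta> / 2)" using elim(2) unfolding K_def by (intro mult_left_mono) auto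
      finally have 1: "\<bar>(\<Sum>n=1..N. F (int n + t) * Lambda (int n + t)) - corr Q1 Q2 h1 h2 N\<bar> \<le>
          real N * (\<delta> / 2)" .
      have 2: "\<bar>corr Q1 Q2 h1 h2 N - real N * main_term Q1 Q2 h1 h2\<bar> \<le> (\<delta> / 2) * real N"
        using elim(1) Q by blast
      have "\<bar>x - z\<bar> \<le> \<delta> * real N" if "\<bar>x - y\<bar> \<le> real N * (\<delta> / 2)" "\<bar>y - z\<bar> \<le> (\<delta> / 2) * real N"
        for x y z :: real
      proof -
        have "\<bar>x - z\<bar> \<le> \<bar>x - y\<bar> + \<bar>y - z\<bar>" by linarith
        also have "\<dots> \<le> real N * (\<delta> / 2) + (\<delta> / 2) * real N" by (rule add_mono[OF that])
        finally show ?thesis by (simp add: field_simps)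
      qed
      from this[OF 1 2] show "\<bar>(\<Sum>n=1..N. F (int n + t) * Lambda (int n + t)) - real N * main_term Q1 Q2 h1 h2\<bar>
        \<le> \<delta> * real N" .
    qed
  qed
qed

text \<open>Since e^(1/2) \<le> 2, the number e^(24 omega) = (e^(1/2))^(48 omega) is at most 2^(48
  omega) \<le> tau^48.\<close>

lemma exp_card_prime_factors_le:
  assumes "n > 0"
  shows "exp (24 * real (card (prime_factors n))) \<le> real (divisor_count n) ^ 48"
proof -
  let ?w = "card (prime_factors n)"
  have "exp (24 * real ?w) = (exp (1/2) ^ ?w) ^ 48"
    by (simp flip: exp_of_nat_mult)
  also have "\<dots> \<le> (2 ^ ?w) ^ 48" by (intro power_mono exp_half_le2) auto
  also have "\<dots> \<le> real (divisor_count n) ^ 48"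
  proof (rule power_mono)
    have "real (2 ^ ?w) \<le> real (divisor_count n)"
      using two_power_card_prime_factors_le[OF assms] by (rule of_nat_mono)
    thus "2 ^ ?w \<le> real (divisor_count n)" by simp
  qed simp
  finally show ?thesis .
qed

text \<open>\<open>H\<close> will be a product of three differences of shifts, so tau(H)^48 is below
  any fixed power of N, while truncation saves Q^(1/4), of order at least N^(\<epsilon>/4).\<close>

lemma truncation_error_small:
  assumes "\<epsilon> > 0" "c > 0" "\<delta> > 0"
  shows "\<forall>\<^sub>F N in sequentially. \<forall>(H::int) Q. H \<noteq> 0 \<longrightarrow> \<bar>H\<bar> \<le> int N ^ 4 \<longrightarrow>
    c * real N powr \<epsilon> \<le> real (Suc Q) \<longrightarrow>
    bad_prime_factor H / real (Suc Q) powr (1/4) \<le> \<delta>"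
proof -
  \<comment> \<open>Since 1536 = 8 * 4 * 48, the bound (N^4)^(48 d) is N^(\<epsilon>/8), half of the
    exponent saved.\<close>
  define d where "d = \<epsilon> / 1536"
  have d: "d > 0" using assms by (simp add: d_def)
  obtain C where C: "C > 0" "\<And>n. n > 0 \<Longrightarrow> real (divisor_count n) \<le> C * real n powr d"
    using divisor_count_le_powr[OF d] by blast
  have "\<forall>\<^sub>F N in sequentially. exp (20 * zeta32) * C ^ 48 * real N powr (\<epsilon> / 8) / (c * real N powr \<epsilon>) powr (1/4) < \<delta>"
  proof (rule order_tendstoD)
    show "((\<lambda>N. exp (20 * zeta32) * C ^ 48 * real N powr (\<epsilon> / 8) / (c * real N powr \<epsilon>) powr (1/4)) \<longlongrightarrow> 0)
        sequentially"
      using assms C(1) by real_asymp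
  qed (use assms in auto)
  moreover have "\<forall>\<^sub>F N in sequentially. N \<ge> 1" by (rule eventually_ge_at_top)
  ultimately show ?thesis
  proof eventually_elim
    case (elim N)
    have N: "real N \<ge> 1" using elim(2) by simp
    show ?case
    proof (intro allI impI)
      fix H :: int and Q :: nat
      assume H: "H \<noteq> 0" "\<bar>H\<bar> \<le> int N ^ 4" and Q: "c * real N powr \<epsilon> \<le> real (Suc Q)"
      have n: "nat \<bar>H\<bar> > 0" using H by simp
      have "int (nat \<bar>H\<bar>) \<le> int (N ^ 4)" using H(2) by simp
      hence "real (nat \<bar>H\<bar>) \<le> real (N ^ 4)" by (simp only: of_nat_le_iff)
      hence HN: "real (nat \<bar>H\<bar>) \<le> real N powr 4" using N by simp
      have "bad_prime_factor H \<le>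
          exp (20 * zeta32) * real (divisor_count (nat \<bar>H\<bar>)) ^ 48"
        unfolding exp_add by (intro mult_left_mono exp_card_prime_factors_le n) auto
      also have "\<dots> \<le> exp (20 * zeta32) * (C * (real N powr 4) powr d) ^ 48"
      proof (intro mult_left_mono power_mono)
        have "real (divisor_count (nat \<bar>H\<bar>)) \<le> C * real (nat \<bar>H\<bar>) powr d" by (rule C(2)[OF n])
        also have "\<dots> \<le> C * (real N powr 4) powr d"
          using C(1) d HN by (intro mult_left_mono powr_mono2) auto
        finally show "real (divisor_count (nat \<bar>H\<bar>)) \<le> C * (real N powr 4) powr d" .
      qed auto
      also have "(C * (real N powr 4) powr d) ^ 48 = C ^ 48 * real N powr (\<epsilon> / 8)"
      proof -
        have "((real N powr 4) powr d) ^ 48 = (real N powr (4 * d)) powr real 48"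
          unfolding powr_powr[of "real N" 4] using N
          by (intro powr_realpow [symmetric]) simp
        also have "\<dots> = real N powr (\<epsilon> / 8)" by (simp add: powr_powr d_def)
        finally show ?thesis by (simp only: power_mult_distrib)
      qed
      finally have num: "bad_prime_factor H \<le>
          exp (20 * zeta32) * C ^ 48 * real N powr (\<epsilon> / 8)" by (simp only: mult.assoc)
      have "(c * real N powr \<epsilon>) powr (1/4) \<le> real (Suc Q) powr (1/4)"
        using Q assms by (intro powr_mono2) auto
      hence "bad_prime_factor H / real (Suc Q) powr (1/4) \<le>
          exp (20 * zeta32) * C ^ 48 * real N powr (\<epsilon> / 8) / (c * real N powr \<epsilon>) powr (1/4)"
        using num N assms by (intro frac_le) auto
      also have "\<dots> \<le> \<delta>" using elim(1) by simp
      finally show "bad_prime_factor H / real (Suc Q) powr (1/4) \<le> \<delta>" .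
    qed
  qed
qed

text \<open>Take y about log N and 4s = 1/log y. The shift enters only through its prime factors:
  those above y contribute O(1), those below O(sqrt(log log N)), and 1/s = O(log log N). The error
  is thus a power of log N with exponent tending to 0.\<close>

lemma diagonal_error_small:
  assumes "\<delta> > 0"
  shows "\<forall>\<^sub>F N in sequentially. \<forall>h::int. h \<noteq> 0 \<longrightarrow> \<bar>h\<bar> \<le> int N \<longrightarrow>
    (\<exists>s. 0 < s \<and> s \<le> 1/8 \<and> diagonal_error h s \<le> \<delta> * ln (real N))"
proof -
  define e :: real where "e = 10 * exp 1"
  have e: "e > 0" by (simp add: e_def)
  have "\<forall>\<^sub>F N in sequentially. exp (24 * zeta32 + e * (sqrt (2 + 4 * ln (1 + ln (real N))) + 2)) *
      (4 * ln (1 + ln (real N))) / ln (real N) < \<delta>"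
  proof (rule order_tendstoD)
    show "((\<lambda>N. exp (24 * zeta32 + e * (sqrt (2 + 4 * ln (1 + ln (real N))) + 2)) *
      (4 * ln (1 + ln (real N))) / ln (real N)) \<longlongrightarrow> 0) sequentially"
      using e by real_asymp
  qed (use assms in auto)
  moreover have "\<forall>\<^sub>F N in sequentially. ln (real N) > 8" by real_asymp
  ultimately show ?thesis
  proof eventually_elim
    case (elim N)
    define y where "y = nat \<lceil>ln (real N)\<rceil>"
    have y: "ln (real N) \<le> real y" "real y \<le> 1 + ln (real N)" using elim(2) by (auto simp: y_def) linarith
    have y8: "real y \<ge> 8" using y elim(2) by linarith
    \<comment> \<open>From y \<ge> 8 > e^2 follows log y \<ge> 2, which is s \<le> 1/8.\<close>
    have "ln (exp 2) \<le> ln (real y)"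
    proof (rule ln_mono)
      have "exp (2::real) = exp 1 * exp 1" by (simp flip: exp_add)
      also have "\<dots> \<le> (272/100) * (272/100)" using e_less_272 by (intro mult_mono) auto
      also have "\<dots> \<le> 8" by simp
      finally show "exp 2 \<le> real y" using y8 by linarith
    qed auto
    hence ly: "ln (real y) \<ge> 2" by simp
    have lyN: "ln (real y) \<le> ln (1 + ln (real N))" using y y8 by (intro ln_mono) auto
    define s where "s = 1 / (4 * ln (real y))"
    have s: "0 < s" "s \<le> 1/8" using ly by (auto simp: s_def field_simps)
    show ?case
    proof (intro allI impI exI[of _ s] conjI s)
      fix h :: int assume h: "h \<noteq> 0" "\<bar>h\<bar> \<le> int N"
      have n: "nat \<bar>h\<bar> > 0" using h by simp
      have s4: "4 * s - 1 = 1 / ln (real y) - 1" by (simp add: s_def)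
      have "(\<Sum>p\<in>prime_factors (nat \<bar>h\<bar>). real p powr (4 * s - 1)) \<le>
          exp 1 * (sqrt (2 + 4 * ln (real y)) + 2 * ln (real (nat \<bar>h\<bar>)) / real y)"
        unfolding s4 using y8 by (intro sum_prime_factors_powr_le n) auto
      also have "\<dots> \<le> exp 1 * (sqrt (2 + 4 * ln (1 + ln (real N))) + 2)"
      proof (intro mult_left_mono add_mono)
        show "sqrt (2 + 4 * ln (real y)) \<le> sqrt (2 + 4 * ln (1 + ln (real N)))"
          using lyN by simp
        have "ln (real (nat \<bar>h\<bar>)) \<le> ln (real N)" using h n by (intro ln_mono) auto
        hence "2 * ln (real (nat \<bar>h\<bar>)) \<le> 2 * real y" using y by linarith
        thus "2 * ln (real (nat \<bar>h\<bar>)) / real y \<le> 2" using y8 by (simp add: pos_divide_le_eq)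
      qed simp
      finally have "exp (24 * zeta32 + 10 * (\<Sum>p\<in>prime_factors (nat \<bar>h\<bar>). real p powr (4 * s - 1))) \<le>
          exp (24 * zeta32 + e * (sqrt (2 + 4 * ln (1 + ln (real N))) + 2))"
        by (simp add: e_def)
      hence "exp (24 * zeta32 + 10 * (\<Sum>p\<in>prime_factors (nat \<bar>h\<bar>). real p powr (4 * s - 1))) * (4 * ln (real y)) \<le>
          exp (24 * zeta32 + e * (sqrt (2 + 4 * ln (1 + ln (real N))) + 2)) * (4 * ln (1 + ln (real N)))"
        using lyN ly by (intro mult_mono) auto
      also have "\<dots> \<le> \<delta> * ln (real N)"
        using elim by (simp add: pos_divide_less_eq)
      finally show "diagonal_error h s
          \<le> \<delta> * ln (real N)" by (simp add: s_def)
    qed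
  qed
qed

text \<open>Any absolute constant serves here: combined with the diagonal estimate at Q = 2 it
  controls the size of the singular series.\<close>

lemma abs_main_term_2_le: "\<bar>main_term 2 2 h1 h2\<bar> \<le> 64"
proof -
  have "\<bar>main_term 2 2 h1 h2\<bar> \<le> (\<Sum>d1=1..2. \<Sum>d2=1..2. \<bar>lam_weight 2 d1 * lam_weight 2 d2 * rho2 h1 h2 d1 d2\<bar>)"
    unfolding main_term_def by (rule order_trans[OF sum_abs], rule sum_mono, rule sum_abs)
  also have "\<dots> \<le> (\<Sum>d1=1..2::nat. \<Sum>d2=1..2::nat. 4 * 4 * 1)"
  proof (intro sum_mono)
    fix d1 d2 :: nat assume d: "d1 \<in> {1..2}" "d2 \<in> {1..2}"
    have w: "\<bar>lam_weight 2 d\<bar> \<le> 4" if "d \<in> {1..2}" for d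
    proof -
      have "\<bar>lam_weight 2 d\<bar> \<le> harm 2 ^ 3" using that by (intro abs_lam_weight_le) auto
      also have "harm 2 = (3/2 :: real)" by (simp add: harm_expand)
      finally show ?thesis by (simp add: power3_eq_cube)
    qed
    have "lcm d1 d2 > 0" using d by (intro lcm_pos_nat) auto
    hence "real (totient (lcm d1 d2)) \<ge> 1" by (simp add: Suc_le_eq)
    moreover have "1 / x \<le> 1" if "x \<ge> 1" for x :: real using that by simp
    ultimately have "1 / real (totient (lcm d1 d2)) \<le> 1" by blast
    hence "\<bar>rho2 h1 h2 d1 d2\<bar> \<le> 1" by (simp add: rho2_def)
    thus "\<bar>lam_weight 2 d1 * lam_weight 2 d2 * rho2 h1 h2 d1 d2\<bar> \<le> 4 * 4 * 1"
      unfolding abs_mult using d by (intro mult_mono w) auto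
  qed
  also have "\<dots> = 64" by simp
  finally show ?thesis .
qed

text \<open>Passing from log floor(R) to log R costs up to log 2 times the singular series, which is
  not uniformly bounded. The diagonal estimate itself, taken at Q = 2, bounds this cost by the same
  error term plus 64.\<close>

lemma main_term_diagonal_real:
  fixes j :: "nat \<Rightarrow> int"
  assumes "j 1 \<noteq> j 2" "R \<ge> 1" and s: "0 < s" "s \<le> 1/8"
  defines "h \<equiv> j 1 - j 2" and "Q \<equiv> nat \<lfloor>R\<rfloor>"
  shows "\<bar>main_term Q Q h h - ln R * singular_series 2 j\<bar> \<le>
    2 * (diagonal_error h s) + 64"
proof -
  define B where "B = diagonal_error h s"
  define S where "S = singular_series 2 j"
  have Q: "Q \<ge> 1" unfolding Q_def using assms(2) by linarith
  have "\<lfloor>R\<rfloor> \<ge> 1" using assms(2) by simp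
  hence "real Q = of_int \<lfloor>R\<rfloor>" by (simp add: Q_def)
  moreover have "real Q \<ge> 1" using Q by simp
  ultimately have QR: "real Q \<le> R" "R \<le> 2 * real Q" by linarith+
  have 1: "\<bar>main_term Q Q h h - ln (real Q) * S\<bar> \<le> B"
    unfolding B_def S_def h_def by (intro main_term_diagonal assms Q)
  have "\<bar>main_term 2 2 h h - ln (real 2) * S\<bar> \<le> B"
    unfolding B_def S_def h_def by (intro main_term_diagonal assms) auto
  hence 2: "ln 2 * \<bar>S\<bar> \<le> B + 64"
    using abs_main_term_2_le[of h h] by (simp add: abs_le_iff abs_mult_pos' abs_if split: if_splits)
  have "ln R \<le> ln (2 * real Q)" using QR assms(2) by (intro ln_mono) auto
  also have "\<dots> = ln 2 + ln (real Q)" using Q by (subst ln_mult_pos) auto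
  finally have "ln R - ln (real Q) \<le> ln 2" by simp
  moreover have "ln (real Q) \<le> ln R" using QR Q by (intro ln_mono) auto
  ultimately have "\<bar>ln (real Q) * S - ln R * S\<bar> \<le> ln 2 * \<bar>S\<bar>"
    unfolding left_diff_distrib [symmetric] abs_mult by (intro mult_right_mono) auto
  with 1 2 have "\<bar>main_term Q Q h h - ln R * S\<bar> \<le> 2 * B + 64" by linarith
  thus ?thesis unfolding B_def S_def .
qed

section \<open>The three correlation sums\<close>

lemma eventually_powr_neg_less:
  assumes "K > 0" "a > 0" "\<delta> > 0"
  shows "\<forall>\<^sub>F N::nat in sequentially. K * real N powr (- a) < \<delta>"
proof (rule order_tendstoD)
  show "((\<lambda>N::nat. K * real N powr (- a)) \<longlongrightarrow> 0) sequentially" using assms by real_asymp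
qed (use assms in auto)

lemma shift_le_N:
  assumes "real_of_int J \<le> D * real N powr (1 - \<epsilon>)" "D * real N powr (- \<epsilon>) < 1 / 2" "N \<ge> 1"
  shows "2 * J \<le> int N"
proof -
  have "real N powr (1 - \<epsilon>) = real N * real N powr (- \<epsilon>)"
    using assms(3) powr_add[of "real N" 1 "- \<epsilon>"] by simp
  hence "real_of_int J \<le> real N * (D * real N powr (- \<epsilon>))" using assms(1) by (simp add: mult_ac)
  also have "\<dots> \<le> real N * (1 / 2)" using assms(2) by (intro mult_left_mono) auto
  finally have "real_of_int (2 * J) \<le> real_of_int (int N)" by simp
  thus ?thesis by (simp only: of_int_le_iff)
qed

lemma abs_product_le_power4:
  fixes a b c :: int
  assumes "\<bar>a\<bar> \<le> int N" "\<bar>b\<bar> \<le> int N" "\<bar>c\<bar> \<le> 2 * int N" "N \<ge> 2"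
  shows "\<bar>a * b * c\<bar> \<le> int N ^ 4"
proof -
  have "\<bar>a\<bar> * \<bar>b\<bar> \<le> int N * int N" using assms(1,2) by (intro mult_mono) auto
  moreover have "2 * int N \<le> int N * int N" using assms(4) by (intro mult_right_mono) auto
  hence "\<bar>c\<bar> \<le> int N * int N" using assms(3) by linarith
  ultimately have "\<bar>a\<bar> * \<bar>b\<bar> * \<bar>c\<bar> \<le> int N * int N * (int N * int N)"
    by (rule mult_mono) auto
  thus ?thesis by (simp add: abs_mult power4_eq_xxxx)
qed

lemma nat_floor_bounds:
  assumes "R \<ge> 1"
  shows "1 \<le> nat \<lfloor>R\<rfloor>" "real (nat \<lfloor>R\<rfloor>) \<le> R" "R \<le> real (Suc (nat \<lfloor>R\<rfloor>))"
proof -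
  have f: "\<lfloor>R\<rfloor> \<ge> 1" using assms by simp
  hence "real (nat \<lfloor>R\<rfloor>) = of_int \<lfloor>R\<rfloor>" by simp
  moreover have "1 \<le> nat \<lfloor>R\<rfloor>" using f by linarith
  ultimately show "1 \<le> nat \<lfloor>R\<rfloor>" "real (nat \<lfloor>R\<rfloor>) \<le> R" "R \<le> real (Suc (nat \<lfloor>R\<rfloor>))" by linarith+
qed

text \<open>The square of R is at most C^2 N^(\<theta> - 2 \<epsilon>), and the surplus N^(-3
  \<epsilon>/2) absorbs C^2.\<close>

lemma level_pair_le:
  assumes R: "1 \<le> R" "R \<le> C * real N powr (\<theta> / 2 - \<epsilon>)" and N: "N \<ge> 1"
    and C: "C\<^sup>2 * real N powr (- (3 * \<epsilon> / 2)) < 1"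
  shows "real (nat \<lfloor>R\<rfloor> * nat \<lfloor>R\<rfloor>) \<le> real N powr (\<theta> - \<epsilon> / 2)"
proof -
  have "real (nat \<lfloor>R\<rfloor> * nat \<lfloor>R\<rfloor>) = real (nat \<lfloor>R\<rfloor>) ^ 2" by (simp add: power2_eq_square)
  also have "\<dots> \<le> (C * real N powr (\<theta> / 2 - \<epsilon>)) ^ 2"
    using nat_floor_bounds[OF R(1)] R(2) by (intro power_mono) auto
  also have "\<dots> = C\<^sup>2 * (real N powr (\<theta> / 2 - \<epsilon>) * real N powr (\<theta> / 2 - \<epsilon>))"
    by (simp add: power2_eq_square)
  also have "real N powr (\<theta> / 2 - \<epsilon>) * real N powr (\<theta> / 2 - \<epsilon>) =
      real N powr (- (3 * \<epsilon> / 2)) * real N powr (\<theta> - \<epsilon> / 2)"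
    unfolding powr_add [symmetric] by (intro arg_cong[of _ _ "(powr) (real N)"]) (simp add: field_simps)
  also have "C\<^sup>2 * \<dots> = C\<^sup>2 * real N powr (- (3 * \<epsilon> / 2)) * real N powr (\<theta> - \<epsilon> / 2)" by simp
  also have "\<dots> \<le> 1 * real N powr (\<theta> - \<epsilon> / 2)" using C by (intro mult_right_mono) auto
  finally show ?thesis by simp
qed

lemma abs_diff_chain:
  assumes "\<bar>x - N * m\<bar> \<le> \<delta> / 2 * N" "\<bar>m - S\<bar> \<le> \<delta> / 2" "(N :: real) \<ge> 0"
  shows "\<bar>x - S * N\<bar> \<le> \<delta> * N"
proof -
  have "\<bar>N * (m - S)\<bar> \<le> N * (\<delta> / 2)"
    unfolding abs_mult abs_of_nonneg[OF assms(3)] by (rule mult_left_mono[OF assms(2,3)])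
  moreover have "x - S * N = (x - N * m) + N * (m - S)" by (simp add: algebra_simps)
  ultimately have "\<bar>x - S * N\<bar> \<le> \<delta> / 2 * N + N * (\<delta> / 2)" using assms(1) by linarith
  also have "\<dots> = \<delta> * N" by (simp add: field_simps)
  finally show ?thesis .
qed

text \<open>The single lambda is paired with \<open>lam 1\<close> at the dummy shift -h of
  \<open>main_term_tuple2\<close>, so that the estimate for pairs applies.\<close>

lemma correlation_k2:
  assumes "EH \<theta>" "\<theta> \<le> 1" "\<epsilon> > 0" "c > 0" "C > 0" "D > 0" "\<delta> > 0"
  shows "\<forall>\<^sub>F N::nat in sequentially. \<forall>(R::real) (j::nat \<Rightarrow> int) J.
    1 \<le> R \<longrightarrow> c * real N powr \<epsilon> \<le> R \<longrightarrow> R \<le> C * real N powr (\<theta> - \<epsilon>) \<longrightarrow>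
    j 1 \<noteq> j 2 \<longrightarrow> \<bar>j 1\<bar> \<le> J \<longrightarrow> \<bar>j 2\<bar> \<le> J \<longrightarrow> real_of_int J \<le> D * real N powr (1 - \<epsilon>) \<longrightarrow>
    \<bar>(\<Sum>n=1..N. lambda_R R (int n + j 1) * Lambda (int n + j 2)) - singular_series 2 j * real N\<bar>
      \<le> \<delta> * real N"
  using pair_correlation[OF assms(1-3) assms(6) half_gt_zero[OF assms(7)]]
    truncation_error_small[OF assms(3,4) half_gt_zero[OF assms(7)]]
    eventually_powr_neg_less[OF assms(5) half_gt_zero[OF assms(3)] zero_less_one]
    eventually_powr_neg_less[OF assms(6,3) half_gt_zero[OF zero_less_one]] eventually_ge_at_top[of 2]
proof eventually_elim
  case (elim N)
  show ?case
  proof (intro allI impI)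
    fix R :: real and j :: "nat \<Rightarrow> int" and J :: int
    assume R: "1 \<le> R" "c * real N powr \<epsilon> \<le> R" "R \<le> C * real N powr (\<theta> - \<epsilon>)"
      and j: "j 1 \<noteq> j 2" "\<bar>j 1\<bar> \<le> J" "\<bar>j 2\<bar> \<le> J" and J: "real_of_int J \<le> D * real N powr (1 - \<epsilon>)"
    define Q where "Q = nat \<lfloor>R\<rfloor>"
    define h where "h = j 1 - j 2"
    note Q = nat_floor_bounds[OF R(1), folded Q_def]
    have JN: "2 * J \<le> int N" by (rule shift_le_N[OF J elim(4)]) (use elim(5) in linarith)
    have hJ: "\<bar>h\<bar> \<le> 2 * J" using j unfolding h_def by linarith
    have "real (Q * 1) \<le> C * real N powr (\<theta> - \<epsilon>)" using Q R by simp
    also have "\<theta> - \<epsilon> = - (\<epsilon> / 2) + (\<theta> - \<epsilon> / 2)" by simp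
    also have "C * real N powr (- (\<epsilon> / 2) + (\<theta> - \<epsilon> / 2)) = C * real N powr (- (\<epsilon> / 2)) * real N powr (\<theta> - \<epsilon> / 2)"
      unfolding powr_add by simp
    also have "\<dots> \<le> 1 * real N powr (\<theta> - \<epsilon> / 2)"
      using elim(3) assms by (intro mult_right_mono) auto
    finally have QQ: "real (Q * 1) \<le> real N powr (\<theta> - \<epsilon> / 2)" by simp
    define F where "F m = lambda_R R (m + h)" for m
    have F: "\<forall>m>0. \<bar>F m\<bar> \<le> \<bar>lam Q (m + h) * lam 1 (m + - h)\<bar>"
      "\<forall>m. m + h > 0 \<longrightarrow> m + - h > 0 \<longrightarrow> F m = lam Q (m + h) * lam 1 (m + - h)"
      by (auto simp: F_def lambda_R_eq_lam Q_def)
    have "\<bar>(\<Sum>n=1..N. F (int n + j 2) * Lambda (int n + j 2)) - real N * main_term Q 1 h (- h)\<bar> \<le> (\<delta> / 2) * real N"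
      using elim(1)[THEN spec, of Q, THEN spec, of 1, THEN spec, of "j 2", THEN spec, of h,
          THEN spec, of "- h", THEN spec, of J, THEN spec, of F, THEN mp, THEN mp, THEN mp, THEN mp,
          THEN mp, THEN mp, THEN mp, THEN mp, THEN mp, OF Q(1) order_refl QQ J j(3) hJ _ F] hJ
      by simp
    moreover have "F (int n + j 2) = lambda_R R (int n + j 1)" for n by (simp add: F_def h_def)
    ultimately have 1: "\<bar>(\<Sum>n=1..N. lambda_R R (int n + j 1) * Lambda (int n + j 2)) - real N * main_term Q 1 h (- h)\<bar>
        \<le> \<delta> / 2 * real N" by simp
    have "\<bar>main_term Q 1 h (- h) - singular_series 2 j\<bar> \<le>
      bad_prime_factor (h * - h * (h - - h)) / real (Suc Q) powr (1/4)"
      unfolding h_def by (rule main_term_tuple2[OF j(1) Q(1)])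
    also have "\<dots> \<le> \<delta> / 2"
    proof -
      have "\<bar>h * - h * (h - - h)\<bar> \<le> int N ^ 4"
        using hJ JN elim(5) by (intro abs_product_le_power4) auto
      moreover have "h * - h * (h - - h) \<noteq> 0" using j(1) by (simp add: h_def)
      moreover have "c * real N powr \<epsilon> \<le> real (Suc Q)" using R(2) Q(3) by linarith
      ultimately show ?thesis by (intro elim(2)[rule_format])
    qed
    finally have 2: "\<bar>main_term Q 1 h (- h) - singular_series 2 j\<bar> \<le> \<delta> / 2" .
    show "\<bar>(\<Sum>n=1..N. lambda_R R (int n + j 1) * Lambda (int n + j 2)) - singular_series 2 j * real N\<bar>
      \<le> \<delta> * real N"
      by (rule abs_diff_chain[OF 1 2]) simp
  qed
qed

lemma correlation_k3_distinct:
  assumes "EH \<theta>" "\<theta> \<le> 1" "\<epsilon> > 0" "c > 0" "C > 0" "D > 0" "\<delta> > 0"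
  shows "\<forall>\<^sub>F N::nat in sequentially. \<forall>(R::real) (j::nat \<Rightarrow> int) J.
    1 \<le> R \<longrightarrow> c * real N powr \<epsilon> \<le> R \<longrightarrow> R \<le> C * real N powr (\<theta> / 2 - \<epsilon>) \<longrightarrow>
    j 1 \<noteq> j 3 \<longrightarrow> j 2 \<noteq> j 3 \<longrightarrow> j 1 \<noteq> j 2 \<longrightarrow> \<bar>j 1\<bar> \<le> J \<longrightarrow> \<bar>j 2\<bar> \<le> J \<longrightarrow> \<bar>j 3\<bar> \<le> J \<longrightarrow>
    real_of_int J \<le> D * real N powr (1 - \<epsilon>) \<longrightarrow>
    \<bar>(\<Sum>n=1..N. lambda_R R (int n + j 1) * lambda_R R (int n + j 2) * Lambda (int n + j 3))
       - singular_series 3 j * real N\<bar> \<le> \<delta> * real N"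
proof -
  have C2: "C\<^sup>2 > 0" and e32: "3 * \<epsilon> / 2 > 0" using assms by simp_all
  show ?thesis
    using pair_correlation[OF assms(1-3) assms(6) half_gt_zero[OF assms(7)]]
      truncation_error_small[OF assms(3,4) half_gt_zero[OF assms(7)]]
      eventually_powr_neg_less[OF C2 e32 zero_less_one]
      eventually_powr_neg_less[OF assms(6,3) half_gt_zero[OF zero_less_one]] eventually_ge_at_top[of 2]
  proof eventually_elim
    case (elim N)
    show ?case
    proof (intro allI impI)
      fix R :: real and j :: "nat \<Rightarrow> int" and J :: int
      assume R: "1 \<le> R" "c * real N powr \<epsilon> \<le> R" "R \<le> C * real N powr (\<theta> / 2 - \<epsilon>)"
        and j: "j 1 \<noteq> j 3" "j 2 \<noteq> j 3" "j 1 \<noteq> j 2" "\<bar>j 1\<bar> \<le> J" "\<bar>j 2\<bar> \<le> J" "\<bar>j 3\<bar> \<le> J"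
        and J: "real_of_int J \<le> D * real N powr (1 - \<epsilon>)"
      define Q where "Q = nat \<lfloor>R\<rfloor>"
      define h1 h2 where "h1 = j 1 - j 3" and "h2 = j 2 - j 3"
      note Q = nat_floor_bounds[OF R(1), folded Q_def]
      have JN: "2 * J \<le> int N" by (rule shift_le_N[OF J elim(4)]) (use elim(5) in linarith)
      have hJ: "\<bar>h1\<bar> \<le> 2 * J" "\<bar>h2\<bar> \<le> 2 * J" "\<bar>j 1 - j 2\<bar> \<le> 2 * J"
        using j unfolding h1_def h2_def by linarith+
      have QQ: "real (Q * Q) \<le> real N powr (\<theta> - \<epsilon> / 2)"
        unfolding Q_def
        by (rule level_pair_le[OF R(1,3) _ elim(3)]) (use elim(5) in linarith)
      define F where "F m = lambda_R R (m + h1) * lambda_R R (m + h2)" for m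
      have F: "\<forall>m>0. \<bar>F m\<bar> \<le> \<bar>lam Q (m + h1) * lam Q (m + h2)\<bar>"
        "\<forall>m. m + h1 > 0 \<longrightarrow> m + h2 > 0 \<longrightarrow> F m = lam Q (m + h1) * lam Q (m + h2)"
        by (auto simp: F_def lambda_R_eq_lam Q_def)
      have "\<bar>(\<Sum>n=1..N. F (int n + j 3) * Lambda (int n + j 3)) - real N * main_term Q Q h1 h2\<bar> \<le> (\<delta> / 2) * real N"
        by (rule elim(1)[THEN spec, of Q, THEN spec, of Q, THEN spec, of "j 3", THEN spec, of h1,
            THEN spec, of h2, THEN spec, of J, THEN spec, of F, THEN mp, THEN mp, THEN mp, THEN mp,
            THEN mp, THEN mp, THEN mp, THEN mp, THEN mp, OF Q(1) Q(1) QQ J j(6) hJ(1,2) F])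
      moreover have "F (int n + j 3) = lambda_R R (int n + j 1) * lambda_R R (int n + j 2)" for n
        by (simp add: F_def h1_def h2_def)
      ultimately have 1: "\<bar>(\<Sum>n=1..N. lambda_R R (int n + j 1) * lambda_R R (int n + j 2) * Lambda (int n + j 3))
          - real N * main_term Q Q h1 h2\<bar> \<le> \<delta> / 2 * real N" by simp
      have "\<bar>main_term Q Q h1 h2 - singular_series 3 j\<bar> \<le>
        bad_prime_factor (h1 * h2 * (j 1 - j 2)) / real (Suc Q) powr (1/4)"
        unfolding h1_def h2_def by (rule main_term_tuple3[OF j(1-3)])
      also have "\<dots> \<le> \<delta> / 2"
      proof -
        have "\<bar>h1 * h2 * (j 1 - j 2)\<bar> \<le> int N ^ 4"
          using hJ JN elim(5) by (intro abs_product_le_power4) auto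
        moreover have "h1 * h2 * (j 1 - j 2) \<noteq> 0" using j by (simp add: h1_def h2_def)
        moreover have "c * real N powr \<epsilon> \<le> real (Suc Q)" using R(2) Q(3) by linarith
        ultimately show ?thesis by (intro elim(2)[rule_format])
      qed
      finally have 2: "\<bar>main_term Q Q h1 h2 - singular_series 3 j\<bar> \<le> \<delta> / 2" .
      show "\<bar>(\<Sum>n=1..N. lambda_R R (int n + j 1) * lambda_R R (int n + j 2) * Lambda (int n + j 3))
         - singular_series 3 j * real N\<bar> \<le> \<delta> * real N"
        by (rule abs_diff_chain[OF 1 2]) simp
    qed
  qed
qed

text \<open>The normalization is N log R, and R is at least a constant times N^\<epsilon>; an error
  o(N log N) is therefore small enough.\<close>

lemma correlation_k3_square:
  assumes "EH \<theta>" "\<theta> \<le> 1" "\<epsilon> > 0" "c > 0" "C > 0" "D > 0" "\<delta> > 0"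
  shows "\<forall>\<^sub>F N::nat in sequentially. \<forall>(R::real) (j::nat \<Rightarrow> int) J.
    1 \<le> R \<longrightarrow> c * real N powr \<epsilon> \<le> R \<longrightarrow> R \<le> C * real N powr (\<theta> / 2 - \<epsilon>) \<longrightarrow>
    j 1 \<noteq> j 2 \<longrightarrow> \<bar>j 1\<bar> \<le> J \<longrightarrow> \<bar>j 2\<bar> \<le> J \<longrightarrow> real_of_int J \<le> D * real N powr (1 - \<epsilon>) \<longrightarrow>
    ln R > 0 \<and>
    \<bar>(\<Sum>n=1..N. lambda_R R (int n + j 1) ^ 2 * Lambda (int n + j 2)) - singular_series 2 j * real N * ln R\<bar>
      \<le> \<delta> * real N * ln R"
proof -
  \<comment> \<open>The errors add up to 4 \<delta>' N log N = \<delta> (\<epsilon>/2) N log N, and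
    log R is at least (\<epsilon>/2) log N.\<close>
  define \<delta>' where "\<delta>' = \<delta> * \<epsilon> / 8"
  have C2: "C\<^sup>2 > 0" and e32: "3 * \<epsilon> / 2 > 0" using assms by simp_all
  have d': "\<delta>' > 0" using assms by (simp add: \<delta>'_def)
  \<comment> \<open>Half of the exponent \<epsilon> absorbs the constant \<open>c\<close> in the
    lower bound for R.\<close>
  have e1: "\<forall>\<^sub>F N::nat in sequentially. ln c + \<epsilon> * ln (real N) > \<epsilon> / 2 * ln (real N)"
    using assms(3) by real_asymp
  \<comment> \<open>The constant 64 is the additive term of
    \<open>main_term_diagonal_real\<close>.\<close>
  have e2: "\<forall>\<^sub>F N::nat in sequentially. \<delta>' * ln (real N) > 64" using d' by real_asymp
  have e3: "\<forall>\<^sub>F N::nat in sequentially. ln (real N) > 1" by real_asymp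
  show ?thesis
    using pair_correlation[OF assms(1-3) assms(6) d'] diagonal_error_small[OF d']
      eventually_powr_neg_less[OF C2 e32 zero_less_one]
      eventually_powr_neg_less[OF assms(6,3) half_gt_zero[OF zero_less_one]] eventually_ge_at_top[of 2] e1 e2 e3
  proof eventually_elim
    case (elim N)
    show ?case
    proof (intro allI impI)
      fix R :: real and j :: "nat \<Rightarrow> int" and J :: int
      assume R: "1 \<le> R" "c * real N powr \<epsilon> \<le> R" "R \<le> C * real N powr (\<theta> / 2 - \<epsilon>)"
        and j: "j 1 \<noteq> j 2" "\<bar>j 1\<bar> \<le> J" "\<bar>j 2\<bar> \<le> J" and J: "real_of_int J \<le> D * real N powr (1 - \<epsilon>)"
      define Q where "Q = nat \<lfloor>R\<rfloor>"
      define h where "h = j 1 - j 2"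
      define S where "S = singular_series 2 j"
      define l where "l = ln (real N)"
      define X where "X = (\<Sum>n=1..N. lambda_R R (int n + j 1) ^ 2 * Lambda (int n + j 2))"
      note Q = nat_floor_bounds[OF R(1), folded Q_def]
      have l: "l > 1" "\<delta>' * l > 64" using elim unfolding l_def by simp_all
      have JN: "2 * J \<le> int N" by (rule shift_le_N[OF J elim(4)]) (use elim(5) in linarith)
      have hJ: "\<bar>h\<bar> \<le> 2 * J" using j unfolding h_def by linarith
      have QQ: "real (Q * Q) \<le> real N powr (\<theta> - \<epsilon> / 2)"
        unfolding Q_def
      by (rule level_pair_le[OF R(1,3) _ elim(3)]) (use elim(5) in linarith)
      define F where "F m = lambda_R R (m + h) ^ 2" for m
      have F: "\<forall>m>0. \<bar>F m\<bar> \<le> \<bar>lam Q (m + h) * lam Q (m + h)\<bar>"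
        "\<forall>m. m + h > 0 \<longrightarrow> m + h > 0 \<longrightarrow> F m = lam Q (m + h) * lam Q (m + h)"
        by (auto simp: F_def lambda_R_eq_lam Q_def power2_eq_square)
      have "\<bar>(\<Sum>n=1..N. F (int n + j 2) * Lambda (int n + j 2)) - real N * main_term Q Q h h\<bar> \<le> \<delta>' * real N"
        by (rule elim(1)[THEN spec, of Q, THEN spec, of Q, THEN spec, of "j 2", THEN spec, of h,
            THEN spec, of h, THEN spec, of J, THEN spec, of F, THEN mp, THEN mp, THEN mp, THEN mp,
            THEN mp, THEN mp, THEN mp, THEN mp, THEN mp, OF Q(1) Q(1) QQ J j(3) hJ hJ F])
      moreover have "F (int n + j 2) = lambda_R R (int n + j 1) ^ 2" for n by (simp add: F_def h_def)
      ultimately have 1: "\<bar>X - real N * main_term Q Q h h\<bar> \<le> \<delta>' * real N"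
        by (simp add: X_def)
      have "h \<noteq> 0" "\<bar>h\<bar> \<le> int N" using j(1) hJ JN by (auto simp: h_def)
      then obtain s where s: "0 < s" "s \<le> 1/8" and
        B: "diagonal_error h s \<le> \<delta>' * l"
        using elim(2) unfolding l_def by blast
      have "\<bar>main_term Q Q h h - ln R * S\<bar> \<le>
        2 * (diagonal_error h s) + 64"
        unfolding Q_def h_def S_def by (rule main_term_diagonal_real[OF j(1) R(1) s])
      also have "\<dots> \<le> 3 * (\<delta>' * l)" using B l by linarith
      finally have 2: "\<bar>main_term Q Q h h - ln R * S\<bar> \<le> 3 * (\<delta>' * l)" .
      have "\<bar>real N * (main_term Q Q h h - ln R * S)\<bar> \<le> real N * (3 * (\<delta>' * l))"
        unfolding abs_mult abs_of_nat by (rule mult_left_mono[OF 2]) simp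
      moreover have "X - S * real N * ln R = (X - real N * main_term Q Q h h) +
          real N * (main_term Q Q h h - ln R * S)" by (simp add: algebra_simps)
      moreover have "\<delta>' * real N \<le> real N * (\<delta>' * l)"
        using d' l(1) by (simp add: mult_left_mono mult.left_commute mult_le_cancel_left1)
      ultimately have 3: "\<bar>X - S * real N * ln R\<bar> \<le> real N * (\<delta>' * l) + real N * (3 * (\<delta>' * l))"
        using 1 by linarith
      have "c * real N powr \<epsilon> > 0" using assms elim(5) by simp
      hence "ln (c * real N powr \<epsilon>) \<le> ln R" using R(2) by (intro ln_mono) auto
      also have "ln (c * real N powr \<epsilon>) = ln c + \<epsilon> * l"
        using assms elim(5) by (simp add: ln_mult_pos ln_powr l_def)
      finally have lR: "\<epsilon> / 2 * l \<le> ln R" using elim(6) unfolding l_def by linarith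
      have "\<epsilon> / 2 * l > 0" using assms l by simp
      with lR have "ln R > 0" by linarith
      moreover have "real N * (\<delta>' * l) + real N * (3 * (\<delta>' * l)) = \<delta> * real N * (\<epsilon> / 2 * l)"
        by (simp add: \<delta>'_def field_simps)
      moreover have "\<delta> * real N * (\<epsilon> / 2 * l) \<le> \<delta> * real N * ln R"
        using lR assms by (intro mult_left_mono) auto
      ultimately show "ln R > 0 \<and> \<bar>(\<Sum>n=1..N. lambda_R R (int n + j 1) ^ 2 * Lambda (int n + j 2)) -
          singular_series 2 j * real N * ln R\<bar> \<le> \<delta> * real N * ln R"
        using 3 unfolding X_def S_def by linarith
    qed
  qed
qed

text \<open>The witness is the error divided by N L; this passes from an absolute error bound to the
  form S + \<eta>.\<close>

lemma relative_error_witness: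
  assumes "\<bar>X - S * N * L\<bar> \<le> \<delta> * N * L" "N * L > (0 :: real)"
  shows "\<exists>\<eta>. \<bar>\<eta>\<bar> \<le> \<delta> \<and> X = (S + \<eta>) * N * L"
proof -
  let ?\<eta> = "(X - S * N * L) / (N * L)"
  have "\<bar>?\<eta>\<bar> = \<bar>X - S * N * L\<bar> / (N * L)" unfolding abs_divide using assms(2) by linarith
  also have "\<dots> \<le> \<delta>" using assms by (subst pos_divide_le_eq) (auto simp: mult.assoc)
  finally have "\<bar>?\<eta>\<bar> \<le> \<delta>" .
  moreover have "?\<eta> * (N * L) = X - S * N * L"
    using assms(2) by (intro nonzero_eq_divide_eq[THEN iffD1]) linarith+
  hence "X = (S + ?\<eta>) * N * L" by (simp only: distrib_right mult.assoc)
  ultimately show ?thesis by blast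
qed

text \<open>The constants c, C and D are those implied in the ranges of R and of the shifts; o(1)
  becomes an \<eta> bounded by an arbitrary \<delta>, where the threshold for N precedes R and j and
  so expresses uniformity.\<close>

theorem theorem2:
  fixes k r :: nat and a :: "nat \<Rightarrow> nat" and \<theta> \<epsilon> :: real
  assumes "2 \<le> k" and "k \<le> 3"
    and "2 \<le> r"
    and "\<forall>i\<in>{1..r}. 1 \<le> a i" and "a r = 1" and "(\<Sum>i=1..r. a i) = k"
    and "0 < \<theta>" and "\<theta> \<le> 1" and "EH \<theta>"
    and "0 < \<epsilon>"
  shows "\<forall>c>0. \<forall>C>0. \<forall>D>0. \<forall>\<delta>>0. \<forall>\<^sub>F N::nat in sequentially.
    \<forall>(R::real) (j::nat \<Rightarrow> int).
      1 \<le> R \<longrightarrow>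
      c * real N powr \<epsilon> \<le> R \<longrightarrow>
      R \<le> C * real N powr (\<theta> / (real k - 1) - \<epsilon>) \<longrightarrow>
      inj_on j {1..r} \<longrightarrow>
      real_of_int (MAX i\<in>{1..r}. \<bar>j i\<bar>) \<le> D * real N powr (1 / (real k - 1) - \<epsilon>) \<longrightarrow>
      (\<exists>\<eta>::real. \<bar>\<eta>\<bar> \<le> \<delta> \<and>
        (\<Sum>n=1..N. (\<Prod>i=1..r-1. lambda_R R (int n + j i) ^ a i) * Lambda (int n + j r))
          = (singular_series r j + \<eta>) * real N * ln R ^ (k - r))"
proof (intro allI impI, goal_cases)
  case pos: (1 c C D \<delta>)
  have sub: "{1..2} = {1, 2::nat}" "{1..3} = {1, 2, 3::nat}" by auto
  \<comment> \<open>All exponents are at least 1, so r \<le> k; this leaves three cases and makes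
    the natural subtraction k - r exact.\<close>
  have "card {1..r} \<le> (\<Sum>i=1..r. a i)"
    using sum_mono[of "{1..r}" "\<lambda>_. 1" a] assms(4) by simp
  hence "r \<le> k" using assms(6) by simp
  then consider "k = 2" "r = 2" | "k = 3" "r = 3" | "k = 3" "r = 2" using assms(1-3) by linarith
  thus ?case
  proof cases
    case 1
    have a: "a 1 = 1" using assms(5,6) 1 unfolding 1 sub by simp
    from correlation_k2[OF assms(9,8,10) pos] eventually_ge_at_top[of 1] show ?thesis
    proof eventually_elim
      case (elim N)
      show ?case
      proof (intro allI impI)
        fix R :: real and j :: "nat \<Rightarrow> int"
        assume R: "1 \<le> R" "c * real N powr \<epsilon> \<le> R" "R \<le> C * real N powr (\<theta> / (real k - 1) - \<epsilon>)"
          and j: "inj_on j {1..r}"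
            "real_of_int (MAX i\<in>{1..r}. \<bar>j i\<bar>) \<le> D * real N powr (1 / (real k - 1) - \<epsilon>)"
        have J: "\<bar>j 1\<bar> \<le> (MAX i\<in>{1..r}. \<bar>j i\<bar>)" "\<bar>j 2\<bar> \<le> (MAX i\<in>{1..r}. \<bar>j i\<bar>)"
          unfolding 1 sub by simp_all
        have R3: "R \<le> C * real N powr (\<theta> - \<epsilon>)" using R(3) by (simp add: 1)
        have j2: "real_of_int (MAX i\<in>{1..r}. \<bar>j i\<bar>) \<le> D * real N powr (1 - \<epsilon>)"
          using j(2) by (simp add: 1)
        have "j 1 \<noteq> j 2" using j(1) unfolding 1 sub by (auto simp: inj_on_def)
        hence "\<bar>(\<Sum>n=1..N. lambda_R R (int n + j 1) * Lambda (int n + j 2)) - singular_series 2 j * real N\<bar>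
          \<le> \<delta> * real N"
          by (rule elim(1)[rule_format, OF R(1,2) R3 _ J j2])
        \<comment> \<open>For k = r the power of log R is 1.\<close>
        hence "\<exists>\<eta>. \<bar>\<eta>\<bar> \<le> \<delta> \<and> (\<Sum>n=1..N. lambda_R R (int n + j 1) * Lambda (int n + j 2)) =
            (singular_series 2 j + \<eta>) * real N * 1"
          using elim(2) by (intro relative_error_witness) auto
        thus "\<exists>\<eta>::real. \<bar>\<eta>\<bar> \<le> \<delta> \<and>
          (\<Sum>n=1..N. (\<Prod>i=1..r-1. lambda_R R (int n + j i) ^ a i) * Lambda (int n + j r))
            = (singular_series r j + \<eta>) * real N * ln R ^ (k - r)"
          using a by (simp add: 1)
      qed
    qed
  next
    case 2
    have "a 1 \<ge> 1" "a 2 \<ge> 1" using assms(4) by (simp_all add: 2)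
    moreover have "a 1 + a 2 = 2" using assms(5,6) unfolding 2 sub by simp
    ultimately have a: "a 1 = 1" "a 2 = 1" by linarith+
    from correlation_k3_distinct[OF assms(9,8,10) pos] eventually_ge_at_top[of 1] show ?thesis
    proof eventually_elim
      case (elim N)
      show ?case
      proof (intro allI impI)
        fix R :: real and j :: "nat \<Rightarrow> int"
        assume R: "1 \<le> R" "c * real N powr \<epsilon> \<le> R" "R \<le> C * real N powr (\<theta> / (real k - 1) - \<epsilon>)"
          and j: "inj_on j {1..r}"
            "real_of_int (MAX i\<in>{1..r}. \<bar>j i\<bar>) \<le> D * real N powr (1 / (real k - 1) - \<epsilon>)"
        have J: "\<bar>j 1\<bar> \<le> (MAX i\<in>{1..r}. \<bar>j i\<bar>)" "\<bar>j 2\<bar> \<le> (MAX i\<in>{1..r}. \<bar>j i\<bar>)"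
          "\<bar>j 3\<bar> \<le> (MAX i\<in>{1..r}. \<bar>j i\<bar>)" unfolding 2 sub by simp_all
        have R3: "R \<le> C * real N powr (\<theta> / 2 - \<epsilon>)" using R(3) by (simp add: 2)
        \<comment> \<open>For k = 3 the shifts are of size at most N^(1/2 - \<epsilon>), inside the
          range N^(1 - \<epsilon>) in which the correlation lemmas are stated.\<close>
        have "D * real N powr (1 / (real k - 1) - \<epsilon>) \<le> D * real N powr (1 - \<epsilon>)"
          using pos elim(2) by (intro mult_left_mono powr_mono) (auto simp: 2)
        with j(2) have j2: "real_of_int (MAX i\<in>{1..r}. \<bar>j i\<bar>) \<le> D * real N powr (1 - \<epsilon>)" by linarith
        have "j 1 \<noteq> j 3" "j 2 \<noteq> j 3" "j 1 \<noteq> j 2" using j(1) unfolding 2 sub by (auto simp: inj_on_def)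
        hence "\<bar>(\<Sum>n=1..N. lambda_R R (int n + j 1) * lambda_R R (int n + j 2) * Lambda (int n + j 3))
           - singular_series 3 j * real N\<bar> \<le> \<delta> * real N"
          by (rule elim(1)[rule_format, OF R(1,2) R3 _ _ _ J j2])
        hence "\<exists>\<eta>. \<bar>\<eta>\<bar> \<le> \<delta> \<and> (\<Sum>n=1..N. lambda_R R (int n + j 1) * lambda_R R (int n + j 2) * Lambda (int n + j 3)) =
            (singular_series 3 j + \<eta>) * real N * 1"
          using elim(2) by (intro relative_error_witness) auto
        moreover have "(\<Prod>i=1..r-1. lambda_R R (int n + j i) ^ a i) =
            lambda_R R (int n + j 1) * lambda_R R (int n + j 2)" for n
        proof -
          have "{1..r-1} = {1, 2}" by (auto simp: 2)
          thus ?thesis using a by simp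
        qed
        ultimately show "\<exists>\<eta>::real. \<bar>\<eta>\<bar> \<le> \<delta> \<and>
          (\<Sum>n=1..N. (\<Prod>i=1..r-1. lambda_R R (int n + j i) ^ a i) * Lambda (int n + j r))
            = (singular_series r j + \<eta>) * real N * ln R ^ (k - r)"
          by (simp add: 2)
      qed
    qed
  next
    case 3
    have a: "a 1 = 2" using assms(5,6) unfolding 3 sub by simp
    from correlation_k3_square[OF assms(9,8,10) pos] eventually_ge_at_top[of 1] show ?thesis
    proof eventually_elim
      case (elim N)
      show ?case
      proof (intro allI impI)
        fix R :: real and j :: "nat \<Rightarrow> int"
        assume R: "1 \<le> R" "c * real N powr \<epsilon> \<le> R" "R \<le> C * real N powr (\<theta> / (real k - 1) - \<epsilon>)"
          and j: "inj_on j {1..r}"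
            "real_of_int (MAX i\<in>{1..r}. \<bar>j i\<bar>) \<le> D * real N powr (1 / (real k - 1) - \<epsilon>)"
        have J: "\<bar>j 1\<bar> \<le> (MAX i\<in>{1..r}. \<bar>j i\<bar>)" "\<bar>j 2\<bar> \<le> (MAX i\<in>{1..r}. \<bar>j i\<bar>)"
          unfolding 3 sub by simp_all
        have R3: "R \<le> C * real N powr (\<theta> / 2 - \<epsilon>)" using R(3) by (simp add: 3)
        have "D * real N powr (1 / (real k - 1) - \<epsilon>) \<le> D * real N powr (1 - \<epsilon>)"
          using pos elim(2) by (intro mult_left_mono powr_mono) (auto simp: 3)
        with j(2) have j2: "real_of_int (MAX i\<in>{1..r}. \<bar>j i\<bar>) \<le> D * real N powr (1 - \<epsilon>)" by linarith
        have "j 1 \<noteq> j 2" using j(1) unfolding 3 sub by (auto simp: inj_on_def)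
        hence "ln R > 0 \<and> \<bar>(\<Sum>n=1..N. lambda_R R (int n + j 1) ^ 2 * Lambda (int n + j 2)) -
            singular_series 2 j * real N * ln R\<bar> \<le> \<delta> * real N * ln R"
          by (rule elim(1)[rule_format, OF R(1,2) R3 _ J j2])
        hence "\<exists>\<eta>. \<bar>\<eta>\<bar> \<le> \<delta> \<and> (\<Sum>n=1..N. lambda_R R (int n + j 1) ^ 2 * Lambda (int n + j 2)) =
            (singular_series 2 j + \<eta>) * real N * ln R"
          using elim(2) by (intro relative_error_witness) auto
        thus "\<exists>\<eta>::real. \<bar>\<eta>\<bar> \<le> \<delta> \<and>
          (\<Sum>n=1..N. (\<Prod>i=1..r-1. lambda_R R (int n + j i) ^ a i) * Lambda (int n + j r))
            = (singular_series r j + \<eta>) * real N * ln R ^ (k - r)"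
          using a by (simp add: 3)
      qed
    qed
  qed
qed

end
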